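(* Fix $K\ge1$, the chain count $L_R\ge 2K$, and assume $N_R\ge 2L_R$. Let $$\mathcal{F}_{\mathrm{PS}}:=\{\mathbf{F}\in\mathbb{C}^{L_R\times N_R}:\ |[\mathbf{F}]_{\ell,n}|=1/\sqrt{N_R}\ \text{ for all }\ell,n\},$$ $$\mathcal{R}_{\mathrm{PS}}:=\{\operatorname{row}(\mathbf{F}):\mathbf{F}\in\mathcal{F}_{\mathrm{PS}},\ \operatorname{rank}(\mathbf{F})=L_R\}\subseteq\mathrm{Gr}(L_R,N_R).$$ Then: (i) (Löwner ordering) For every (full-row-rank) $\mathbf{F}\in\mathcal{F}_{\mathrm{PS}}$, $\mathbf{J}_{\mathrm{PS}}(\boldsymbol{\xi};\mathbf{F})\preceq\mathbf{J}_{\mathrm{dig}}(\boldsymbol{\xi})$ and $\mathrm{CRB}_{\mathrm{PS}}(\boldsymbol{\theta};\mathbf{F})\succeq\mathrm{CRB}_{\mathrm{dig}}(\boldsymbol{\theta})$, with equality if and only if $\operatorname{row}(\mathbf{F})\supseteq\mathcal{S}_K^\star(\boldsymbol{\theta})$. (ii) (Reach deficit on the Grassmannian) The set $\mathcal{R}_{\mathrm{PS}}$ of subspaces reachable as row spaces of phase-shifter combiners has at most $L_R(N_R-1)$ real degrees of freedom, falling short of $\dim_{\mathbb{R}}\mathrm{Gr}(L_R,N_R)=2L_R(N_R-L_R)$ by $$\Delta(L_R,N_R):=L_R(N_R-2L_R+1)>0.$$ In probabilistic terms, an $L_R$-dimensional subspace drawn uniformly at random from $\mathrm{Gr}(L_R,N_R)$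 falls outside $\mathcal{R}_{\mathrm{PS}}$ with probability one, so $\mathcal{R}_{\mathrm{PS}}$ occupies vanishing volume in the Grassmannian. (iii) (Generic strict gap) Fix any (full-row-rank) phase-shifter combiner $\mathbf{F}\in\mathcal{F}_{\mathrm{PS}}$. The steering curve $\theta\mapsto\mathbf{a}(\theta)$ meets the fixed proper subspace $\operatorname{row}(\mathbf{F})$ only at isolated angles, and therefore the target configurations $\boldsymbol{\theta}$ satisfying $\operatorname{row}(\mathbf{F})\supseteq\mathcal{S}_K^\star(\boldsymbol{\theta})$ form a measure-zero set. Hence, by (i), $\mathrm{CRB}_{\mathrm{PS}}(\boldsymbol{\theta};\mathbf{F})\succ\mathrm{CRB}_{\mathrm{dig}}(\boldsymbol{\theta})$ strictly for almost every $\boldsymbol{\theta}$, reducing for a single target ($K=1$) to $\mathrm{CRB}_{\mathrm{PS}}(\theta;\mathbf{F})>\mathrm{CRB}_{\mathrm{dig}}(\theta)$. By contrast, for every $\boldsymbol{\theta}$ a feasible MiLAC combiner $\mathbf{G}\in\mathcal{F}_{\mathrm{MiLAC}}\subseteq\mathbb{C}^{L_R\times N_R}$ can be chosen with $\operatorname{row}(\mathbf{G})\supseteq\mathcal{S}_K^\star(\boldsymbol{\theta})$, attaining $\mathrm{CRB}_{\mathrm{MiLAC}}(\boldsymbol{\theta};\mathbf{G})=\mathrm{CRB}_{\mathrm{dig}}(\boldsymbol{\theta})$ exactly.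
   Context: The array is the half-wavelength uniform linear array with steering vector $\mathbf{a}(\theta)\in\mathbb{C}^{N_R}$, $[\mathbf{a}(\theta)]_n=e^{j\pi n\sin\theta}$, $n=0,\dots,N_R-1$, and $\dot{\mathbf{a}}=\partial_\theta\mathbf{a}$. $\boldsymbol{\theta}=[\theta_1,\dots,\theta_K]^{\mathsf T}\in\mathbb{R}^K$ with distinct $\theta_k$; $\beta_1,\dots,\beta_K\in\mathbb{C}\setminus\{0\}$ fixed; $\mathbf{s}=(s_1,\dots,s_T)\in\mathbb{C}^T$ is a fixed known nonzero waveform; $\sigma^2>0$. $\mathcal{S}_K^\star(\boldsymbol{\theta}):=\operatorname{span}_{\mathbb{C}}\{\mathbf{a}(\theta_k),\dot{\mathbf{a}}(\theta_k)\}_{k=1}^K\subseteq\mathbb{C}^{N_R}$; standing non-degeneracy assumption on the target configurations considered: $\dim_{\mathbb{C}}\mathcal{S}_K^\star(\boldsymbol{\theta})=2K$. The real parameter vector is $\boldsymbol{\xi}=[\theta_1,\dots,\theta_K,\Re\beta_1,\Im\beta_1,\dots,\Re\beta_K,\Im\beta_K]^{\mathsf T}\in\mathbb{R}^{3K}$. "Almost every $\boldsymbol{\theta}$" and "measure zero" in (iii) refer to Lebesgue measure on the angle space. Let $\boldsymbol{\mu}_t=s_t\sum_{k}\beta_k\mathbf{a}(\theta_k)$, so $\partial_{\theta_k}\boldsymbol{\mu}_t=s_t\beta_k\dot{\mathbf{a}}(\theta_k)$, $\partial_{\Re\beta_k}\boldsymbol{\mu}_t=s_t\mathbf{a}(\theta_k)$,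 $\partial_{\Im\beta_k}\boldsymbol{\mu}_t=js_t\mathbf{a}(\theta_k)$. Let $\mathcal{J}_{\mathrm{dig}}\in\mathbb{C}^{TN_R\times3K}$ be the vertical stack over $t$ of $\partial\boldsymbol{\mu}_t/\partial\boldsymbol{\xi}$. Define $\mathbf{J}_{\mathrm{dig}}(\boldsymbol{\xi})=\frac{2}{\sigma^2}\Re\{\mathcal{J}_{\mathrm{dig}}^{\mathsf H}\mathcal{J}_{\mathrm{dig}}\}$ and, for a full-row-rank combiner $\mathbf{M}\in\mathbb{C}^{L_R\times N_R}$, $$\mathbf{J}(\boldsymbol{\xi};\mathbf{M})=\frac{2}{\sigma^2}\Re\bigl\{\mathcal{J}_{\mathrm{dig}}^{\mathsf H}\bigl(\mathbf{I}_T\otimes\mathbf{M}^{\mathsf H}(\mathbf{M}\mathbf{M}^{\mathsf H})^{-1}\mathbf{M}\bigr)\mathcal{J}_{\mathrm{dig}}\bigr\},$$ the Fisher information matrix about $\boldsymbol{\xi}$ in $\mathbf{M}(\boldsymbol{\mu}_t+\mathbf{n}_t)$, $\mathbf{n}_t\sim\mathcal{CN}(\mathbf{0},\sigma^2\mathbf{I}_{N_R})$ independent over $t=1,\dots,T$. Write $\mathbf{J}_{\mathrm{PS}}(\boldsymbol{\xi};\mathbf{F})=\mathbf{J}(\boldsymbol{\xi};\mathbf{F})$ for $\mathbf{F}\in\mathcal{F}_{\mathrm{PS}}$ and $\mathbf{J}_{\mathrm{MiLAC}}(\boldsymbol{\xi};\mathbf{G})=\mathbf{J}(\boldsymbol{\xi};\mathbf{G})$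 for $\mathbf{G}\in\mathcal{F}_{\mathrm{MiLAC}}$. For a $3K\times3K$ information matrix $\mathbf{J}$ partitioned into angle block $\mathbf{J}_{\theta\theta}$ ($K\times K$), amplitude block $\mathbf{J}_{\beta\beta}$ ($2K\times2K$) and cross blocks, the corresponding $\mathrm{CRB}(\boldsymbol{\theta})$ is $(\mathbf{J}_{\theta\theta}-\mathbf{J}_{\theta\beta}\mathbf{J}_{\beta\beta}^{-1}\mathbf{J}_{\beta\theta})^{-1}$, considered when $\mathbf{J}_{\beta\beta}$ is invertible and the Schur complement is positive definite; subscripts dig, PS, MiLAC indicate which information matrix is used. $\mathcal{F}_{\mathrm{MiLAC}}$ (the combiners realizable by a lossless reciprocal microwave linear analog computer, MiLAC) is the set of $\mathbf{G}\in\mathbb{C}^{L_R\times N_R}$ that occur as the lower-left $L_R\times N_R$ block of some symmetric unitary $\boldsymbol{\Theta}\in\mathbb{C}^{(N_R+L_R)\times(N_R+L_R)}$ ($\boldsymbol{\Theta}^{\mathsf H}\boldsymbol{\Theta}=\mathbf{I}$, $\boldsymbol{\Theta}^{\mathsf T}=\boldsymbol{\Theta}$). Conventions: $\operatorname{row}(\mathbf{M}):=\operatorname{col}(\mathbf{M}^{\mathsf H})$; $\mathrm{Gr}(L_R,N_R)$ is the Grassmannian of $L_R$-dimensional complex subspaces of $\mathbb{C}^{N_R}$ (uniform measure: the unitarily invariant probability measure); $\mathbf{A}\preceq\mathbf{B}$ (resp. $\mathbf{A}\prec\mathbf{B}$) means $\mathbf{B}-\mathbf{A}$ is positive semidefinite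 (resp. positive definite).
   Formalization: In (i), "equality iff row(F) ⊇ S*" is proved for the information matrices, and for both equalities jointly; that equality of the CRBs alone forces row(F) ⊇ S* is dropped, since it fails (e.g. K=1, L_R=2, N_R=4, θ=0). *)

theory Defs
  imports "HOL-Probability.Probability"
begin

section \<open>Matrices\<close>

definition hconj :: "complex^'n^'m \<Rightarrow> complex^'m^'n" where
  "hconj A = (\<chi> i j. cnj (A $ j $ i))"

definition Re_mat :: "complex^'n^'m \<Rightarrow> real^'n^'m" where
  "Re_mat A = (\<chi> i j. Re (A $ i $ j))"

definition kron :: "complex^'b^'a \<Rightarrow> complex^'d^'c \<Rightarrow> complex^('b \<times> 'd)^('a \<times> 'c)" where
  "kron A B = (\<chi> i j. A $ fst i $ fst j * B $ snd i $ snd j)"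

definition pos_semidef :: "real^'n^'n \<Rightarrow> bool" where
  "pos_semidef A \<longleftrightarrow> transpose A = A \<and> (\<forall>x. 0 \<le> x \<bullet> (A *v x))"

definition pos_def :: "real^'n^'n \<Rightarrow> bool" where
  "pos_def A \<longleftrightarrow> transpose A = A \<and> (\<forall>x. x \<noteq> 0 \<longrightarrow> 0 < x \<bullet> (A *v x))"

text \<open>The names \<open>span\<close>, \<open>dim\<close>, \<open>subspace\<close> refer to real scalars; the versions qualified with
  \<open>vec\<close> are the complex-linear ones on vectors with complex entries.\<close>

definition col_space :: "complex^'n^'m \<Rightarrow> (complex^'m) set" where
  "col_space A = vec.span (columns A)"

definition row_space :: "complex^'n^'m \<Rightarrow> (complex^'n) set" where
  "row_space M = col_space (hconj M)"

section \<open>Array and signal model\<close>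

text \<open>The finite type \<open>'n\<close> indexes the antennas; \<open>pos\<close> is the enumeration of the antennas by
  \<open>0, \<dots>, CARD('n) - 1\<close>.\<close>

definition steer :: "('n::finite \<Rightarrow> nat) \<Rightarrow> real \<Rightarrow> complex^'n" where
  "steer pos \<theta> = (\<chi> n. exp (\<i> * complex_of_real (pi * real (pos n) * sin \<theta>)))"

definition dsteer :: "('n::finite \<Rightarrow> nat) \<Rightarrow> real \<Rightarrow> complex^'n" where
  "dsteer pos \<theta> = vector_derivative (steer pos) (at \<theta>)"

definition target_space :: "('n::finite \<Rightarrow> nat) \<Rightarrow> real^'k \<Rightarrow> (complex^'n) set" where
  "target_space pos \<theta> =
     vec.span (range (\<lambda>k. steer pos (\<theta> $ k)) \<union> range (\<lambda>k. dsteer pos (\<theta> $ k)))"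

definition admissible :: "('n::finite \<Rightarrow> nat) \<Rightarrow> real^'k \<Rightarrow> bool" where
  "admissible pos \<theta> \<longleftrightarrow>
     inj (\<lambda>k. \<theta> $ k) \<and> vec.dim (target_space pos \<theta>) = 2 * CARD('k)"

text \<open>The \<open>3K\<close> real parameters are indexed by a disjoint sum: \<open>Inl k\<close> is the angle of target \<open>k\<close>,
  \<open>Inr (Inl k)\<close> and \<open>Inr (Inr k)\<close> are the real and imaginary parts of its amplitude.\<close>

definition param_vec :: "real^'k \<Rightarrow> complex^'k \<Rightarrow> real^('k + ('k + 'k))" where
  "param_vec \<theta> \<beta> = (\<chi> p. case p of
      Inl k \<Rightarrow> \<theta> $ k
    | Inr (Inl k) \<Rightarrow> Re (\<beta> $ k)
    | Inr (Inr k) \<Rightarrow> Im (\<beta> $ k))"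

definition mean_vec ::
  "('n::finite \<Rightarrow> nat) \<Rightarrow> complex^'t::finite \<Rightarrow> real^('k::finite + ('k + 'k)) \<Rightarrow> 't \<Rightarrow> complex^'n" where
  "mean_vec pos s \<xi> t =
     s $ t *s (\<Sum>k\<in>UNIV. Complex (\<xi> $ Inr (Inl k)) (\<xi> $ Inr (Inr k)) *s steer pos (\<xi> $ Inl k))"

text \<open>The vertical stack over \<open>t\<close> is indexed by pairs of a snapshot and an antenna; column \<open>p\<close>
  holds the partial derivatives in the coordinate \<open>p\<close>.\<close>

definition jacobian ::
  "('n::finite \<Rightarrow> nat) \<Rightarrow> complex^'t::finite \<Rightarrow> real^('k::finite + ('k + 'k)) \<Rightarrow>
     complex^('k + ('k + 'k))^('t \<times> 'n)" where
  "jacobian pos s \<xi> = (\<chi> r p.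
     vector_derivative (\<lambda>x. mean_vec pos s (\<chi> q. if q = p then x else \<xi> $ q) (fst r) $ snd r)
       (at (\<xi> $ p)))"

definition fim_dig ::
  "('n::finite \<Rightarrow> nat) \<Rightarrow> complex^'t::finite \<Rightarrow> real \<Rightarrow> real^('k::finite + ('k + 'k)) \<Rightarrow>
     real^('k + ('k + 'k))^('k + ('k + 'k))" where
  "fim_dig pos s var \<xi> =
     (2 / var) *\<^sub>R Re_mat (hconj (jacobian pos s \<xi>) ** jacobian pos s \<xi>)"

definition fim ::
  "('n::finite \<Rightarrow> nat) \<Rightarrow> complex^'t::finite \<Rightarrow> real \<Rightarrow> real^('k::finite + ('k + 'k)) \<Rightarrow>
     complex^'n^'l \<Rightarrow> real^('k + ('k + 'k))^('k + ('k + 'k))" where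
  "fim pos s var \<xi> M =
     (2 / var) *\<^sub>R Re_mat (hconj (jacobian pos s \<xi>)
        ** kron (mat 1 :: complex^'t^'t) (hconj M ** matrix_inv (M ** hconj M) ** M)
        ** jacobian pos s \<xi>)"

section \<open>Cramer-Rao bound for the angles\<close>

definition amp_block :: "real^('k::finite + 'b::finite)^('k + 'b) \<Rightarrow> real^'b^'b" where
  "amp_block J = (\<chi> i j. J $ Inr i $ Inr j)"

definition schur_angle :: "real^('k::finite + 'b::finite)^('k + 'b) \<Rightarrow> real^'k^'k" where
  "schur_angle J =
     (\<chi> i j. J $ Inl i $ Inl j)
     - (\<chi> i j. J $ Inl i $ Inr j) ** matrix_inv (amp_block J) ** (\<chi> i j. J $ Inr i $ Inl j)"

definition crb :: "real^('k::finite + 'b::finite)^('k + 'b) \<Rightarrow> real^'k^'k" where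
  "crb J = matrix_inv (schur_angle J)"

text \<open>\<open>matrix_inv\<close> is total, so \<open>crb J\<close> is the bound only under the following condition.\<close>

definition crb_defined :: "real^('k::finite + 'b::finite)^('k + 'b) \<Rightarrow> bool" where
  "crb_defined J \<longleftrightarrow> invertible (amp_block J) \<and> pos_def (schur_angle J)"

section \<open>Combiners\<close>

definition F_PS :: "(complex^'n^'l) set" where
  "F_PS = {F. \<forall>l n. cmod (F $ l $ n) = 1 / sqrt (real CARD('n))}"

definition R_PS :: "'l::finite itself \<Rightarrow> (complex^'n) set set" where
  "R_PS _ = {row_space F | F :: complex^'n^'l. F \<in> F_PS \<and> rank F = CARD('l)}"

text \<open>With antennas \<open>Inl\<close> listed before chains \<open>Inr\<close>, the lower-left block has rows \<open>Inr\<close> and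
  columns \<open>Inl\<close>.\<close>

definition F_MiLAC :: "(complex^'n^'l) set" where
  "F_MiLAC = {G. \<exists>\<Theta> :: complex^('n + 'l)^('n + 'l).
     hconj \<Theta> ** \<Theta> = mat 1 \<and> transpose \<Theta> = \<Theta> \<and> G = (\<chi> l n. \<Theta> $ Inr l $ Inl n)}"

section \<open>The Grassmannian\<close>

definition grassmannian :: "nat \<Rightarrow> (complex^'n) set set" where
  "grassmannian L = {V. vec.subspace V \<and> vec.dim V = L}"

definition orth_proj :: "(complex^'n) set \<Rightarrow> complex^'n^'n" where
  "orth_proj V = (THE P. hconj P = P \<and> P ** P = P \<and> range ((*v) P) = V)"

definition gr_topology :: "nat \<Rightarrow> (complex^'n) set topology" where
  "gr_topology L = pullback_topology (grassmannian L) orth_proj euclidean"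

definition manifold_dim :: "'a topology \<Rightarrow> nat \<Rightarrow> bool" where
  "manifold_dim X d \<longleftrightarrow> Hausdorff_space X \<and>
     (\<forall>x\<in>topspace X. \<exists>U V. openin X U \<and> x \<in> U \<and> openin (Euclidean_space d) V \<and>
        subtopology X U homeomorphic_space subtopology (Euclidean_space d) V)"

text \<open>A set of \<open>CARD('l)\<close>-dimensional subspaces has at most \<open>DIM('p)\<close> real degrees of freedom if it
  is covered by a continuously differentiable map into the Grassmannian that is defined on an open
  subset of the parameter space \<open>'p\<close>. The map is given by a frame: the subspace at \<open>x\<close> is the
  column space of the full-rank matrix \<open>B x\<close>.\<close>

definition real_dof_at_most ::
  "'p::euclidean_space itself \<Rightarrow> 'l::finite itself \<Rightarrow> (complex^'n) set set \<Rightarrow> bool" where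
  "real_dof_at_most _ _ R \<longleftrightarrow>
     (\<exists>(D :: 'p set) (B :: 'p \<Rightarrow> complex^'l^'n) (B' :: 'p \<Rightarrow> 'p \<Rightarrow>\<^sub>L (complex^'l^'n)).
        open D \<and> (\<forall>x\<in>D. (B has_derivative blinfun_apply (B' x)) (at x)) \<and> continuous_on D B' \<and>
        (\<forall>x\<in>D. rank (B x) = CARD('l)) \<and>
        R \<subseteq> (\<lambda>x. col_space (B x)) ` D)"

text \<open>The uniform measure is characterised as the unitarily invariant Borel probability measure.\<close>

definition gr_uniform :: "nat \<Rightarrow> (complex^'n) set measure \<Rightarrow> bool" where
  "gr_uniform L \<mu> \<longleftrightarrow>
     prob_space \<mu> \<and> space \<mu> = grassmannian L \<and>
     sets \<mu> = sigma_sets (grassmannian L) {U. openin (gr_topology L) U} \<and>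
     (\<forall>Q :: complex^'n^'n. hconj Q ** Q = mat 1 \<longrightarrow> distr \<mu> \<mu> (\<lambda>V. (*v) Q ` V) = \<mu>)"

definition reach_deficit :: "nat \<Rightarrow> nat \<Rightarrow> int" where
  "reach_deficit L N = int L * (int N - 2 * int L + 1)"

section \<open>Closed forms of the derivatives\<close>

lemma has_vector_derivative_steer_nth:
  "((\<lambda>x. steer pos x $ n) has_vector_derivative
      \<i> * complex_of_real (pi * real (pos n) * cos \<theta>) * steer pos \<theta> $ n) (at \<theta>)"
proof -
  have 1: "((\<lambda>x. \<i> * complex_of_real (pi * real (pos n) * sin x)) has_vector_derivative
          \<i> * complex_of_real (pi * real (pos n) * cos \<theta>)) (at \<theta>)"
    by (auto intro!: derivative_eq_intros has_vector_derivative_of_real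
        simp flip: has_real_derivative_iff_has_vector_derivative)
  show ?thesis
    using field_vector_diff_chain_at[OF 1 DERIV_exp]
    by (simp add: steer_def o_def)
qed

lemma has_vector_derivative_steer:
  fixes pos :: "'n::finite \<Rightarrow> nat"
  shows "(steer pos has_vector_derivative
      (\<chi> n. \<i> * complex_of_real (pi * real (pos n) * cos \<theta>) * steer pos \<theta> $ n)) (at \<theta>)"
proof -
  have "((\<lambda>x. (\<Sum>n\<in>UNIV. axis n (steer pos x $ n))) has_vector_derivative
      (\<Sum>n\<in>UNIV. axis n (\<i> * complex_of_real (pi * real (pos n) * cos \<theta>) * steer pos \<theta> $ n))) (at \<theta>)"
  proof (rule has_vector_derivative_sum)
    fix n :: 'n
    have "bounded_linear (axis n :: complex \<Rightarrow> complex^'n)"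
      unfolding linear_conv_bounded_linear[symmetric]
      by (auto intro!: linearI simp: axis_def vec_eq_iff)
    from bounded_linear.has_vector_derivative[OF this has_vector_derivative_steer_nth]
    show "((\<lambda>x. axis n (steer pos x $ n)) has_vector_derivative
        axis n (\<i> * complex_of_real (pi * real (pos n) * cos \<theta>) * steer pos \<theta> $ n)) (at \<theta>)" .
  qed
  moreover have "(\<Sum>n\<in>UNIV. axis n (v $ n)) = v" for v :: "complex^'n"
    by (simp add: vec_eq_iff axis_def)
  moreover have "(\<Sum>n\<in>UNIV. axis n (f n)) = (\<chi> n. f n)" for f :: "'n \<Rightarrow> complex"
    by (simp add: vec_eq_iff axis_def)
  ultimately show ?thesis
    by simp
qed

lemma dsteer_nth:
  "dsteer pos \<theta> $ n = \<i> * complex_of_real (pi * real (pos n) * cos \<theta>) * steer pos \<theta> $ n"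
  by (simp add: dsteer_def vector_derivative_at[OF has_vector_derivative_steer])

lemma jacobian_angle:
  "jacobian pos s (param_vec \<theta> \<beta>) $ r $ Inl k = s $ fst r * \<beta> $ k * dsteer pos (\<theta> $ k) $ snd r"
proof -
  have "((\<lambda>x. \<Sum>j\<in>UNIV. \<beta> $ j * steer pos (if j = k then x else \<theta> $ j) $ snd r)
      has_vector_derivative
      (\<Sum>j\<in>UNIV. if j = k then \<beta> $ j * dsteer pos (\<theta> $ k) $ snd r else 0)) (at (\<theta> $ k))"
  proof (rule has_vector_derivative_sum)
    fix j
    show "((\<lambda>x. \<beta> $ j * steer pos (if j = k then x else \<theta> $ j) $ snd r) has_vector_derivative
        (if j = k then \<beta> $ j * dsteer pos (\<theta> $ k) $ snd r else 0)) (at (\<theta> $ k))"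
      by (cases "j = k")
        (simp_all add: dsteer_nth has_vector_derivative_mult_right
          has_vector_derivative_steer_nth del: of_real_mult)
  qed
  then have "((\<lambda>x. s $ fst r * (\<Sum>j\<in>UNIV. \<beta> $ j * steer pos (if j = k then x else \<theta> $ j) $ snd r))
      has_vector_derivative s $ fst r * (\<beta> $ k * dsteer pos (\<theta> $ k) $ snd r)) (at (\<theta> $ k))"
    by (intro has_vector_derivative_mult_right) simp
  then show ?thesis
    by (simp add: jacobian_def mean_vec_def param_vec_def vector_derivative_at mult.assoc cong: if_cong)
qed

lemma jacobian_Re:
  "jacobian pos s (param_vec \<theta> \<beta>) $ r $ Inr (Inl k) = s $ fst r * steer pos (\<theta> $ k) $ snd r"
proof -
  let ?b = "\<lambda>x j. Complex (if j = k then x else Re (\<beta> $ j)) (Im (\<beta> $ j))"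
  have "((\<lambda>x. \<Sum>j\<in>UNIV. ?b x j * steer pos (\<theta> $ j) $ snd r) has_vector_derivative
      (\<Sum>j\<in>UNIV. if j = k then steer pos (\<theta> $ k) $ snd r else 0)) (at (Re (\<beta> $ k)))"
  proof (rule has_vector_derivative_sum)
    fix j
    have "((\<lambda>x. (complex_of_real x + \<i> * Im (\<beta> $ j)) * steer pos (\<theta> $ k) $ snd r)
        has_vector_derivative (1 + 0) * steer pos (\<theta> $ k) $ snd r) (at (Re (\<beta> $ k)))"
      by (intro has_vector_derivative_mult_left has_vector_derivative_add
          has_vector_derivative_const has_vector_derivative_of_real[where D = 1, simplified] DERIV_ident)
    then show "((\<lambda>x. ?b x j * steer pos (\<theta> $ j) $ snd r) has_vector_derivative
        (if j = k then steer pos (\<theta> $ k) $ snd r else 0)) (at (Re (\<beta> $ k)))"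
      by (cases "j = k") (auto simp: Complex_eq)
  qed
  then have "((\<lambda>x. s $ fst r * (\<Sum>j\<in>UNIV. ?b x j * steer pos (\<theta> $ j) $ snd r))
      has_vector_derivative s $ fst r * (steer pos (\<theta> $ k) $ snd r)) (at (Re (\<beta> $ k)))"
    by (intro has_vector_derivative_mult_right) simp
  then show ?thesis
    by (simp add: jacobian_def mean_vec_def param_vec_def vector_derivative_at cong: if_cong)
qed

lemma jacobian_Im:
  "jacobian pos s (param_vec \<theta> \<beta>) $ r $ Inr (Inr k) =
     \<i> * s $ fst r * steer pos (\<theta> $ k) $ snd r"
proof -
  let ?b = "\<lambda>x j. Complex (Re (\<beta> $ j)) (if j = k then x else Im (\<beta> $ j))"
  have "((\<lambda>x. \<Sum>j\<in>UNIV. ?b x j * steer pos (\<theta> $ j) $ snd r) has_vector_derivative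
      (\<Sum>j\<in>UNIV. if j = k then \<i> * steer pos (\<theta> $ k) $ snd r else 0)) (at (Im (\<beta> $ k)))"
  proof (rule has_vector_derivative_sum)
    fix j
    have "((\<lambda>x. (complex_of_real (Re (\<beta> $ j)) + \<i> * complex_of_real x) * steer pos (\<theta> $ k) $ snd r)
        has_vector_derivative (0 + \<i> * 1) * steer pos (\<theta> $ k) $ snd r) (at (Im (\<beta> $ k)))"
      by (intro has_vector_derivative_mult_left has_vector_derivative_mult_right
          has_vector_derivative_add has_vector_derivative_const
          has_vector_derivative_of_real[where D = 1, simplified] DERIV_ident)
    then show "((\<lambda>x. ?b x j * steer pos (\<theta> $ j) $ snd r) has_vector_derivative
        (if j = k then \<i> * steer pos (\<theta> $ k) $ snd r else 0)) (at (Im (\<beta> $ k)))"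
      by (cases "j = k") (auto simp: Complex_eq)
  qed
  then have "((\<lambda>x. s $ fst r * (\<Sum>j\<in>UNIV. ?b x j * steer pos (\<theta> $ j) $ snd r))
      has_vector_derivative s $ fst r * (\<i> * steer pos (\<theta> $ k) $ snd r)) (at (Im (\<beta> $ k)))"
    by (intro has_vector_derivative_mult_right) simp
  then show ?thesis
    by (simp add: jacobian_def mean_vec_def param_vec_def vector_derivative_at mult_ac cong: if_cong)
qed

end

theory Submission
  imports Defs "HOL-Complex_Analysis.Conformal_Mappings"
begin

text \<open>All Fisher information matrices are Gram matrices: with \<open>P\<close> the orthogonal projection onto the
  row space of the combiner, the quadratic form of \<open>fim\<close> is a multiple of \<open>\<parallel>P w\<parallel>\<^sup>2\<close>, where \<open>w\<close> runs
  through the combinations of the derivatives of the mean, and \<open>fim_dig\<close> is the case \<open>P = 1\<close>. The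
  Schur complement is the partial minimum of the quadratic form, so it is monotone and the bound is
  antitone.

  For a complex subspace \<open>X\<close> of dimension at least \<open>2 K\<close>, the vectors \<open>a(\<theta>\<^sub>k), a'(\<theta>\<^sub>k)\<close> are linearly
  independent as functionals on \<open>X\<close> for almost every \<open>\<theta>\<close>: adding one target at a time, the exceptional
  values of the new angle are zeros of the Wronskian of two independent polynomials. Taking for \<open>X\<close>
  the row space and its orthogonal complement gives the definedness of the bound and its strictness.

  A phase-shifter row space contains a vector with entries of equal modulus. Such vectors form, up to
  phase, a torus of dimension \<open>N - 1\<close>, while a random subspace comes within \<open>\<epsilon>\<close> of a given vector with
  probability of order \<open>\<epsilon> ^ (2 (N - L))\<close>, and \<open>2 (N - L) \<ge> N\<close>. So covering the torus by balls of
  radius \<open>\<epsilon>\<close> shows that the reachable set is null.\<close>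

section \<open>The complex inner product\<close>

text \<open>Strictness in (iii) is asked in the sense of \<open>pos_def\<close>, and for that it is
  not enough that the row space fails to contain the target space: no nonzero combination of the
  derivatives may lie in it. So the null set that is excluded is larger than the one named in the
  statement; it is where the target vectors become dependent modulo the row space. A second null set
  is excluded because a combiner may destroy identifiability even when the digital bound exists; off
  it the bound of the combiner is defined as well. The assumption that there are at least twice as
  many antennas as chains enters both in the exponent of the measure estimate and here: it leaves
  the orthogonal complement of the row space with dimension at least \<open>L \<ge> 2 K\<close>. The
  uniform measure is known only through its invariance, so its small-ball estimate is transferred
  from Lebesgue measure by averaging over vectors rather than computed in a chart.\<close>

definition hinner :: "complex^'n \<Rightarrow> complex^'n \<Rightarrow> complex" where
  "hinner u v = (\<Sum>i\<in>UNIV. cnj (u $ i) * v $ i)"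

lemma hinner_add_right: "hinner u (v + w) = hinner u v + hinner u w"
  and hinner_add_left: "hinner (v + w) u = hinner v u + hinner w u"
  and hinner_diff_right: "hinner u (v - w) = hinner u v - hinner u w"
  and hinner_diff_left: "hinner (v - w) u = hinner v u - hinner w u"
  and hinner_scale_right: "hinner u (c *s v) = c * hinner u v"
  and hinner_scale_left: "hinner (c *s v) u = cnj c * hinner v u"
  and hinner_0_right [simp]: "hinner u 0 = 0"
  and hinner_0_left [simp]: "hinner 0 u = 0"
  by (simp_all add: hinner_def algebra_simps sum.distrib sum_subtractf sum_distrib_left)

lemma hinner_sum_right: "hinner u (\<Sum>a\<in>A. f a) = (\<Sum>a\<in>A. hinner u (f a))"
  by (induction A rule: infinite_finite_induct) (auto simp: hinner_add_right)

lemma cnj_hinner: "cnj (hinner u v) = hinner v u"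
  by (simp add: hinner_def mult.commute)

lemma hinner_self: "hinner u u = of_real ((norm u)\<^sup>2)"
proof -
  have "(norm u)\<^sup>2 = (\<Sum>i\<in>UNIV. (cmod (u $ i))\<^sup>2)"
    by (simp add: norm_vec_def L2_set_def sum_nonneg)
  then show ?thesis
    by (simp add: hinner_def complex_norm_square mult.commute del: of_real_power)
qed

lemma Re_hinner: "Re (hinner u v) = u \<bullet> v"
  by (simp add: hinner_def inner_vec_def inner_complex_def)

lemma hinner_self_eq_0 [simp]: "hinner u u = 0 \<longleftrightarrow> u = 0"
  by (simp add: hinner_self)

lemma hconj_nth [simp]: "hconj A $ i $ j = cnj (A $ j $ i)"
  by (simp add: hconj_def)

lemma hconj_hconj [simp]: "hconj (hconj A) = A"
  by (simp add: vec_eq_iff)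

lemma hconj_mult: "hconj (A ** B) = hconj B ** hconj A"
  by (simp add: vec_eq_iff matrix_matrix_mult_def mult.commute)

lemma hconj_mat_1 [simp]: "hconj (mat 1) = mat 1"
  by (simp add: vec_eq_iff mat_def)

lemma hconj_diff: "hconj (A - B) = hconj A - hconj B"
  by (simp add: vec_eq_iff)

lemma hinner_mult_left: "hinner (A *v u) v = hinner u (hconj A *v v)"
  unfolding hinner_def matrix_vector_mult_def
  by (simp add: sum_distrib_left sum_distrib_right mult_ac) (rule sum.swap)

lemma norm_mult_unitary:
  assumes "hconj Q ** Q = mat 1"
  shows "norm (Q *v x) = norm x"
proof -
  have "hinner (Q *v x) (Q *v x) = hinner x x"
    by (simp add: hinner_mult_left matrix_vector_mul_assoc assms)
  then have "(norm (Q *v x))\<^sup>2 = (norm x)\<^sup>2"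
    by (simp add: hinner_self del: of_real_power)
  then show ?thesis by simp
qed

lemma matrix_vector_mult_scale: "(A :: 'a::comm_semiring_1^'n^'m) *v (c *s v) = c *s (A *v v)"
  by (simp add: vec_eq_iff matrix_vector_mult_def sum_distrib_left mult_ac)

lemma matrix_vector_mult_sum: "(A :: 'a::comm_ring_1^'n^'m) *v (\<Sum>a\<in>S. f a) = (\<Sum>a\<in>S. A *v f a)"
  by (induction S rule: infinite_finite_induct) (auto simp: matrix_vector_right_distrib)

section \<open>Independent families\<close>

text \<open>Independence of a family, not of its range as a set: a repeated vector already lowers
  the dimension below the number of indices, so equality forces injectivity.\<close>

lemma dim_range_eq_card_iff:
  fixes f :: "'i::finite \<Rightarrow> 'a::field^'n"
  shows "vec.dim (range f) = CARD('i) \<longleftrightarrow>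
    (\<forall>c. (\<Sum>i\<in>UNIV. c i *s f i) = 0 \<longrightarrow> (\<forall>i. c i = 0))"
proof
  assume *: "vec.dim (range f) = CARD('i)"
  have "card (range f) \<le> CARD('i)" "vec.dim (range f) \<le> card (range f)"
    by (auto intro: card_image_le vec.dim_le_card')
  then have card: "card (range f) = CARD('i)" using * by simp
  then have inj: "inj f" by (simp add: eq_card_imp_inj_on)
  have ind: "vec.independent (range f)"
    by (rule vec.card_le_dim_spanning[where V="vec.span (range f)"])
      (use * card in \<open>auto simp: vec.span_superset\<close>)
  show "\<forall>c. (\<Sum>i\<in>UNIV. c i *s f i) = 0 \<longrightarrow> (\<forall>i. c i = 0)"
  proof (intro allI impI)
    fix c i assume "(\<Sum>i\<in>UNIV. c i *s f i) = 0"
    then have "(\<Sum>v\<in>range f. c (inv f v) *s v) = 0"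
      by (simp add: sum.reindex[OF inj] inj)
    with ind have "c (inv f (f i)) = 0"
      using vec.independentD[OF ind, of "range f" "\<lambda>v. c (inv f v)" "f i"] by auto
    then show "c i = 0" using inj by simp
  qed
next
  assume *: "\<forall>c. (\<Sum>i\<in>UNIV. c i *s f i) = 0 \<longrightarrow> (\<forall>i. c i = 0)"
  have inj: "inj f"
  proof
    fix i j assume ij: "f i = f j"
    show "i = j"
    proof (rule ccontr)
      assume "i \<noteq> j"
      then have "(\<Sum>k\<in>UNIV. (if k = i then 1 else if k = j then -1 else 0) *s f k)
         = (\<Sum>k\<in>UNIV. (if k = i then f i else 0) - (if k = j then f i else 0))"
        using ij by (intro sum.cong) auto
      also have "\<dots> = 0" by (simp add: sum_subtractf)
      finally show False
        using spec[OF *, of "\<lambda>k. if k = i then 1 else if k = j then -1 else 0"]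
        by (metis (mono_tags, lifting) zero_neq_one)
    qed
  qed
  have "vec.independent (range f)"
  proof (rule vec.independent_if_scalars_zero)
    fix c x assume s: "(\<Sum>x\<in>range f. c x *s x) = 0" and "x \<in> range f"
    then obtain i where "x = f i" by auto
    have "(\<Sum>i\<in>UNIV. c (f i) *s f i) = 0" using s by (simp add: sum.reindex[OF inj])
    then show "c x = 0" using * \<open>x = f i\<close> by auto
  qed auto
  then show "vec.dim (range f) = CARD('i)"
    by (simp add: vec.dim_eq_card_independent card_image inj)
qed

lemma col_space_eq_range:
  fixes A :: "complex^'l^'n"
  shows "col_space A = range ((*v) A)"
proof -
  have ax: "A *v axis i 1 = column i A" for i
    by (simp add: vec_eq_iff matrix_vector_mult_def column_def axis_def if_distrib cong: if_cong)
  have *: "columns A = (*v) A ` cart_basis"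
    unfolding columns_def cart_basis_def by (auto simp flip: ax)
  show ?thesis
    unfolding col_space_def * vec.span_image span_cart_basis ..
qed

lemma subspace_col_space: "vec.subspace (col_space A)"
  by (simp add: col_space_def)

lemma dim_col_space:
  fixes A :: "complex^'l^'n"
  shows "vec.dim (col_space A) = CARD('l) \<longleftrightarrow> (\<forall>x. A *v x = 0 \<longrightarrow> x = 0)"
proof -
  have "columns A = range (\<lambda>i. column i A)" by (auto simp: columns_def)
  then have "vec.dim (col_space A) = CARD('l) \<longleftrightarrow>
     (\<forall>c. (\<Sum>i\<in>UNIV. c i *s column i A) = 0 \<longrightarrow> (\<forall>i. c i = 0))"
    by (simp only: col_space_def vec.dim_span dim_range_eq_card_iff)
  also have "\<dots> \<longleftrightarrow> (\<forall>x. A *v x = 0 \<longrightarrow> x = 0)"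
    by (rule trans[OF matrix_left_invertible_independent_columns[symmetric] matrix_left_invertible_ker])
  finally show ?thesis .
qed

text \<open>Relations between the rows become kernel vectors of \<open>hconj F\<close> after
  conjugating the coefficients. The kernel form fits \<open>row_space\<close>, which is the column
  space of \<open>hconj F\<close>.\<close>

lemma full_row_rank_iff:
  fixes F :: "complex^'n^'l"
  shows "rank F = CARD('l) \<longleftrightarrow> (\<forall>x. hconj F *v x = 0 \<longrightarrow> x = 0)"
proof -
  have "rows F = range (\<lambda>i. row i F)" by (auto simp: rows_def)
  then have "rank F = CARD('l) \<longleftrightarrow> 
     (\<forall>c. (\<Sum>i\<in>UNIV. c i *s row i F) = 0 \<longrightarrow> (\<forall>i. c i = 0))"
    by (simp only: row_rank_def_gen dim_range_eq_card_iff)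
  also have "\<dots> \<longleftrightarrow> (\<forall>x. hconj F *v x = 0 \<longrightarrow> x = 0)"
  proof safe
    fix x assume *: "\<forall>c. (\<Sum>i\<in>UNIV. c i *s row i F) = 0 \<longrightarrow> (\<forall>i. c i = 0)" "hconj F *v x = 0"
    have "(\<Sum>i\<in>UNIV. cnj (x $ i) *s row i F) $ j = cnj ((hconj F *v x) $ j)" for j
      by (simp add: matrix_vector_mult_def row_def mult.commute)
    then have "(\<Sum>i\<in>UNIV. cnj (x $ i) *s row i F) = 0" using *(2) by (simp add: vec_eq_iff)
    with *(1) have "\<forall>i. cnj (x $ i) = 0" by (rule_tac allE[OF *(1), of "\<lambda>i. cnj (x $ i)"]) blast
    then show "x = 0" by (simp add: vec_eq_iff)
  next
    fix c i assume *: "\<forall>x. hconj F *v x = 0 \<longrightarrow> x = 0" "(\<Sum>i\<in>UNIV. c i *s row i F) = 0"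
    have "(hconj F *v (\<chi> i. cnj (c i))) $ j = cnj ((\<Sum>i\<in>UNIV. c i *s row i F) $ j)" for j
      by (simp add: matrix_vector_mult_def row_def mult.commute)
    then have "hconj F *v (\<chi> i. cnj (c i)) = 0" using *(2) by (simp add: vec_eq_iff)
    then have "(\<chi> i. cnj (c i)) = (0 :: complex^'l)" using *(1) by blast
    from arg_cong[OF this, of "\<lambda>v. v $ i"] show "c i = 0" by simp
  qed
  finally show ?thesis .
qed

section \<open>Orthonormal sets and projections\<close>

definition orthonormal :: "(complex^'n) set \<Rightarrow> bool" where
  "orthonormal B \<longleftrightarrow> (\<forall>u\<in>B. \<forall>v\<in>B. hinner u v = (if u = v then 1 else 0))"

lemma orthonormal_mono: "orthonormal B \<Longrightarrow> A \<subseteq> B \<Longrightarrow> orthonormal A"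
  by (simp add: orthonormal_def subset_eq)

lemma orthonormal_independent:
  assumes "orthonormal B" shows "vec.independent B"
proof (rule ccontr)
  assume "\<not> vec.independent B"
  then obtain S c v where S: "finite S" "S \<subseteq> B" "(\<Sum>w\<in>S. c w *s w) = 0" "v \<in> S" "c v \<noteq> 0"
    by (auto simp: vec.dependent_explicit)
  have "0 = hinner v (\<Sum>w\<in>S. c w *s w)" using S by simp
  also have "\<dots> = (\<Sum>w\<in>S. c w * (if v = w then 1 else 0))"
    unfolding hinner_sum_right hinner_scale_right
    using assms S by (intro sum.cong) (auto simp: orthonormal_def subset_eq)
  also have "\<dots> = c v" using S by (simp add: if_distrib cong: if_cong)
  finally show False using S by simp
qed

lemma orthonormal_finite: "orthonormal B \<Longrightarrow> finite B"
  by (rule vec.finiteI_independent[OF orthonormal_independent])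

text \<open>A sum of Hermitian rank-one matrices; for orthonormal \<open>B\<close> it is the
  orthogonal projection onto the span.\<close>

definition gram_proj :: "(complex^'n) set \<Rightarrow> complex^'n^'n" where
  "gram_proj B = (\<chi> i j. \<Sum>b\<in>B. b $ i * cnj (b $ j))"

lemma gram_proj_mult: "gram_proj B *v x = (\<Sum>b\<in>B. hinner b x *s b)"
proof -
  have "(gram_proj B *v x) $ i = (\<Sum>j\<in>UNIV. \<Sum>b\<in>B. b $ i * cnj (b $ j) * x $ j)" for i
    by (simp add: gram_proj_def matrix_vector_mult_def sum_distrib_right)
  also have "\<dots> i = (\<Sum>b\<in>B. hinner b x *s b) $ i" for i
    by (subst sum.swap) (simp add: hinner_def sum_distrib_right sum_distrib_left mult_ac)
  finally show ?thesis by (simp add: vec_eq_iff)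
qed

lemma hinner_gram_proj:
  assumes "orthonormal B" "b \<in> B" shows "hinner b (gram_proj B *v x) = hinner b x"
proof -
  have "hinner b (gram_proj B *v x) = (\<Sum>c\<in>B. hinner c x * (if b = c then 1 else 0))"
    unfolding gram_proj_mult hinner_sum_right hinner_scale_right
    using assms by (intro sum.cong) (auto simp: orthonormal_def)
  also have "\<dots> = hinner b x"
    using assms orthonormal_finite[OF assms(1)] by (simp add: if_distrib cong: if_cong)
  finally show ?thesis .
qed

text \<open>Gram-Schmidt by maximality: independence bounds the size of orthonormal sets, so a
  largest one containing \<open>B\<close> inside \<open>V\<close> exists. If it did not span
  \<open>V\<close>, the normalised residual of a missed vector would enlarge it.\<close>

lemma orthonormal_extend:
  assumes B: "orthonormal B" "B \<subseteq> V" and V: "vec.subspace V"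
  obtains C where "B \<subseteq> C" "orthonormal C" "vec.span C = V"
proof -
  define Q where "Q C \<longleftrightarrow> B \<subseteq> C \<and> orthonormal C \<and> C \<subseteq> V" for C
  have "card C \<le> CARD('a)" if "Q C" for C
    using that orthonormal_independent[of C] dim_subset_UNIV_cart_gen[of C]
    by (auto simp: Q_def vec.dim_eq_card_independent)
  moreover have "Q B" using B by (simp add: Q_def)
  ultimately obtain C where C: "Q C" and max: "\<And>D. Q D \<Longrightarrow> card D \<le> card C"
    by (metis ex_has_greatest_nat less_Suc_eq_le)
  have fin: "finite C" using C by (simp add: Q_def orthonormal_finite)
  have "vec.span C = V"
  proof (rule ccontr)
    assume "vec.span C \<noteq> V"
    moreover have "vec.span C \<subseteq> V" using C V by (simp add: Q_def vec.span_minimal)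
    ultimately obtain v where v: "v \<in> V" "v \<notin> vec.span C" by blast
    define w where "w = v - gram_proj C *v v"
    have g: "gram_proj C *v v \<in> vec.span C"
      unfolding gram_proj_mult by (intro vec.span_sum vec.span_scale vec.span_base)
    have "w \<noteq> 0" using v g by (auto simp: w_def)
    have "w \<in> V" unfolding w_def using v g \<open>vec.span C \<subseteq> V\<close> V
      by (intro vec.subspace_diff) auto
    define u where "u = of_real (1 / norm w) *s w"
    have uV: "u \<in> V" unfolding u_def using \<open>w \<in> V\<close> V by (rule vec.subspace_scale[rotated])
    have "hinner u u = 1" using \<open>w \<noteq> 0\<close>
      by (simp add: u_def hinner_scale_left hinner_scale_right hinner_self[of w] power2_eq_square)
    moreover have bu: "hinner b u = 0" if "b \<in> C" for b
      using that C by (simp add: u_def w_def hinner_scale_right hinner_diff_right Q_def hinner_gram_proj)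
    moreover have "hinner u b = 0" if "b \<in> C" for b
      using bu[OF that] cnj_hinner[of b u] by simp
    moreover have "u \<notin> C" using bu[of u] \<open>hinner u u = 1\<close> by auto
    ultimately have "Q (insert u C)" using C uV
      by (auto simp: Q_def orthonormal_def)
    then show False using max[of "insert u C"] \<open>u \<notin> C\<close> fin by simp
  qed
  then show ?thesis using C that by (auto simp: Q_def)
qed

text \<open>The condition inside the description \<open>orth_proj\<close>, kept as a relation so
  that explicit formulas for a projection can be checked before existence and uniqueness are
  known.\<close>

definition is_proj :: "complex^'n^'n \<Rightarrow> (complex^'n) set \<Rightarrow> bool" where
  "is_proj P V \<longleftrightarrow> hconj P = P \<and> P ** P = P \<and> range ((*v) P) = V"

lemma is_proj_gram_proj:
  assumes "orthonormal B" shows "is_proj (gram_proj B) (vec.span B)"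
proof -
  have fix1: "gram_proj B *v b = b" if "b \<in> B" for b
  proof -
    have "gram_proj B *v b = (\<Sum>c\<in>B. (if c = b then b else 0))"
      unfolding gram_proj_mult using assms that by (intro sum.cong) (auto simp: orthonormal_def)
    then show ?thesis using assms that by (simp add: orthonormal_finite)
  qed
  have ran: "gram_proj B *v x \<in> vec.span B" for x
    unfolding gram_proj_mult by (intro vec.span_sum vec.span_scale vec.span_base)
  have fix2: "gram_proj B *v x = x" if "x \<in> vec.span B" for x
    using that by (induction rule: vec.span_induct_alt)
       (auto simp: matrix_vector_right_distrib matrix_vector_mult_scale fix1)
  show ?thesis unfolding is_proj_def
  proof (intro conjI)
    show "hconj (gram_proj B) = gram_proj B"
      by (simp add: gram_proj_def vec_eq_iff mult.commute)
    show "gram_proj B ** gram_proj B = gram_proj B"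
      by (simp add: matrix_eq fix2 ran flip: matrix_vector_mul_assoc)
    show "range ((*v) (gram_proj B)) = vec.span B"
      using ran fix2 by (auto simp: image_iff) metis
  qed
qed

lemma is_proj_fix:
  assumes "is_proj P V" shows "P *v x = x \<longleftrightarrow> x \<in> V"
proof
  assume "x \<in> V"
  then obtain y where "x = P *v y" using assms by (auto simp: is_proj_def)
  then show "P *v x = x" using assms by (simp add: matrix_vector_mul_assoc is_proj_def)
next
  assume "P *v x = x"
  then show "x \<in> V" using assms rangeI[of "(*v) P" x] by (simp add: is_proj_def)
qed

lemma is_proj_in: "is_proj P V \<Longrightarrow> P *v x \<in> V"
  by (auto simp: is_proj_def)

text \<open>Each projection fixes the common range, so \<open>P ** Q = Q\<close> and
  \<open>Q ** P = P\<close>; conjugate transposition of the second identity gives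
  \<open>P = P ** Q\<close>.\<close>

lemma is_proj_unique:
  assumes "is_proj P V" "is_proj Q V" shows "P = Q"
proof -
  have 1: "P ** Q = Q" "Q ** P = P"
    using assms by (simp_all add: matrix_eq is_proj_fix is_proj_in flip: matrix_vector_mul_assoc)
  have "P = hconj (Q ** P)" using 1 assms by (simp add: is_proj_def)
  also have "\<dots> = P ** Q" using assms by (simp add: hconj_mult is_proj_def)
  finally show ?thesis using 1 by simp
qed

lemma is_proj_orth_proj:
  assumes "vec.subspace V" shows "is_proj (orth_proj V) V"
proof -
  obtain C where "orthonormal C" "vec.span C = V"
    using orthonormal_extend[of "{}" V] assms by (auto simp: orthonormal_def)
  then have "is_proj (gram_proj C) V" using is_proj_gram_proj by blast
  then have "\<exists>!P. hconj P = P \<and> P ** P = P \<and> range ((*v) P) = V"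
    using is_proj_unique unfolding is_proj_def by (intro ex1I[of _ "gram_proj C"]) blast+
  from theI'[OF this] show ?thesis unfolding is_proj_def orth_proj_def .
qed

lemma orth_proj_eqI: "is_proj P V \<Longrightarrow> vec.subspace V \<Longrightarrow> orth_proj V = P"
  using is_proj_orth_proj is_proj_unique by blast

lemma is_proj_hinner:
  assumes "is_proj P V" shows "hinner (P *v x) y = hinner x (P *v y)"
  using assms by (simp add: hinner_mult_left is_proj_def)

lemma is_proj_inner:
  assumes "is_proj P V" shows "(P *v x) \<bullet> (P *v y) = x \<bullet> (P *v y)"
proof -
  have "hinner (P *v x) (P *v y) = hinner x (P *v y)"
    using is_proj_fix[OF assms, of "P *v y"] is_proj_in[OF assms, of y]
    by (simp add: is_proj_hinner[OF assms])
  then show ?thesis by (metis Re_hinner)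
qed

lemma is_proj_norm:
  assumes "is_proj P V" shows "(norm x)\<^sup>2 = (norm (P *v x))\<^sup>2 + (norm (x - P *v x))\<^sup>2"
proof -
  have "(x - P *v x) \<bullet> (x - P *v x) = x \<bullet> x - 2 * (x \<bullet> (P *v x)) + (P *v x) \<bullet> (P *v x)"
    by (simp add: inner_diff_left inner_diff_right inner_commute)
  then show ?thesis
    using is_proj_inner[OF assms, of x x] by (simp only: power2_norm_eq_inner)
qed

lemma is_proj_norm_eq_iff:
  assumes "is_proj P V" shows "(norm (P *v x))\<^sup>2 = (norm x)\<^sup>2 \<longleftrightarrow> x \<in> V"
proof -
  have "(norm (P *v x))\<^sup>2 = (norm x)\<^sup>2 \<longleftrightarrow> (norm (x - P *v x))\<^sup>2 = 0"
    using is_proj_norm[OF assms, of x] by linarith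
  also have "\<dots> \<longleftrightarrow> P *v x = x" by auto
  finally show ?thesis using is_proj_fix[OF assms] by simp
qed

section \<open>Matrix inverses and explicit projections onto column and row spaces\<close>

lemma invertible_hermitian_product:
  fixes A :: "complex^'l^'n"
  assumes "\<And>x. A *v x = 0 \<Longrightarrow> x = 0"
  shows "invertible (hconj A ** A)"
proof -
  have "x = 0" if "(hconj A ** A) *v x = 0" for x
  proof -
    have "hinner (A *v x) (A *v x) = hinner x ((hconj A ** A) *v x)"
      by (simp add: hinner_mult_left matrix_vector_mul_assoc)
    then show ?thesis using that assms by simp
  qed
  then show ?thesis
    unfolding invertible_left_inverse matrix_left_invertible_ker by blast
qed

lemma matrix_inv:
  fixes A :: "'a::semiring_1^'n^'n"
  assumes "invertible A"
  shows matrix_inv_right: "A ** matrix_inv A = mat 1" and matrix_inv_left: "matrix_inv A ** A = mat 1"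
  using assms someI_ex[of "\<lambda>A'. A ** A' = mat 1 \<and> A' ** A = mat 1"]
  unfolding invertible_def matrix_inv_def by auto

lemma matrix_inv_unique:
  fixes A :: "'a::semiring_1^'n^'n"
  assumes "A ** B = mat 1" "B ** A = mat 1" shows "matrix_inv A = B"
proof -
  have "invertible A" using assms invertible_def by blast
  then have "matrix_inv A = matrix_inv A ** (A ** B)" using assms by simp
  also have "\<dots> = B" using matrix_inv_left[OF \<open>invertible A\<close>] by (simp add: matrix_mul_assoc)
  finally show ?thesis .
qed

lemma hconj_matrix_inv:
  fixes A :: "complex^'n^'n"
  assumes "invertible A" shows "hconj (matrix_inv A) = matrix_inv (hconj A)"
proof -
  have "hconj A ** hconj (matrix_inv A) = mat 1" "hconj (matrix_inv A) ** hconj A = mat 1"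
    using matrix_inv_left[OF assms] matrix_inv_right[OF assms] by (simp_all flip: hconj_mult)
  then show ?thesis by (rule matrix_inv_unique[symmetric])
qed

text \<open>The least-squares projection. Everything rests on the fact that it fixes
  \<open>A\<close>: idempotence and the range both follow from that.\<close>

lemma is_proj_col_space:
  fixes A :: "complex^'l^'n"
  assumes "\<And>x. A *v x = 0 \<Longrightarrow> x = 0"
  shows "is_proj (A ** matrix_inv (hconj A ** A) ** hconj A) (col_space A)"
proof -
  let ?H = "hconj A ** A"
  let ?P = "A ** matrix_inv ?H ** hconj A"
  have inv: "invertible ?H" using assms by (rule invertible_hermitian_product)
  have PA: "?P ** A = A"
    using matrix_inv_left[OF inv] by (simp flip: matrix_mul_assoc)
  show ?thesis unfolding is_proj_def
  proof (intro conjI)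
    show "hconj ?P = ?P"
      by (simp add: hconj_mult hconj_matrix_inv[OF inv] matrix_mul_assoc)
    show "?P ** ?P = ?P"
      using arg_cong[OF PA, of "\<lambda>X. X ** (matrix_inv ?H ** hconj A)"] by (simp add: matrix_mul_assoc)
    show "range ((*v) ?P) = col_space A"
      unfolding col_space_eq_range
    proof safe
      fix x show "?P *v x \<in> range ((*v) A)"
        by (simp flip: matrix_mul_assoc matrix_vector_mul_assoc)
      show "A *v y \<in> range ((*v) ?P)" for y
        using rangeI[of "(*v) ?P" "A *v y"] by (simp add: PA matrix_vector_mul_assoc)
    qed
  qed
qed

text \<open>This identifies the matrix inside \<open>fim\<close>, so a combiner enters the
  information only through its row space.\<close>

lemma is_proj_row_space:
  fixes M :: "complex^'n^'l"
  assumes "rank M = CARD('l)"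
  shows "is_proj (hconj M ** matrix_inv (M ** hconj M) ** M) (row_space M)"
proof -
  have *: "\<forall>x. hconj M *v x = 0 \<longrightarrow> x = 0" by (rule iffD1[OF full_row_rank_iff assms])
  have "x = 0" if "hconj M *v x = 0" for x by (rule mp[OF spec[OF *] that])
  from is_proj_col_space[of "hconj M", OF this] show ?thesis by (simp add: row_space_def)
qed

lemma row_space_grassmannian:
  fixes M :: "complex^'n^'l"
  assumes "rank M = CARD('l)"
  shows "row_space M \<in> grassmannian CARD('l)"
proof -
  have "vec.dim (row_space M) = CARD('l)"
    unfolding row_space_def dim_col_space by (rule iffD1[OF full_row_rank_iff assms])
  then show ?thesis by (simp add: grassmannian_def row_space_def subspace_col_space)
qed

section \<open>Positive definite block matrices\<close>

lemma inner_matrix_transpose: "x \<bullet> (M *v y) = (transpose M *v x) \<bullet> (y :: real^'n)"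
  by (simp add: dot_lmul_matrix)

lemma inner_symmetric: "transpose M = M \<Longrightarrow> x \<bullet> (M *v y) = (M *v x) \<bullet> (y :: real^'n)"
  by (simp add: inner_matrix_transpose)

lemma pos_def_imp_semidef: "pos_def A \<Longrightarrow> pos_semidef A"
  unfolding pos_def_def pos_semidef_def
  by (metis inner_zero_left less_eq_real_def)

lemma pos_def_invertible:
  assumes "pos_def A" shows "invertible A"
proof -
  have "x = 0" if "A *v x = 0" for x
    using assms that by (force simp: pos_def_def)
  then show ?thesis unfolding invertible_left_inverse matrix_left_invertible_ker by blast
qed

lemma symmetric_matrix_inv:
  fixes A :: "'a::comm_semiring_1^'n^'n"
  assumes "invertible A" "transpose A = A" shows "transpose (matrix_inv A) = matrix_inv A"
proof (rule matrix_inv_unique[symmetric])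
  show "A ** transpose (matrix_inv A) = mat 1" "transpose (matrix_inv A) ** A = mat 1"
    using arg_cong[OF matrix_inv_left[OF assms(1)], of transpose]
      arg_cong[OF matrix_inv_right[OF assms(1)], of transpose]
    by (simp_all add: matrix_transpose_mul assms(2))
qed

text \<open>Put \<open>y = matrix_inv B *v x\<close> and \<open>z = matrix_inv A *v x\<close>.
  Nonnegativity of the form of \<open>A\<close> at \<open>y - z\<close> bounds the difference of the
  inverse forms at \<open>x\<close> from below by the difference of the forms of \<open>B\<close>
  and \<open>A\<close> at \<open>y\<close>. This avoids matrix square roots and also yields the
  strict version, since \<open>y\<close> is nonzero with \<open>x\<close>.\<close>

lemma matrix_inv_antitone:
  fixes A B :: "real^'n^'n"
  assumes A: "pos_def A" and B: "pos_def B" and le: "\<And>x. x \<bullet> (A *v x) \<le> x \<bullet> (B *v x)"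
  shows "pos_semidef (matrix_inv A - matrix_inv B)"
    and "(\<And>x. x \<noteq> 0 \<Longrightarrow> x \<bullet> (A *v x) < x \<bullet> (B *v x)) \<Longrightarrow> pos_def (matrix_inv A - matrix_inv B)"
proof -
  note inv = pos_def_invertible[OF A] pos_def_invertible[OF B]
  have sym: "transpose (matrix_inv A - matrix_inv B) = matrix_inv A - matrix_inv B"
    using symmetric_matrix_inv[OF inv(1)] symmetric_matrix_inv[OF inv(2)] A B
    by (simp add: pos_def_def transpose_def vec_eq_iff)
  have key: "x \<bullet> ((matrix_inv A - matrix_inv B) *v x) \<ge>
      (matrix_inv B *v x) \<bullet> (B *v (matrix_inv B *v x)) - (matrix_inv B *v x) \<bullet> (A *v (matrix_inv B *v x))"
    for x
  proof -
    define y where "y = matrix_inv B *v x"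
    define z where "z = matrix_inv A *v x"
    have By: "B *v y = x" and Az: "A *v z = x"
      using matrix_inv_right[OF inv(2)] matrix_inv_right[OF inv(1)]
      by (simp_all add: y_def z_def matrix_vector_mul_assoc)
    have "0 \<le> (y - z) \<bullet> (A *v (y - z))"
      using pos_def_imp_semidef[OF A] by (simp add: pos_semidef_def)
    also have "\<dots> = y \<bullet> (A *v y) - y \<bullet> x - z \<bullet> (A *v y) + z \<bullet> x"
      by (simp add: matrix_vector_mult_diff_distrib inner_diff_left inner_diff_right Az)
    also have "z \<bullet> (A *v y) = x \<bullet> y"
      using A by (simp add: inner_symmetric pos_def_def Az)
    finally have "2 * (x \<bullet> y) - y \<bullet> (A *v y) \<le> x \<bullet> z"
      by (simp add: inner_commute)
    then show ?thesis
      by (simp add: matrix_vector_mult_diff_rdistrib inner_diff_right By inner_commute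
          flip: y_def z_def)
  qed
  show "pos_semidef (matrix_inv A - matrix_inv B)"
    unfolding pos_semidef_def
  proof (intro conjI allI sym)
    show "0 \<le> x \<bullet> ((matrix_inv A - matrix_inv B) *v x)" for x
      using key[of x] le[of "matrix_inv B *v x"] by linarith
  qed
  assume lt: "\<And>x. x \<noteq> 0 \<Longrightarrow> x \<bullet> (A *v x) < x \<bullet> (B *v x)"
  show "pos_def (matrix_inv A - matrix_inv B)"
    unfolding pos_def_def
  proof (intro conjI allI impI sym)
    fix x :: "real^'n" assume "x \<noteq> 0"
    have "B *v (matrix_inv B *v x) = x"
      using matrix_inv_right[OF inv(2)] by (simp add: matrix_vector_mul_assoc)
    with \<open>x \<noteq> 0\<close> have "matrix_inv B *v x \<noteq> 0" by auto
    from lt[OF this] key[of x] show "0 < x \<bullet> ((matrix_inv A - matrix_inv B) *v x)" by linarith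
  qed
qed

section \<open>Schur complements of symmetric block matrices\<close>

definition joinv :: "real^'k \<Rightarrow> real^'b \<Rightarrow> real^('k + 'b)" where
  "joinv x y = (\<chi> p. case p of Inl i \<Rightarrow> x $ i | Inr j \<Rightarrow> y $ j)"

lemma joinv_nth [simp]: "joinv x y $ Inl i = x $ i" "joinv x y $ Inr j = y $ j"
  by (simp_all add: joinv_def)

lemma joinv_eq_0 [simp]: "joinv x y = 0 \<longleftrightarrow> x = 0 \<and> y = 0"
  by (simp add: vec_eq_iff split_sum_all)

lemma sum_UNIV_Plus:
  fixes f :: "'a::finite + 'b::finite \<Rightarrow> 'c::comm_monoid_add"
  shows "(\<Sum>p\<in>UNIV. f p) = (\<Sum>i\<in>UNIV. f (Inl i)) + (\<Sum>j\<in>UNIV. f (Inr j))"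
  using sum.Plus[of "UNIV :: 'a set" "UNIV :: 'b set" f] by (simp add: o_def)

lemma inner_joinv: "joinv x y \<bullet> joinv x' y' = x \<bullet> x' + y \<bullet> y'"
  by (simp add: inner_vec_def sum_UNIV_Plus)

context
  fixes J :: "real^('k::finite + 'b::finite)^('k + 'b)"
  assumes sym: "transpose J = J"
begin

private definition "A = (\<chi> i j. J $ Inl i $ Inl j)"
private definition "B = (\<chi> i j. J $ Inl i $ Inr j)"
private definition "C = (\<chi> i j. J $ Inr i $ Inl j)"
private definition "D = (\<chi> i j. J $ Inr i $ Inr j)"

private lemma J_sym: "J $ i $ j = J $ j $ i"
  using arg_cong[OF sym, of "\<lambda>M. M $ j $ i"] by (simp add: transpose_def)

private lemma block_transpose: "transpose A = A" "transpose B = C" "transpose D = D"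
  by (auto simp: A_def B_def C_def D_def transpose_def vec_eq_iff intro: J_sym)

private lemma schur_eq: "schur_angle J = A - B ** matrix_inv D ** C"
  by (simp add: schur_angle_def amp_block_def A_def B_def C_def D_def)

private lemma mult_joinv: "J *v joinv x y = joinv (A *v x + B *v y) (C *v x + D *v y)"
  by (simp add: vec_eq_iff split_sum_all matrix_vector_mult_def sum_UNIV_Plus A_def B_def C_def D_def)

lemma transpose_amp_block: "transpose (amp_block J) = amp_block J"
  using block_transpose(3) unfolding D_def amp_block_def .

lemma amp_block_form: "y \<bullet> (amp_block J *v y) = joinv 0 y \<bullet> (J *v joinv 0 y)"
  unfolding mult_joinv inner_joinv amp_block_def D_def by simp

context
  assumes inv: "invertible (amp_block J)"
begin

private lemma invD: "invertible D"
  using inv unfolding amp_block_def D_def .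

lemma transpose_schur_angle: "transpose (schur_angle J) = schur_angle J"
proof -
  have "transpose C = B" unfolding block_transpose(2)[symmetric] by simp
  then have *: "transpose (B ** matrix_inv D ** C) = B ** matrix_inv D ** C"
    by (simp only: matrix_transpose_mul matrix_mul_assoc block_transpose(2)
        symmetric_matrix_inv[OF invD block_transpose(3)])
  have "transpose (X - Y) = transpose X - transpose Y" for X Y :: "real^'k^'k"
    by (simp add: transpose_def vec_eq_iff)
  then show ?thesis
    by (simp only: schur_eq * block_transpose(1))
qed

text \<open>Completing the square in the second block. The shift \<open>w\<close> depends on
  \<open>x\<close> only, so \<open>y = - w\<close> removes the second term.\<close>

lemma schur_completion:
  obtains w where "\<And>y. joinv x y \<bullet> (J *v joinv x y) =
     x \<bullet> (schur_angle J *v x) + (y + w) \<bullet> (amp_block J *v (y + w))"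
proof
  fix y
  define v where "v = matrix_inv D *v (C *v x)"
  have Dv: "D *v v = C *v x"
    using matrix_inv_right[OF invD] by (simp add: v_def matrix_vector_mul_assoc matrix_mul_assoc)
  have 1: "x \<bullet> (B *v u) = (C *v x) \<bullet> u" for u
    by (simp add: inner_matrix_transpose block_transpose)
  have 2: "v \<bullet> (D *v y) = (C *v x) \<bullet> y"
    by (simp add: inner_symmetric[OF block_transpose(3)] Dv)
  have 3: "schur_angle J *v x = A *v x - B *v v"
    by (simp add: schur_eq v_def matrix_vector_mult_diff_rdistrib matrix_vector_mul_assoc matrix_mul_assoc)
  have D: "amp_block J = D" by (simp add: D_def amp_block_def)
  show "joinv x y \<bullet> (J *v joinv x y) =
     x \<bullet> (schur_angle J *v x) + (y + v) \<bullet> (amp_block J *v (y + v))"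
    unfolding 3 D mult_joinv inner_joinv
    by (simp add: inner_add_left inner_add_right inner_diff_right matrix_vector_right_distrib
        1 2 Dv inner_commute)
qed

lemma schur_angle_attained:
  obtains y where "joinv x y \<bullet> (J *v joinv x y) = x \<bullet> (schur_angle J *v x)"
proof -
  obtain w where "\<And>y. joinv x y \<bullet> (J *v joinv x y) =
     x \<bullet> (schur_angle J *v x) + (y + w) \<bullet> (amp_block J *v (y + w))"
    using schur_completion by blast
  from this[of "-w"] show ?thesis using that by simp
qed

lemma schur_angle_le:
  assumes "pos_semidef J"
  shows "x \<bullet> (schur_angle J *v x) \<le> joinv x y \<bullet> (J *v joinv x y)"
proof -
  obtain w where w: "\<And>y. joinv x y \<bullet> (J *v joinv x y) =
     x \<bullet> (schur_angle J *v x) + (y + w) \<bullet> (amp_block J *v (y + w))"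
    using schur_completion by blast
  have "0 \<le> (y + w) \<bullet> (amp_block J *v (y + w))"
    unfolding amp_block_form using assms by (simp add: pos_semidef_def)
  then show ?thesis using w by simp
qed

end

end

text \<open>The amplitude block is the form restricted to first component 0, and the Schur
  complement at \<open>x\<close> is a value of the form at some vector with first component
  \<open>x\<close>; both inherit positivity.\<close>

lemma crb_defined_pos_def:
  fixes J :: "real^('k::finite + 'b::finite)^('k + 'b)"
  assumes J: "pos_def J" shows "crb_defined J"
proof -
  have sym: "transpose J = J" using J by (simp add: pos_def_def)
  have "pos_def (amp_block J)"
    using J transpose_amp_block[OF sym] by (simp add: pos_def_def amp_block_form[OF sym])
  then have inv: "invertible (amp_block J)" by (rule pos_def_invertible)
  have "0 < x \<bullet> (schur_angle J *v x)" if "x \<noteq> 0" for x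
  proof -
    obtain y where "joinv x y \<bullet> (J *v joinv x y) = x \<bullet> (schur_angle J *v x)"
      using schur_angle_attained[OF sym inv] by blast
    moreover have "0 < joinv x y \<bullet> (J *v joinv x y)"
      using J that by (simp add: pos_def_def)
    ultimately show ?thesis by simp
  qed
  then show ?thesis
    using inv transpose_schur_angle[OF sym inv] by (simp add: crb_defined_def pos_def_def)
qed

text \<open>The \<open>y\<close> that attains the Schur complement of \<open>J'\<close> at
  \<open>x\<close> is a competitor for \<open>J\<close>, so the comparison of the forms passes to
  the Schur complements. Strictness survives because \<open>joinv x y\<close> is nonzero as soon as
  \<open>x\<close> is.\<close>

lemma crb_antitone:
  fixes J J' :: "real^('k::finite + 'b::finite)^('k + 'b)"
  assumes J: "crb_defined J" "pos_semidef J" and J': "crb_defined J'" "pos_semidef J'"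
  shows "pos_semidef (J' - J) \<Longrightarrow> pos_semidef (crb J - crb J')"
    and "pos_def (J' - J) \<Longrightarrow> pos_def (crb J - crb J')"
proof -
  have sym: "transpose J = J" "transpose J' = J'"
    using J J' by (simp_all add: pos_semidef_def)
  have inv: "invertible (amp_block J)" "invertible (amp_block J')"
    and pd: "pos_def (schur_angle J)" "pos_def (schur_angle J')"
    using J J' by (simp_all add: crb_defined_def)
  have key: "\<exists>y. x \<bullet> (schur_angle J *v x) \<le> joinv x y \<bullet> (J *v joinv x y) \<and>
      x \<bullet> (schur_angle J' *v x) = joinv x y \<bullet> (J' *v joinv x y)" for x
  proof -
    obtain y where "joinv x y \<bullet> (J' *v joinv x y) = x \<bullet> (schur_angle J' *v x)"
      using schur_angle_attained[OF sym(2) inv(2)] .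
    then show ?thesis using schur_angle_le[OF sym(1) inv(1) J(2)] by (intro exI[of _ y]) simp
  qed
  {
    assume "pos_semidef (J' - J)"
    then have le: "z \<bullet> (J *v z) \<le> z \<bullet> (J' *v z)" for z
      by (simp add: pos_semidef_def matrix_vector_mult_diff_rdistrib inner_diff_right)
    have "x \<bullet> (schur_angle J *v x) \<le> x \<bullet> (schur_angle J' *v x)" for x
    proof -
      from key[of x] obtain y where "x \<bullet> (schur_angle J *v x) \<le> joinv x y \<bullet> (J *v joinv x y)"
        "x \<bullet> (schur_angle J' *v x) = joinv x y \<bullet> (J' *v joinv x y)" by blast
      with le[of "joinv x y"] show ?thesis by linarith
    qed
    from matrix_inv_antitone(1)[OF pd this] show "pos_semidef (crb J - crb J')"
      by (simp add: crb_def)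
  }
  {
    assume "pos_def (J' - J)"
    then have lt: "z \<bullet> (J *v z) < z \<bullet> (J' *v z)" if "z \<noteq> 0" for z
      using that by (simp add: pos_def_def matrix_vector_mult_diff_rdistrib inner_diff_right)
    have *: "x \<bullet> (schur_angle J *v x) < x \<bullet> (schur_angle J' *v x)" if "x \<noteq> 0" for x
    proof -
      from key[of x] obtain y where "x \<bullet> (schur_angle J *v x) \<le> joinv x y \<bullet> (J *v joinv x y)"
        "x \<bullet> (schur_angle J' *v x) = joinv x y \<bullet> (J' *v joinv x y)" by blast
      moreover have "joinv x y \<noteq> 0" using that by simp
      ultimately show ?thesis using lt[of "joinv x y"] by linarith
    qed
    have "x \<bullet> (schur_angle J *v x) \<le> x \<bullet> (schur_angle J' *v x)" for x
      using *[of x] by (cases "x = 0") auto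
    from matrix_inv_antitone(2)[OF pd this *] show "pos_def (crb J - crb J')"
      by (simp add: crb_def)
  }
qed

section \<open>The Fisher information as a Gram matrix\<close>

text \<open>What remains of a Jacobian column after the waveform sample is factored out; by this
  factorisation the snapshots contribute only the scalar \<open>(norm s)\<^sup>2\<close> to the
  information.\<close>

definition target_deriv ::
  "('n::finite \<Rightarrow> nat) \<Rightarrow> real^'k \<Rightarrow> complex^'k \<Rightarrow> 'k + ('k + 'k) \<Rightarrow> complex^'n" where
  "target_deriv pos \<theta> \<beta> p = (case p of
     Inl k \<Rightarrow> \<beta> $ k *s dsteer pos (\<theta> $ k)
   | Inr (Inl k) \<Rightarrow> steer pos (\<theta> $ k)
   | Inr (Inr k) \<Rightarrow> \<i> *s steer pos (\<theta> $ k))"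

lemma target_deriv_simps [simp]:
  "target_deriv pos \<theta> \<beta> (Inl k) = \<beta> $ k *s dsteer pos (\<theta> $ k)"
  "target_deriv pos \<theta> \<beta> (Inr (Inl k)) = steer pos (\<theta> $ k)"
  "target_deriv pos \<theta> \<beta> (Inr (Inr k)) = \<i> *s steer pos (\<theta> $ k)"
  by (simp_all add: target_deriv_def)

lemma jacobian_eq:
  "jacobian pos s (param_vec \<theta> \<beta>) $ r $ p = s $ fst r * target_deriv pos \<theta> \<beta> p $ snd r"
proof (cases p)
  case (Inr q)
  then show ?thesis by (cases q) (simp_all add: jacobian_Re jacobian_Im mult_ac)
qed (simp add: jacobian_angle)

lemma norm_square_vec: "(norm (s :: complex^'t))\<^sup>2 = (\<Sum>t\<in>UNIV. (cmod (s $ t))\<^sup>2)"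
  by (simp add: norm_vec_def L2_set_def sum_nonneg)

lemma sum_UNIV_prod: "(\<Sum>r\<in>UNIV. f r) = (\<Sum>t\<in>UNIV. \<Sum>n\<in>UNIV. f (t, n))"
  by (simp add: sum.cartesian_product)

text \<open>The Kronecker product with the identity acts on each snapshot separately, so the sum
  over snapshots splits off as the energy of the waveform.\<close>

lemma fim_gram:
  fixes s :: "complex^'t::finite" and M :: "complex^'n^'l"
  defines "P \<equiv> hconj M ** matrix_inv (M ** hconj M) ** M"
  shows "fim pos s var (param_vec \<theta> \<beta>) M $ p $ q =
    2 / var * (norm s)\<^sup>2 * (target_deriv pos \<theta> \<beta> p \<bullet> (P *v target_deriv pos \<theta> \<beta> q))"
proof -
  let ?w = "target_deriv pos \<theta> \<beta>"
  let ?J = "jacobian pos s (param_vec \<theta> \<beta>)"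
  let ?K = "kron (mat 1 :: complex^'t^'t) P"
  have K: "(?K ** ?J) $ (t, n) $ q = s $ t * (P *v ?w q) $ n" for t n
  proof -
    have "(?K ** ?J) $ (t, n) $ q
      = (\<Sum>t'\<in>UNIV. (if t = t' then \<Sum>n'\<in>UNIV. P $ n $ n' * (s $ t' * ?w q $ n') else 0))"
      unfolding matrix_matrix_mult_def vec_lambda_beta sum_UNIV_prod jacobian_eq
      by (intro sum.cong refl) (simp add: kron_def mat_def)
    then show ?thesis
      by (simp add: matrix_vector_mult_def sum_distrib_left mult_ac)
  qed
  have "(hconj ?J ** (?K ** ?J)) $ p $ q
      = (\<Sum>t\<in>UNIV. \<Sum>n\<in>UNIV. cnj (s $ t * ?w p $ n) * (s $ t * (P *v ?w q) $ n))"
    unfolding matrix_matrix_mult_def[of "hconj ?J"] vec_lambda_beta sum_UNIV_prod K hconj_nth jacobian_eq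
    by simp
  also have "\<dots> = (\<Sum>t\<in>UNIV. of_real ((cmod (s $ t))\<^sup>2) * hinner (?w p) (P *v ?w q))"
    unfolding hinner_def sum_distrib_left complex_norm_square
    by (intro sum.cong refl) (simp add: mult_ac)
  also have "\<dots> = of_real ((norm s)\<^sup>2) * hinner (?w p) (P *v ?w q)"
    by (simp only: norm_square_vec of_real_sum sum_distrib_right)
  finally have *: "(hconj ?J ** (?K ** ?J)) $ p $ q = of_real ((norm s)\<^sup>2) * hinner (?w p) (P *v ?w q)" .
  have "Re ((hconj ?J ** (?K ** ?J)) $ p $ q) = (norm s)\<^sup>2 * (?w p \<bullet> (P *v ?w q))"
    unfolding * by (simp add: Re_hinner del: of_real_power)
  then show ?thesis
    by (simp add: fim_def Re_mat_def P_def matrix_mul_assoc)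
qed

lemma fim_dig_gram:
  fixes s :: "complex^'t::finite"
  shows "fim_dig pos s var (param_vec \<theta> \<beta>) $ p $ q =
    2 / var * (norm s)\<^sup>2 * (target_deriv pos \<theta> \<beta> p \<bullet> target_deriv pos \<theta> \<beta> q)"
proof -
  let ?w = "target_deriv pos \<theta> \<beta>"
  let ?J = "jacobian pos s (param_vec \<theta> \<beta>)"
  have "(hconj ?J ** ?J) $ p $ q
      = (\<Sum>t\<in>UNIV. \<Sum>n\<in>UNIV. cnj (s $ t * ?w p $ n) * (s $ t * ?w q $ n))"
    unfolding matrix_matrix_mult_def vec_lambda_beta sum_UNIV_prod hconj_nth jacobian_eq
    by simp
  also have "\<dots> = (\<Sum>t\<in>UNIV. of_real ((cmod (s $ t))\<^sup>2) * hinner (?w p) (?w q))"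
    unfolding hinner_def sum_distrib_left complex_norm_square
    by (intro sum.cong refl) (simp add: mult_ac)
  also have "\<dots> = of_real ((norm s)\<^sup>2) * hinner (?w p) (?w q)"
    by (simp only: norm_square_vec of_real_sum sum_distrib_right)
  finally have *: "(hconj ?J ** ?J) $ p $ q = of_real ((norm s)\<^sup>2) * hinner (?w p) (?w q)" .
  have "Re ((hconj ?J ** ?J) $ p $ q) = (norm s)\<^sup>2 * (?w p \<bullet> ?w q)"
    unfolding * by (simp add: Re_hinner del: of_real_power)
  then show ?thesis
    by (simp add: fim_dig_def Re_mat_def)
qed

text \<open>Coefficients \<open>x\<close> belong to the derivatives, \<open>y\<close> to the
  steering vectors. Real parameter directions produce only \<open>x k\<close> on the real line
  through \<open>\<beta> $ k\<close>; allowing all complex coefficients makes the independence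
  questions complex linear.\<close>

definition lin_comb ::
  "('n::finite \<Rightarrow> nat) \<Rightarrow> real^'k \<Rightarrow> ('k \<Rightarrow> complex) \<Rightarrow> ('k \<Rightarrow> complex) \<Rightarrow> complex^'n" where
  "lin_comb pos \<theta> x y = (\<Sum>k\<in>UNIV. x k *s dsteer pos (\<theta> $ k) + y k *s steer pos (\<theta> $ k))"

lemma gram_form:
  fixes w :: "'p::finite \<Rightarrow> complex^'n" and z :: "real^'p"
  assumes J: "\<And>p q. J $ p $ q = c * (w p \<bullet> (P *v w q))"
  shows "z \<bullet> (J *v z) = c * ((\<Sum>p\<in>UNIV. z $ p *\<^sub>R w p) \<bullet> (P *v (\<Sum>p\<in>UNIV. z $ p *\<^sub>R w p)))"
proof -
  have "P *v (z $ p *\<^sub>R w p) = z $ p *\<^sub>R (P *v w p)" for p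
    by (simp add: vec_eq_iff matrix_vector_mult_def scaleR_sum_right)
  then have "P *v (\<Sum>p\<in>UNIV. z $ p *\<^sub>R w p) = (\<Sum>p\<in>UNIV. z $ p *\<^sub>R (P *v w p))"
    by (simp add: matrix_vector_mult_sum)
  moreover have "z \<bullet> (J *v z) = (\<Sum>p\<in>UNIV. \<Sum>q\<in>UNIV. z $ p * z $ q * (c * (w p \<bullet> (P *v w q))))"
    by (simp add: inner_vec_def[of z] matrix_vector_mult_def sum_distrib_left J mult_ac)
  moreover have "\<dots> = (\<Sum>q\<in>UNIV. \<Sum>p\<in>UNIV. z $ p * z $ q * (c * (w p \<bullet> (P *v w q))))"
    by (rule sum.swap)
  ultimately show ?thesis
    by (simp add: inner_sum_left inner_sum_right sum_distrib_left mult_ac)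
qed

lemma sum_target_deriv:
  fixes z :: "real^('k::finite + ('k + 'k))"
  shows "(\<Sum>p\<in>UNIV. z $ p *\<^sub>R target_deriv pos \<theta> \<beta> p) =
    lin_comb pos \<theta> (\<lambda>k. of_real (z $ Inl k) * \<beta> $ k) (\<lambda>k. Complex (z $ Inr (Inl k)) (z $ Inr (Inr k)))"
  unfolding sum_UNIV_Plus lin_comb_def target_deriv_simps
  by (simp add: vec_eq_iff sum.distrib Complex_eq scaleR_conv_of_real[where 'a = complex] algebra_simps)

section \<open>Comparison of the two information matrices\<close>

context
  fixes pos :: "'n::finite \<Rightarrow> nat" and \<beta> :: "complex^'k::finite" and s :: "complex^'t::finite"
    and var :: real
  assumes \<beta>: "\<And>k. \<beta> $ k \<noteq> 0" and s: "s \<noteq> 0" and var: "var > 0"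
begin

private definition "Jd \<theta> = fim_dig pos s var (param_vec \<theta> \<beta>)"
private definition "Jp \<theta> M = fim pos s var (param_vec \<theta> \<beta>) M"
private definition "c = 2 / var * (norm s)\<^sup>2"

private lemma c: "c > 0"
  using s var by (simp add: c_def)

private definition "wsum \<theta> z = lin_comb pos \<theta> (\<lambda>k. of_real (z $ Inl k) * \<beta> $ k)
   (\<lambda>k. Complex (z $ Inr (Inl k)) (z $ Inr (Inr k)))"

private lemma form_dig: "z \<bullet> (Jd \<theta> *v z) = c * (norm (wsum \<theta> z))\<^sup>2"
proof -
  have "z \<bullet> (Jd \<theta> *v z) = c * ((\<Sum>p\<in>UNIV. z $ p *\<^sub>R target_deriv pos \<theta> \<beta> p) \<bullet>
     (mat 1 *v (\<Sum>p\<in>UNIV. z $ p *\<^sub>R target_deriv pos \<theta> \<beta> p)))"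
    by (rule gram_form) (simp add: Jd_def c_def fim_dig_gram)
  then show ?thesis
    by (simp add: sum_target_deriv power2_norm_eq_inner wsum_def)
qed

private lemma form_comb:
  fixes M :: "complex^'n^'l"
  assumes M: "rank M = CARD('l)"
  shows "z \<bullet> (Jp \<theta> M *v z) = c * (norm (orth_proj (row_space M) *v wsum \<theta> z))\<^sup>2"
proof -
  let ?P = "hconj M ** matrix_inv (M ** hconj M) ** M"
  have P: "is_proj ?P (row_space M)" using M by (rule is_proj_row_space)
  have PP: "orth_proj (row_space M) = ?P"
    by (rule orth_proj_eqI[OF P]) (simp add: row_space_def subspace_col_space)
  have "z \<bullet> (Jp \<theta> M *v z) = c * ((\<Sum>p\<in>UNIV. z $ p *\<^sub>R target_deriv pos \<theta> \<beta> p) \<bullet>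
     (?P *v (\<Sum>p\<in>UNIV. z $ p *\<^sub>R target_deriv pos \<theta> \<beta> p)))"
    by (rule gram_form) (simp add: Jp_def c_def fim_gram)
  then show ?thesis
    by (simp add: sum_target_deriv power2_norm_eq_inner wsum_def PP is_proj_inner[OF P])
qed

private lemma proj_row:
  fixes M :: "complex^'n^'l"
  shows "is_proj (orth_proj (row_space M)) (row_space M)"
  by (rule is_proj_orth_proj) (simp add: row_space_def subspace_col_space)

private lemma sym_dig: "transpose (Jd \<theta>) = Jd \<theta>"
  by (simp add: Jd_def transpose_def vec_eq_iff fim_dig_gram inner_commute)

private lemma sym_comb:
  fixes M :: "complex^'n^'l"
  assumes M: "rank M = CARD('l)"
  shows "transpose (Jp \<theta> M) = Jp \<theta> M"
proof -
  let ?P = "hconj M ** matrix_inv (M ** hconj M) ** M"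
  have P: "is_proj ?P (row_space M)" using M by (rule is_proj_row_space)
  have "u \<bullet> (?P *v v) = v \<bullet> (?P *v u)" for u v
    using is_proj_inner[OF P, of u v] is_proj_inner[OF P, of v u] by (simp add: inner_commute)
  then show ?thesis
    by (simp add: Jp_def transpose_def vec_eq_iff fim_gram)
qed

text \<open>Nonzero amplitudes matter here: a target with \<open>\<beta> $ k = 0\<close> would leave
  its angle coefficient undetermined.\<close>

private lemma coeffs_eq_0:
  assumes "(\<forall>k. of_real (z $ Inl k) * \<beta> $ k = 0) \<and>
    (\<forall>k. Complex (z $ Inr (Inl k)) (z $ Inr (Inr k)) = 0)"
  shows "z = 0"
proof -
  have "z $ Inl k = 0" for k using conjunct1[OF assms, rule_format, of k] \<beta>[of k] by simp
  moreover have "z $ Inr (Inl k) = 0" "z $ Inr (Inr k) = 0" for k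
    using assms by (auto simp: complex_eq_iff)
  ultimately show ?thesis by (simp add: vec_eq_iff split_sum_all)
qed

lemma semidef_dig: "pos_semidef (fim_dig pos s var (param_vec \<theta> \<beta>))"
  using c sym_dig form_dig by (simp add: pos_semidef_def flip: Jd_def)

lemma semidef_comb:
  fixes M :: "complex^'n^'l"
  assumes M: "rank M = CARD('l)"
  shows "pos_semidef (fim pos s var (param_vec \<theta> \<beta>) M)"
  using c sym_comb[OF M] form_comb[OF M] by (simp add: pos_semidef_def flip: Jp_def)

private lemma transpose_minus: "transpose (A - B) = transpose A - transpose (B :: real^'a^'b)"
  by (simp add: transpose_def vec_eq_iff)

text \<open>By Pythagoras the lost information is the squared norm of the component off the row
  space. Both the semidefinite and the definite comparison are read off this form.\<close>

private lemma form_diff: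
  fixes M :: "complex^'n^'l"
  assumes M: "rank M = CARD('l)"
  shows "z \<bullet> ((Jd \<theta> - Jp \<theta> M) *v z) =
    c * (norm (wsum \<theta> z - orth_proj (row_space M) *v wsum \<theta> z))\<^sup>2"
  unfolding matrix_vector_mult_diff_rdistrib inner_diff_right form_dig form_comb[OF M]
  using is_proj_norm[OF proj_row[of M], of "wsum \<theta> z"] by (simp add: algebra_simps)

lemma semidef_diff:
  fixes M :: "complex^'n^'l"
  assumes M: "rank M = CARD('l)"
  shows "pos_semidef (fim_dig pos s var (param_vec \<theta> \<beta>) - fim pos s var (param_vec \<theta> \<beta>) M)"
  unfolding pos_semidef_def Jd_def[symmetric] Jp_def[symmetric]
    transpose_minus sym_dig sym_comb[OF M] form_diff[OF M]
  using c by simp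

lemma pos_def_dig:
  assumes ind: "\<And>x y. lin_comb pos \<theta> x y = 0 \<Longrightarrow> (\<forall>k. x k = 0) \<and> (\<forall>k. y k = 0)"
  shows "pos_def (fim_dig pos s var (param_vec \<theta> \<beta>))"
proof -
  have "wsum \<theta> z \<noteq> 0" if "z \<noteq> 0" for z
    using coeffs_eq_0[OF ind] that unfolding wsum_def by blast
  then show ?thesis
    unfolding pos_def_def Jd_def[symmetric] sym_dig form_dig using c by simp
qed

text \<open>For \<open>v\<close> in the row space, the product of \<open>v\<close> with a vector
  equals its product with the projected vector. So a combination killed by the projection is
  annihilated by the whole row space, which \<open>ind\<close> excludes.\<close>

lemma pos_def_comb:
  fixes M :: "complex^'n^'l"
  assumes M: "rank M = CARD('l)"
    and ind: "\<And>x y. (\<And>v. v \<in> row_space M \<Longrightarrow> hinner v (lin_comb pos \<theta> x y) = 0) \<Longrightarrow>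
      (\<forall>k. x k = 0) \<and> (\<forall>k. y k = 0)"
  shows "pos_def (fim pos s var (param_vec \<theta> \<beta>) M)"
proof -
  let ?P = "orth_proj (row_space M)"
  have "?P *v wsum \<theta> z \<noteq> 0" if "z \<noteq> 0" for z
  proof
    assume *: "?P *v wsum \<theta> z = 0"
    have "hinner v (wsum \<theta> z) = 0" if "v \<in> row_space M" for v
    proof -
      have "hinner v (wsum \<theta> z) = hinner (?P *v v) (wsum \<theta> z)"
        using that is_proj_fix[OF proj_row[of M], of v] by simp
      then show ?thesis by (simp add: is_proj_hinner[OF proj_row] *)
    qed
    from coeffs_eq_0[OF ind[OF this[unfolded wsum_def]]] \<open>z \<noteq> 0\<close> show False by simp
  qed
  then show ?thesis
    unfolding pos_def_def Jp_def[symmetric] sym_comb[OF M] form_comb[OF M] using c by simp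
qed

text \<open>The assumption is trivial intersection with the row space, not mere failure of
  inclusion: a nonzero combination inside the row space could be a direction in which no information
  is lost.\<close>

lemma pos_def_diff:
  fixes M :: "complex^'n^'l"
  assumes M: "rank M = CARD('l)"
    and ind: "\<And>x y. lin_comb pos \<theta> x y \<in> row_space M \<Longrightarrow> (\<forall>k. x k = 0) \<and> (\<forall>k. y k = 0)"
  shows "pos_def (fim_dig pos s var (param_vec \<theta> \<beta>) - fim pos s var (param_vec \<theta> \<beta>) M)"
proof -
  let ?P = "orth_proj (row_space M)"
  have "wsum \<theta> z - ?P *v wsum \<theta> z \<noteq> 0" if "z \<noteq> 0" for z
  proof
    assume "wsum \<theta> z - ?P *v wsum \<theta> z = 0"
    then have "wsum \<theta> z \<in> row_space M"
      using is_proj_fix[OF proj_row[of M], of "wsum \<theta> z"] by simp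
    from coeffs_eq_0[OF ind[OF this[unfolded wsum_def]]] \<open>z \<noteq> 0\<close> show False by simp
  qed
  then show ?thesis
    unfolding pos_def_def Jd_def[symmetric] Jp_def[symmetric]
      transpose_minus sym_dig sym_comb[OF M] form_diff[OF M]
    using c by simp
qed

text \<open>The diagonal entries suffice for the forward direction: they compare the norms of a
  derivative and of its projection, and these agree only for vectors in the row space.\<close>

lemma fim_eq_iff:
  fixes M :: "complex^'n^'l"
  assumes M: "rank M = CARD('l)"
  shows "fim pos s var (param_vec \<theta> \<beta>) M = fim_dig pos s var (param_vec \<theta> \<beta>) \<longleftrightarrow>
    target_space pos \<theta> \<subseteq> row_space M"
proof -
  let ?P = "hconj M ** matrix_inv (M ** hconj M) ** M"
  let ?w = "target_deriv pos \<theta> \<beta>"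
  have P: "is_proj ?P (row_space M)" using M by (rule is_proj_row_space)
  have sub: "vec.subspace (row_space M)" by (simp add: row_space_def subspace_col_space)
  have "fim pos s var (param_vec \<theta> \<beta>) M = fim_dig pos s var (param_vec \<theta> \<beta>) \<longleftrightarrow>
     (\<forall>p. ?w p \<in> row_space M)"
  proof
    assume eq: "fim pos s var (param_vec \<theta> \<beta>) M = fim_dig pos s var (param_vec \<theta> \<beta>)"
    show "\<forall>p. ?w p \<in> row_space M"
    proof
      fix p
      have "c * (?w p \<bullet> (?P *v ?w p)) = c * (?w p \<bullet> ?w p)"
        using arg_cong[OF eq, of "\<lambda>A. A $ p $ p"] unfolding fim_gram fim_dig_gram c_def .
      then have "?w p \<bullet> (?P *v ?w p) = ?w p \<bullet> ?w p" using c by simp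
      then have "(norm (?P *v ?w p))\<^sup>2 = (norm (?w p))\<^sup>2"
        by (simp add: power2_norm_eq_inner is_proj_inner[OF P])
      then show "?w p \<in> row_space M" using is_proj_norm_eq_iff[OF P] by blast
    qed
  next
    assume "\<forall>p. ?w p \<in> row_space M"
    then have fix1: "?P *v ?w p = ?w p" for p using is_proj_fix[OF P] by blast
    show "fim pos s var (param_vec \<theta> \<beta>) M = fim_dig pos s var (param_vec \<theta> \<beta>)"
      by (rule vec_eq_iff[THEN iffD2, rule_format])+ (simp only: fim_gram fim_dig_gram fix1)
  qed
  also have "\<dots> \<longleftrightarrow> target_space pos \<theta> \<subseteq> row_space M"
  proof
    assume w: "\<forall>p. ?w p \<in> row_space M"
    have "steer pos (\<theta> $ k) \<in> row_space M" for k
      using w[rule_format, of "Inr (Inl k)"] by simp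
    moreover have "dsteer pos (\<theta> $ k) \<in> row_space M" for k
      using vec.subspace_scale[OF sub w[rule_format, of "Inl k"], of "inverse (\<beta> $ k)"] \<beta>
      by (simp add: vec_eq_iff)
    ultimately show "target_space pos \<theta> \<subseteq> row_space M"
      unfolding target_space_def by (intro vec.span_minimal sub) auto
  next
    assume t: "target_space pos \<theta> \<subseteq> row_space M"
    have "steer pos (\<theta> $ k) \<in> target_space pos \<theta>" "dsteer pos (\<theta> $ k) \<in> target_space pos \<theta>" for k
      unfolding target_space_def by (auto intro: vec.span_base)
    with t have "steer pos (\<theta> $ k) \<in> row_space M" "dsteer pos (\<theta> $ k) \<in> row_space M" for k
      by blast+
    then show "\<forall>p. ?w p \<in> row_space M"
      by (auto simp: target_deriv_def split: sum.split intro!: vec.subspace_scale[OF sub])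
  qed
  finally show ?thesis .
qed

end

lemma admissible_independent:
  assumes "admissible pos \<theta>" "lin_comb pos (\<theta> :: real^'k::finite) x y = 0"
  shows "(\<forall>k. x k = 0) \<and> (\<forall>k. y k = 0)"
proof -
  define f where "f p = (case p of Inl k \<Rightarrow> dsteer pos (\<theta> $ k) | Inr k \<Rightarrow> steer pos (\<theta> $ k))"
    for p :: "'k + 'k"
  have "range f = range (\<lambda>k. steer pos (\<theta> $ k)) \<union> range (\<lambda>k. dsteer pos (\<theta> $ k))"
    by (simp add: f_def UNIV_sum image_Un image_image Un_commute)
  then have "vec.dim (range f) = CARD('k + 'k)"
    using assms(1) by (simp add: admissible_def target_space_def)
  then have *: "\<forall>c. (\<Sum>p\<in>UNIV. c p *s f p) = 0 \<longrightarrow> (\<forall>p. c p = 0)"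
    by (simp only: dim_range_eq_card_iff)
  have "(\<Sum>p\<in>UNIV. (case p of Inl k \<Rightarrow> x k | Inr k \<Rightarrow> y k) *s f p) = lin_comb pos \<theta> x y"
    by (simp add: sum_UNIV_Plus f_def lin_comb_def sum.distrib)
  then have "\<forall>p. (case p of Inl k \<Rightarrow> x k | Inr k \<Rightarrow> y k) = 0"
    using spec[OF *, of "\<lambda>p. case p of Inl k \<Rightarrow> x k | Inr k \<Rightarrow> y k"] assms(2) by simp
  then show ?thesis by (simp add: split_sum_all)
qed

section \<open>The MiLAC combiner\<close>

lemma subspace_row_space [simp]: "vec.subspace (row_space M)"
  by (simp add: row_space_def subspace_col_space)

text \<open>A symmetric matrix with lower-left block \<open>G\<close> and lower-right block 0 has
  upper-right block \<open>transpose G\<close>. It is unitary once the rows of \<open>G\<close> are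
  orthonormal and the remaining block \<open>X\<close> is symmetric with
  \<open>hconj X ** X = mat 1 - hconj G ** G\<close> and \<open>hconj X\<close> annihilates
  \<open>transpose G\<close>. An orthonormal basis adapted to \<open>V\<close> provides both
  blocks.\<close>

lemma ex_milac:
  fixes V :: "(complex^'n::finite) set"
  assumes V: "vec.subspace V" "vec.dim V \<le> CARD('l::finite)" and N: "CARD('l) \<le> CARD('n)"
  obtains G :: "complex^'n^'l" where "G \<in> F_MiLAC" "rank G = CARD('l)" "V \<subseteq> row_space G"
proof -
  obtain B where B: "orthonormal B" "vec.span B = V"
    using orthonormal_extend[of "{}" V] V by (auto simp: orthonormal_def)
  obtain C where C: "B \<subseteq> C" "orthonormal C" "vec.span C = UNIV"
    using orthonormal_extend[OF B(1), of UNIV] by auto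
  have "card B = vec.dim V"
    using vec.dim_span_eq_card_independent[OF orthonormal_independent[OF B(1)]] B by simp
  then have cB: "card B \<le> CARD('l)" using V by simp
  have "card C = vec.dim (UNIV :: (complex^'n) set)"
    using vec.dim_span_eq_card_independent[OF orthonormal_independent[OF C(2)]] C by simp
  then have cC: "CARD('l) \<le> card C" using N by (simp add: vec_dim_card del: vec.dim_UNIV)
  obtain D where D: "B \<subseteq> D" "D \<subseteq> C" "card D = CARD('l)"
    using exists_subset_between[OF cB cC C(1)] orthonormal_finite[OF C(2)] by auto
  have finC: "finite C" and finD: "finite D"
    using C(2) D(2) orthonormal_finite finite_subset by blast+
  obtain f :: "'l \<Rightarrow> complex^'n" where f: "bij_betw f UNIV D"
    using finite_same_card_bij[of "UNIV :: 'l set" D] D(3) finD by auto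
  define G :: "complex^'n^'l" where "G = (\<chi> l n. cnj (f l $ n))"
  define X :: "complex^'n^'n" where "X = (\<chi> i j. \<Sum>c\<in>C - D. cnj (c $ i) * cnj (c $ j))"
  define T :: "complex^('n + 'l)^('n + 'l)" where
    "T = (\<chi> p q. case p of
        Inl i \<Rightarrow> (case q of Inl j \<Rightarrow> X $ i $ j | Inr m \<Rightarrow> G $ m $ i)
      | Inr l \<Rightarrow> (case q of Inl j \<Rightarrow> G $ l $ j | Inr m \<Rightarrow> 0))"
  have orthC: "(\<Sum>i\<in>UNIV. cnj (u $ i) * v $ i) = (if u = v then 1 else 0)" if "u \<in> C" "v \<in> C" for u v
    using C(2) that by (simp add: orthonormal_def hinner_def)
  have fC: "f l \<in> D" "f l \<in> C" for l
    using f D(2) by (auto simp: bij_betw_def)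
  have finj: "f l = f m \<longleftrightarrow> l = m" for l m
    using f by (auto simp: bij_betw_def inj_def)
  \<comment> \<open>Resolution of the identity: \<open>C\<close> spans the whole space, so its Gram
    projection is \<open>mat 1\<close>.\<close>
  have resolution: "(\<Sum>c\<in>C. c $ i * cnj (c $ j)) = (if i = j then 1 else 0)" for i j
  proof -
    have "is_proj (gram_proj C) UNIV" using is_proj_gram_proj[OF C(2)] C(3) by simp
    then have "gram_proj C *v x = x" for x using is_proj_fix by blast
    then have "gram_proj C = mat 1" by (simp add: matrix_eq)
    from arg_cong[OF this, of "\<lambda>P. P $ i $ j"] show ?thesis
      by (simp add: gram_proj_def mat_def)
  qed
  have G_sum: "(\<Sum>l\<in>UNIV. cnj (G $ l $ i) * G $ l $ j) = (\<Sum>c\<in>D. c $ i * cnj (c $ j))" for i j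
    using sum.reindex_bij_betw[OF f, of "\<lambda>c. c $ i * cnj (c $ j)"] by (simp add: G_def)
  have X_sum: "(\<Sum>k\<in>UNIV. cnj (X $ k $ i) * X $ k $ j) = (\<Sum>c\<in>C - D. c $ i * cnj (c $ j))" for i j
  proof -
    have "(\<Sum>k\<in>UNIV. cnj (X $ k $ i) * X $ k $ j)
      = (\<Sum>k\<in>UNIV. \<Sum>c\<in>C - D. \<Sum>d\<in>C - D. c $ i * cnj (d $ j) * (cnj (d $ k) * c $ k))"
      by (simp add: X_def sum_product mult_ac)
    also have "\<dots> = (\<Sum>c\<in>C - D. \<Sum>d\<in>C - D. c $ i * cnj (d $ j) * (\<Sum>k\<in>UNIV. cnj (d $ k) * c $ k))"
      by (simp add: sum.swap[where A = UNIV] sum_distrib_left)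
    also have "\<dots> = (\<Sum>c\<in>C - D. \<Sum>d\<in>C - D. if d = c then c $ i * cnj (d $ j) else 0)"
      by (intro sum.cong refl) (simp add: orthC)
    finally show ?thesis using finC by simp
  qed
  have XG: "(\<Sum>k\<in>UNIV. cnj (X $ k $ i) * G $ l $ k) = 0" for i l
  proof -
    have "(\<Sum>k\<in>UNIV. cnj (X $ k $ i) * G $ l $ k)
      = (\<Sum>k\<in>UNIV. \<Sum>c\<in>C - D. c $ i * (cnj (f l $ k) * c $ k))"
      by (simp add: X_def G_def sum_distrib_left sum_distrib_right mult_ac)
    also have "\<dots> = (\<Sum>c\<in>C - D. c $ i * (\<Sum>k\<in>UNIV. cnj (f l $ k) * c $ k))"
      by (simp add: sum.swap[where A = UNIV] sum_distrib_left)
    also have "\<dots> = 0"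
      using fC by (intro sum.neutral) (auto simp: orthC)
    finally show ?thesis .
  qed
  have GG: "(\<Sum>k\<in>UNIV. cnj (G $ l $ k) * G $ m $ k) = (if l = m then 1 else 0)" for l m
    using orthC[OF fC(2)[of m] fC(2)[of l]] by (cases "l = m") (simp_all add: G_def finj mult.commute)
  have TT: "transpose T = T"
    by (auto simp: transpose_def T_def vec_eq_iff X_def mult.commute split: sum.split)
  have "(hconj T ** T) $ p $ q = mat 1 $ p $ q" for p q
  proof -
    have *: "(hconj T ** T) $ p $ q
      = (\<Sum>k\<in>UNIV. cnj (T $ Inl k $ p) * T $ Inl k $ q) + (\<Sum>l\<in>UNIV. cnj (T $ Inr l $ p) * T $ Inr l $ q)"
      by (simp add: matrix_matrix_mult_def sum_UNIV_Plus)
    have sp: "(\<Sum>c\<in>C - D. h c) + (\<Sum>c\<in>D. h c) = (\<Sum>c\<in>C. h c)" for h :: "_ \<Rightarrow> complex"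
      using sum.subset_diff[OF D(2) finC, of h] by simp
    have XG': "(\<Sum>k\<in>UNIV. cnj (G $ l $ k) * X $ k $ i) = 0" for i l
      using arg_cong[OF XG[of i l], of cnj] by (simp add: mult.commute)
    show ?thesis
      unfolding * mat_def
      by (cases p; cases q) (simp_all add: T_def X_sum G_sum sp resolution XG XG' GG)
  qed
  then have "hconj T ** T = mat 1" by (simp add: vec_eq_iff)
  then have "G \<in> F_MiLAC"
    unfolding F_MiLAC_def using TT
    by (intro CollectI exI[of _ T]) (simp add: T_def vec_eq_iff)
  moreover have GG': "hconj G *v x = (\<Sum>l\<in>UNIV. x $ l *s f l)" for x
    by (simp add: G_def vec_eq_iff matrix_vector_mult_def mult.commute)
  have "x = 0" if "hconj G *v x = 0" for x
  proof -
    have "hinner (f m) (hconj G *v x) = (\<Sum>l\<in>UNIV. if l = m then x $ l else 0)" for m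
      unfolding GG' hinner_sum_right hinner_scale_right
    proof (intro sum.cong refl)
      fix l show "x $ l * hinner (f m) (f l) = (if l = m then x $ l else 0)"
        using orthC[OF fC(2)[of m] fC(2)[of l]] by (cases "l = m") (simp_all add: hinner_def finj)
    qed
    then show ?thesis using that by (simp add: vec_eq_iff)
  qed
  then have "\<forall>x. hconj G *v x = 0 \<longrightarrow> x = 0" by blast
  then have "rank G = CARD('l)" by (rule iffD2[OF full_row_rank_iff])
  moreover have "f l \<in> row_space G" for l
  proof -
    have "hconj G *v axis l 1 = f l"
      by (simp add: G_def vec_eq_iff matrix_vector_mult_def axis_def if_distrib cong: if_cong)
    then show ?thesis
      unfolding row_space_def col_space_eq_range using rangeI[of "(*v) (hconj G)" "axis l 1"] by simp
  qed
  then have "D \<subseteq> row_space G" using f by (auto simp: bij_betw_def)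
  then have "vec.span B \<subseteq> row_space G"
    using D(1) by (intro vec.span_minimal) auto
  ultimately show ?thesis using that B(2) by blast
qed

section \<open>Generic target configurations\<close>

text \<open>Integrate the indicator of \<open>B\<close> at \<open>x + t *\<^sub>R e\<close> over all
  \<open>x\<close> and all real \<open>t\<close>. Translation invariance turns one order of
  integration into an infinite multiple of the measure of \<open>B\<close>; countable slices make
  the other order 0.\<close>

lemma null_set_of_countable_lines:
  fixes B :: "'a::euclidean_space set" and e :: 'a
  assumes B: "B \<in> sets borel" and lines: "\<And>x. countable {t::real. x + t *\<^sub>R e \<in> B}"
  shows "B \<in> null_sets lborel"
proof -
  have meas: "(\<lambda>(x, t). indicator B (x + t *\<^sub>R e) :: ennreal) \<in> borel_measurable (lborel \<Otimes>\<^sub>M lborel)"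
    using B by measurable
  have shift: "(\<integral>\<^sup>+x. indicator B (x + t *\<^sub>R e) \<partial>lborel) = emeasure lborel B" for t
  proof -
    have "emeasure lborel B = (\<integral>\<^sup>+x. indicator B x \<partial>distr lborel borel ((+) (t *\<^sub>R e)))"
      using B by (simp add: lborel_distr_plus)
    also have "\<dots> = (\<integral>\<^sup>+x. indicator B (t *\<^sub>R e + x) \<partial>lborel)"
      using B by (intro nn_integral_distr) auto
    finally show ?thesis by (simp add: add.commute)
  qed
  have inner: "(\<integral>\<^sup>+t. indicator B (x + t *\<^sub>R e) \<partial>lborel) = 0" for x
  proof -
    have "(\<integral>\<^sup>+t. indicator B (x + t *\<^sub>R e) \<partial>lborel) = (\<integral>\<^sup>+t. indicator {t. x + t *\<^sub>R e \<in> B} t \<partial>lborel)"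
      by (intro nn_integral_cong) (simp add: indicator_def)
    also have "\<dots> = emeasure lborel {t. x + t *\<^sub>R e \<in> B}"
      using countable_imp_null_set_lborel[OF lines, of x] by (intro nn_integral_indicator) auto
    finally show ?thesis using countable_imp_null_set_lborel[OF lines, of x] by (simp add: null_sets_def)
  qed
  have "(\<integral>\<^sup>+(t::real). emeasure lborel B \<partial>lborel) = (\<integral>\<^sup>+x. (\<integral>\<^sup>+t. indicator B (x + t *\<^sub>R e) \<partial>lborel) \<partial>lborel)"
    using lborel_pair.Fubini'[OF meas] by (simp add: shift)
  also have "\<dots> = 0" by (simp only: inner) simp
  finally have "emeasure lborel B = 0" by simp
  then show ?thesis using B by (simp add: null_sets_def)
qed

text \<open>Passing to complex arguments makes the identity theorem available: it is enough that
  \<open>g\<close> is nonzero at one point, which may lie off the real axis.\<close>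

lemma entire_real_zeros:
  fixes g :: "complex \<Rightarrow> complex"
  assumes g: "g holomorphic_on UNIV" and z0: "g z0 \<noteq> 0"
  shows "countable {t::real. g (of_real t) = 0}"
    and "g (of_real t) = 0 \<Longrightarrow> t isolated_in {t::real. g (of_real t) = 0}"
proof -
  have "countable {z. g z = 0}"
  proof (cases "g constant_on UNIV")
    case True
    then have "{z. g z = 0} = {}" using z0 by (auto simp: constant_on_def)
    then show ?thesis by simp
  next
    case False
    from holomorphic_countable_zeros[OF g open_UNIV _ fsigma_UNIV False]
    show ?thesis by (simp add: connected_UNIV)
  qed
  then have "countable (of_real -` {z. g z = 0} :: real set)"
    using countable_image_inj_Int_vimage[of "of_real :: real \<Rightarrow> complex" UNIV "{z. g z = 0}"]
    by (simp add: inj_def)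
  then show "countable {t::real. g (of_real t) = 0}"
    by (simp add: vimage_def)
  assume "g (of_real t) = 0"
  then obtain r where r: "0 < r" "\<And>z. z \<in> ball (of_real t) r - {of_real t} \<Longrightarrow> g z \<noteq> 0"
    using isolated_zeros[OF g, of "of_real t" z0] z0 by auto
  have "y = t" if "g (of_real y) = 0" "dist t y < r" for y
    using r(2)[of "of_real y"] that by (auto simp: dist_of_real)
  then show "t isolated_in {t::real. g (of_real t) = 0}"
    using r(1) \<open>g (of_real t) = 0\<close> unfolding isolated_in_dist_Ex_iff by auto
qed

text \<open>The phase factor between adjacent antennas, continued to complex angles. The entries of
  a steering vector are powers of it.\<close>

definition phasor :: "complex \<Rightarrow> complex" where
  "phasor z = exp (\<i> * of_real pi * sin z)"

lemma phasor_real: "phasor (of_real t) = exp (\<i> * complex_of_real (pi * sin t))"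
  by (simp add: phasor_def sin_of_real mult.assoc)

lemma phasor_holomorphic [holomorphic_intros]: "phasor holomorphic_on A"
  unfolding phasor_def by (intro holomorphic_intros)

lemma phasor_nonzero [simp]: "phasor z \<noteq> 0"
  by (simp add: phasor_def)

text \<open>For \<open>s\<close> strictly between 0 and 1 the angle \<open>arcsin s\<close> has
  nonzero cosine, and its phasor \<open>cis (pi * s)\<close> runs through infinitely many points of
  the upper half circle, more than \<open>W\<close> has roots.\<close>

lemma poly_phasor_nonzero:
  assumes "W \<noteq> 0"
  obtains t where "cos t * poly W (phasor t) \<noteq> 0"
proof -
  define u where "u s = phasor (of_real (arcsin s))" for s :: real
  have u: "u s = cis (pi * s)" if "s \<in> {0<..<1}" for s
  proof -
    have "sin (arcsin s) = s" using that by (intro sin_arcsin) simp_all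
    then show ?thesis unfolding u_def phasor_real cis_conv_exp by simp
  qed
  have "inj_on u {0<..<1}"
  proof
    fix s s' :: real assume s: "s \<in> {0<..<1}" "s' \<in> {0<..<1}" "u s = u s'"
    have "Re (cis (pi * s)) = Re (cis (pi * s'))"
      using s(3) unfolding u[OF s(1)] u[OF s(2)] by (rule arg_cong)
    then have "cos (pi * s) = cos (pi * s')" unfolding cis.sel .
    moreover have "0 \<le> pi * x" "pi * x \<le> pi" if "x \<in> {0<..<1}" for x :: real
      using that mult_left_mono[of x 1 pi] by simp_all
    ultimately have "pi * s = pi * s'" using s(1,2) by (rule_tac cos_inj_pi) auto
    then show "s = s'" by simp
  qed
  then have inf: "\<not> finite (u ` {0<..<1})"
    using finite_imageD[of u "{0<..<1}"] infinite_Ioo[of "0::real" 1] zero_less_one by blast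
  have "\<not> u ` {0<..<1} \<subseteq> {z. poly W z = 0}"
  proof
    assume "u ` {0<..<1} \<subseteq> {z. poly W z = 0}"
    then have "finite (u ` {0<..<1})" using poly_roots_finite[OF assms] by (rule finite_subset)
    with inf show False by contradiction
  qed
  then have "\<exists>s\<in>{0<..<1}. poly W (u s) \<noteq> 0" by (simp add: image_subset_iff)
  then obtain s where s: "s \<in> {0<..<1}" "poly W (u s) \<noteq> 0" by blast
  have "cos (arcsin s) \<noteq> 0" using s(1) by (intro cos_arcsin_nonzero) simp_all
  then have "cos (complex_of_real (arcsin s)) \<noteq> 0" unfolding cos_of_real of_real_eq_0_iff .
  moreover have "poly W (phasor (of_real (arcsin s))) \<noteq> 0" using s(2) unfolding u_def .
  ultimately have "cos (complex_of_real (arcsin s)) * poly W (phasor (of_real (arcsin s))) \<noteq> 0"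
    by (rule no_zero_divisors)
  then show ?thesis by (rule that)
qed

lemma poly_phasor_holomorphic: "(\<lambda>z. cos z * poly W (phasor z)) holomorphic_on A"
  by (intro holomorphic_intros)

text \<open>Angles with \<open>cos t = 0\<close> count as exceptional in the first claim because
  \<open>dsteer\<close> vanishes there, so the two vectors of such a target cannot be
  independent.\<close>

lemma poly_phasor_zeros:
  assumes "W \<noteq> 0"
  shows "countable {t::real. cos t = 0 \<or> poly W (phasor (of_real t)) = 0}"
    and "poly W (phasor (of_real t)) = 0 \<Longrightarrow> t isolated_in {t::real. poly W (phasor (of_real t)) = 0}"
proof -
  obtain z where z: "cos z * poly W (phasor z) \<noteq> 0" using poly_phasor_nonzero[OF assms] .
  show "countable {t::real. cos t = 0 \<or> poly W (phasor (of_real t)) = 0}"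
    using entire_real_zeros(1)[OF poly_phasor_holomorphic z] by (simp add: cos_of_real)
  have "(\<lambda>z. poly W (phasor z)) holomorphic_on UNIV" by (intro holomorphic_intros)
  moreover have "poly W (phasor z) \<noteq> 0" using z by auto
  ultimately show "t isolated_in {t::real. poly W (phasor (of_real t)) = 0}"
    if "poly W (phasor (of_real t)) = 0" using entire_real_zeros(2) that by blast
qed

section \<open>Wronskians of polynomials\<close>

lemma wronskian_degree:
  fixes p q :: "'a::field_char_0 poly"
  assumes "p \<noteq> 0" "q \<noteq> 0" and W: "pderiv p * q = p * pderiv q"
  shows "degree p = degree q"
proof (cases "degree p = 0 \<or> degree q = 0")
  case True
  \<comment> \<open>If one polynomial is constant its derivative is 0, and the identity then forces
    the other derivative to be 0 too.\<close>
  then have "pderiv p = 0 \<or> pderiv q = 0" by (simp add: pderiv_eq_0_iff)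
  then have "pderiv p = 0 \<and> pderiv q = 0" using W assms(1,2) by auto
  then show ?thesis by (simp add: pderiv_eq_0_iff)
next
  case False
  have lc: "lead_coeff (pderiv r) = of_nat (degree r) * lead_coeff r" if "degree r \<noteq> 0" for r :: "'a poly"
    using that by (simp add: degree_pderiv coeff_pderiv)
  \<comment> \<open>Both products carry the same pair of leading coefficients, weighted by the
    degree of the differentiated factor.\<close>
  have "of_nat (degree p) * lead_coeff p * lead_coeff q = lead_coeff p * (of_nat (degree q) * lead_coeff q)"
    using arg_cong[OF W, of lead_coeff] False by (simp only: lead_coeff_mult lc) (simp add: lc)
  then show ?thesis using assms(1,2) by simp
qed

text \<open>Cancel the leading coefficient of \<open>p\<close> by a multiple of \<open>q\<close>.
  The remainder still has vanishing Wronskian with \<open>q\<close>, so if it were nonzero it would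
  have the degree of \<open>q\<close>, where its coefficient has just been cancelled.\<close>

lemma wronskian_eq_0:
  fixes p q :: "'a::field_char_0 poly"
  assumes q: "q \<noteq> 0" and W: "pderiv p * q = p * pderiv q"
  obtains c where "p = smult c q"
proof (cases "p = 0")
  case True
  then show ?thesis using that[of 0] by simp
next
  case False
  define r where "r = p - smult (lead_coeff p / lead_coeff q) q"
  have deg: "degree p = degree q" using False q W by (rule wronskian_degree)
  have "pderiv r * q = r * pderiv q"
    using W by (simp add: r_def pderiv_diff pderiv_smult algebra_simps)
  have "r = 0"
  proof (rule ccontr)
    assume "r \<noteq> 0"
    then have "degree r = degree q" using q \<open>pderiv r * q = r * pderiv q\<close> by (rule wronskian_degree)
    then have "lead_coeff r = 0" using q by (simp add: r_def flip: deg) (simp add: deg)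
    with \<open>r \<noteq> 0\<close> show False by simp
  qed
  then show ?thesis using that by (simp add: r_def)
qed

section \<open>The array response as a polynomial in the phasor\<close>

definition conj_poly :: "('n::finite \<Rightarrow> nat) \<Rightarrow> complex^'n \<Rightarrow> complex poly" where
  "conj_poly pos f = (\<Sum>n\<in>UNIV. monom (cnj (f $ n)) (pos n))"

lemma coeff_conj_poly: "inj pos \<Longrightarrow> coeff (conj_poly pos f) (pos n) = cnj (f $ n)"
  by (simp add: conj_poly_def coeff_sum inj_eq)

lemma conj_poly_eq_smult:
  assumes "inj pos" "conj_poly pos f = smult c (conj_poly pos g)"
  shows "f = cnj c *s g"
proof -
  have "cnj (f $ n) = c * cnj (g $ n)" for n
    using arg_cong[OF assms(2), of "\<lambda>p. coeff p (pos n)"] by (simp add: coeff_conj_poly[OF assms(1)])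
  from arg_cong[OF this, of cnj] show ?thesis by (simp add: vec_eq_iff)
qed

lemma steer_nth: "steer pos t $ n = phasor (of_real t) ^ pos n"
  by (simp add: steer_def phasor_real exp_of_nat_mult[symmetric] mult_ac)

lemma hinner_steer: "hinner f (steer pos t) = poly (conj_poly pos f) (phasor (of_real t))"
  by (simp add: hinner_def conj_poly_def poly_sum poly_monom steer_nth)

text \<open>The chain rule through \<open>phasor\<close>, whose derivative supplies the
  prefactor.\<close>

lemma hinner_dsteer: "hinner f (dsteer pos t) =
    \<i> * of_real (pi * cos t) * phasor (of_real t) * poly (pderiv (conj_poly pos f)) (phasor (of_real t))"
proof -
  have pderiv_sum: "pderiv (\<Sum>a\<in>A. h a) = (\<Sum>a\<in>A. pderiv (h a))" for A and h :: "'n \<Rightarrow> complex poly"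
    using higher_pderiv_sum[of "Suc 0" h A] by simp
  have "cnj (f $ n) * dsteer pos t $ n = \<i> * of_real (pi * cos t) *
     (phasor (of_real t) * poly (pderiv (monom (cnj (f $ n)) (pos n))) (phasor (of_real t)))" for n
    by (cases "pos n") (simp_all add: dsteer_nth steer_nth pderiv_monom poly_monom mult_ac)
  then show ?thesis
    by (simp add: hinner_def conj_poly_def pderiv_sum poly_sum sum_distrib_left mult_ac)
qed

text \<open>Configurations whose target vectors with index in \<open>I\<close> are dependent as
  functionals on \<open>X\<close>. Restricting the support of the coefficients, rather than the
  configuration, lets \<open>I\<close> grow in an induction inside one fixed parameter
  space.\<close>

definition degenerate :: "('n::finite \<Rightarrow> nat) \<Rightarrow> (complex^'n) set \<Rightarrow> 'k::finite set \<Rightarrow> (real^'k) set" where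
  "degenerate pos X I = {\<theta>. \<exists>x y. (\<forall>k. k \<notin> I \<longrightarrow> x k = 0 \<and> y k = 0) \<and> (\<exists>k. x k \<noteq> 0 \<or> y k \<noteq> 0) \<and>
     (\<forall>v\<in>X. hinner v (lin_comb pos \<theta> x y) = 0)}"

text \<open>A vector of \<open>X\<close> is orthogonal to \<open>S\<close> as soon as it is
  orthogonal to the projection of \<open>S\<close> into \<open>X\<close>, and this costs at most
  \<open>card S\<close> dimensions. Such vectors serve as tests that do not see the other
  targets.\<close>

lemma orthogonal_pair:
  fixes X :: "(complex^'n::finite) set" and S :: "(complex^'n) set"
  assumes X: "vec.subspace X" and S: "finite S" "card S + 2 \<le> vec.dim X"
  obtains f g where "f \<in> X" "g \<in> X" "hinner f f = 1" "hinner g g = 1" "hinner f g = 0"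
    "\<And>v. v \<in> S \<Longrightarrow> hinner f v = 0" "\<And>v. v \<in> S \<Longrightarrow> hinner g v = 0"
proof -
  let ?P = "orth_proj X"
  have P: "is_proj ?P X" using X by (rule is_proj_orth_proj)
  define U where "U = vec.span ((*v) ?P ` S)"
  have UX: "U \<subseteq> X" unfolding U_def using is_proj_in[OF P] X by (intro vec.span_minimal) auto
  obtain B where B: "orthonormal B" "vec.span B = U"
    using orthonormal_extend[of "{}" U] by (auto simp: orthonormal_def U_def)
  have "B \<subseteq> X" using B UX vec.span_superset by blast
  then obtain C where C: "B \<subseteq> C" "orthonormal C" "vec.span C = X"
    using orthonormal_extend[OF B(1) _ X] by auto
  have "card B = vec.dim U"
    using vec.dim_span_eq_card_independent[OF orthonormal_independent[OF B(1)]] B by simp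
  also have "\<dots> \<le> card ((*v) ?P ` S)" unfolding U_def using S by (simp add: vec.dim_le_card')
  also have "\<dots> \<le> card S" using S by (simp add: card_image_le)
  finally have "card B \<le> card S" .
  moreover have "card C = vec.dim X"
    using vec.dim_span_eq_card_independent[OF orthonormal_independent[OF C(2)]] C by simp
  moreover have "finite B" "finite C" using B C orthonormal_finite by blast+
  ultimately have "2 \<le> card (C - B)" using S C by (simp add: card_Diff_subset)
  then obtain f g where fg: "f \<in> C - B" "g \<in> C - B" "f \<noteq> g"
    by (metis card_2_iff' card_le_Suc0_iff_eq finite_Diff \<open>finite C\<close> not_less_eq_eq numeral_2_eq_2)
  have orth: "hinner h v = 0" if h: "h \<in> C - B" and "v \<in> S" for h v
  proof -
    have "h \<in> X" using h C vec.span_superset by blast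
    then have "hinner h v = hinner (?P *v h) v" using is_proj_fix[OF P, of h] by simp
    also have "\<dots> = hinner h (?P *v v)" by (rule is_proj_hinner[OF P])
    also have "?P *v v \<in> vec.span B"
      unfolding B U_def using \<open>v \<in> S\<close> by (intro vec.span_base) auto
    then have "hinner h (?P *v v) = 0"
    proof (induction rule: vec.span_induct_alt)
      case (step c b u)
      have "hinner h b = 0" using C(1,2) h step(1) by (auto simp: orthonormal_def)
      then show ?case using step by (simp add: hinner_add_right hinner_scale_right)
    qed simp
    finally show ?thesis .
  qed
  show ?thesis
  proof (rule that[of f g])
    show "f \<in> X" "g \<in> X" using fg C vec.span_superset by blast+
    show "hinner f f = 1" "hinner g g = 1" "hinner f g = 0"
      using fg C(2) by (auto simp: orthonormal_def)
  qed (use orth fg in auto)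
qed

lemma continuous_lin_comb:
  fixes pos :: "'n::finite \<Rightarrow> nat"
  shows "continuous_on A (\<lambda>(c, \<theta>). lin_comb pos (\<theta> :: real^'k::finite) (\<lambda>k. fst c $ k) (\<lambda>k. snd c $ k))"
proof -
  have "(\<lambda>(c, \<theta>). lin_comb pos (\<theta> :: real^'k) (\<lambda>k. fst c $ k) (\<lambda>k. snd c $ k)) =
    (\<lambda>z. \<chi> n. \<Sum>k\<in>UNIV. fst (fst z) $ k * (\<i> * complex_of_real (pi * real (pos n) * cos (snd z $ k)) *
        exp (\<i> * complex_of_real (pi * real (pos n) * sin (snd z $ k)))) +
      snd (fst z) $ k * exp (\<i> * complex_of_real (pi * real (pos n) * sin (snd z $ k))))"
    by (auto simp: lin_comb_def fun_eq_iff vec_eq_iff dsteer_nth steer_def)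
  then show ?thesis by (simp only:) (intro continuous_intros)
qed

text \<open>Coefficients can be scaled to the unit sphere, which is compact, and a closed set
  projected along a compact factor stays closed. The purpose is measurability for the slicing
  argument.\<close>

lemma closed_degenerate:
  fixes pos :: "'n::finite \<Rightarrow> nat" and I :: "'k::finite set"
  assumes X: "vec.subspace X"
  shows "closed (degenerate pos X I)"
proof -
  define K :: "((complex^'k) \<times> (complex^'k)) set" where
    "K = sphere 0 1 \<inter> (\<Inter>k\<in>-I. {c. fst c $ k = 0} \<inter> {c. snd c $ k = 0})"
  have K: "compact K" unfolding K_def
    by (intro compact_Int_closed compact_sphere closed_INT ballI closed_Int closed_Collect_eq continuous_intros)
  define L where "L c \<theta> = lin_comb pos \<theta> (\<lambda>k. fst c $ k) (\<lambda>k. snd c $ k)"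
    for c :: "(complex^'k) \<times> (complex^'k)" and \<theta> :: "real^'k"
  define Z where "Z = {z. \<forall>v\<in>X. hinner v (L (fst z) (snd z)) = 0}"
  have "continuous_on UNIV (\<lambda>z. L (fst z) (snd z))"
    using continuous_lin_comb[of UNIV pos] by (simp add: L_def case_prod_unfold)
  then have "continuous_on UNIV (\<lambda>z. hinner v (L (fst z) (snd z)))" for v
    unfolding hinner_def by (intro continuous_intros)
  then have "closed {z. hinner v (L (fst z) (snd z)) = 0}" for v
    by (intro closed_Collect_eq continuous_on_const)
  then have "closed (\<Inter>v\<in>X. {z. hinner v (L (fst z) (snd z)) = 0})" by (intro closed_INT) auto
  moreover have "Z = (\<Inter>v\<in>X. {z. hinner v (L (fst z) (snd z)) = 0})" by (auto simp: Z_def)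
  ultimately have "closed Z" by simp
  have "degenerate pos X I = {\<theta>. \<exists>c\<in>K. (c, \<theta>) \<in> Z}"
  proof safe
    fix \<theta> assume "\<theta> \<in> degenerate pos X I"
    then obtain x y where xy: "\<forall>k. k \<notin> I \<longrightarrow> x k = 0 \<and> y k = 0" "\<exists>k. x k \<noteq> 0 \<or> y k \<noteq> 0"
      "\<forall>v\<in>X. hinner v (lin_comb pos \<theta> x y) = 0" by (auto simp: degenerate_def)
    define c where "c = ((\<chi> k. x k), (\<chi> k. y k))"
    have "c \<noteq> 0" using xy(2) by (auto simp: c_def vec_eq_iff zero_prod_def)
    have "norm ((1 / norm c) *\<^sub>R c) = 1" using \<open>c \<noteq> 0\<close> by simp
    moreover have "fst ((1 / norm c) *\<^sub>R c) $ k = 0 \<and> snd ((1 / norm c) *\<^sub>R c) $ k = 0" if "k \<notin> I" for k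
      using xy(1) that by (simp add: c_def)
    ultimately have "(1 / norm c) *\<^sub>R c \<in> K" unfolding K_def by simp
    moreover have "L ((1 / norm c) *\<^sub>R c) \<theta> = of_real (1 / norm c) *s lin_comb pos \<theta> x y"
      by (simp add: L_def lin_comb_def c_def vec_eq_iff sum_distrib_left scaleR_conv_of_real[where 'a=complex] algebra_simps)
    then have "((1 / norm c) *\<^sub>R c, \<theta>) \<in> Z"
      using xy(3) by (simp add: Z_def hinner_scale_right)
    ultimately show "\<exists>c\<in>K. (c, \<theta>) \<in> Z" by blast
  next
    fix \<theta> c assume c: "c \<in> K" "(c, \<theta>) \<in> Z"
    then have "c \<noteq> 0" by (auto simp: K_def)
    then have "\<exists>k. fst c $ k \<noteq> 0 \<or> snd c $ k \<noteq> 0" by (cases c) (auto simp: vec_eq_iff zero_prod_def)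
    with c show "\<theta> \<in> degenerate pos X I"
      unfolding degenerate_def
      by (intro CollectI exI[of _ "\<lambda>k. fst c $ k"] exI[of _ "\<lambda>k. snd c $ k"])
        (auto simp: K_def Z_def L_def)
  qed
  moreover have "closed {\<theta>. \<exists>c\<in>K. (c, \<theta>) \<in> Z}"
  proof -
    have "closedin (top_of_set UNIV) {\<theta>. \<exists>c. c \<in> K \<and> (c, \<theta>) \<in> (K \<times> UNIV) \<inter> Z}"
      using \<open>closed Z\<close> by (intro closedin_compact_projection[OF K] closedin_closed_Int)
    then show ?thesis by (simp add: conj_assoc Bex_def)
  qed
  ultimately show ?thesis by simp
qed

text \<open>Slicing is done parallel to the axis of the added target, so only one angle moves. Each
  target uses up two dimensions of \<open>X\<close>, and the last one still finds two free.\<close>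

lemma degenerate_null:
  fixes pos :: "'n::finite \<Rightarrow> nat" and I :: "'k::finite set"
  assumes pos: "inj pos" and X: "vec.subspace X" and dim: "2 * card I \<le> vec.dim X"
  shows "degenerate pos X I \<in> null_sets lborel"
proof -
  have "finite I" by simp
  then show ?thesis using dim
  proof (induction I)
    case empty
    have "degenerate pos X {} = ({} :: (real^'k) set)" by (fastforce simp: degenerate_def)
    then show ?case by simp
  next
    case (insert j I)
    \<comment> \<open>Without the earlier exceptional set, every dependence must involve target
      \<open>j\<close>: otherwise it would already be supported on \<open>I\<close>.\<close>
    let ?D = "degenerate pos X (insert j I) - degenerate pos X I"
    have "?D \<in> null_sets lborel"
    proof (rule null_set_of_countable_lines)
      show "?D \<in> sets borel" using closed_degenerate[OF X] by (intro sets.Diff borel_closed)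
      fix \<theta> :: "real^'k"
      let ?S = "(\<lambda>k. steer pos (\<theta> $ k)) ` I \<union> (\<lambda>k. dsteer pos (\<theta> $ k)) ` I"
      have "card ?S \<le> card I + card I"
        by (rule order_trans[OF card_Un_le add_mono[OF card_image_le card_image_le]]) (rule insert.hyps)+
      then have dimS: "card ?S + 2 \<le> vec.dim X" using insert.prems insert.hyps by simp
      have fin: "finite ?S" using insert.hyps by simp
      \<comment> \<open>Tested against \<open>f\<close> and \<open>g\<close>, the targets in
        \<open>I\<close> disappear. Both vectors depend only on the angles in \<open>I\<close>, so
        the same pair serves the whole line.\<close>
      obtain f g where fg: "f \<in> X" "g \<in> X" "hinner f f = 1" "hinner g g = 1" "hinner f g = 0"
        "\<And>v. v \<in> ?S \<Longrightarrow> hinner f v = 0" "\<And>v. v \<in> ?S \<Longrightarrow> hinner g v = 0"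
        by (rule orthogonal_pair[OF X fin dimS]) (rule that)
      define p where "p = conj_poly pos f"
      define q where "q = conj_poly pos g"
      define W where "W = pderiv p * q - p * pderiv q"
      have "q \<noteq> 0"
      proof
        assume "q = 0"
        then have "g = cnj 0 *s g" by (intro conj_poly_eq_smult[OF pos]) (simp add: q_def)
        then have "g = 0" by simp
        then show False using fg by simp
      qed
      \<comment> \<open>Proportional polynomials would make \<open>f\<close> a multiple of
        \<open>g\<close>, against orthonormality.\<close>
      have "W \<noteq> 0"
      proof
        assume "W = 0"
        then obtain c where "p = smult c q" using wronskian_eq_0[OF \<open>q \<noteq> 0\<close>, of p] by (auto simp: W_def)
        then have "f = cnj c *s g" unfolding p_def q_def by (rule conj_poly_eq_smult[OF pos])
        then have "hinner f f = cnj c * hinner f g" by (metis hinner_scale_right)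
        then show False using fg by simp
      qed
      have "t \<in> {t. cos t = 0 \<or> poly W (phasor (of_real t)) = 0}"
        if "\<theta> + s *\<^sub>R axis j 1 \<in> ?D" and t: "t = \<theta> $ j + s" for s t
      proof -
        let ?\<theta> = "\<theta> + s *\<^sub>R axis j 1"
        have \<theta>: "?\<theta> $ j = t" "\<And>k. k \<noteq> j \<Longrightarrow> ?\<theta> $ k = \<theta> $ k"
          by (simp_all add: t axis_def)
        from that(1) obtain x y where xy: "\<forall>k. k \<notin> insert j I \<longrightarrow> x k = 0 \<and> y k = 0"
          "\<exists>k. x k \<noteq> 0 \<or> y k \<noteq> 0" "\<forall>v\<in>X. hinner v (lin_comb pos ?\<theta> x y) = 0"
          by (auto simp: degenerate_def)
        have nz: "x j \<noteq> 0 \<or> y j \<noteq> 0"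
        proof (rule ccontr)
          assume "\<not> ?thesis"
          then have "x k = 0 \<and> y k = 0" if "k \<notin> I" for k
            using xy(1) that by (cases "k = j") auto
          with xy(2,3) have "?\<theta> \<in> degenerate pos X I" unfolding degenerate_def by blast
          with that(1) show False by blast
        qed
        have red: "hinner h (lin_comb pos ?\<theta> x y) = x j * hinner h (dsteer pos t) + y j * hinner h (steer pos t)"
          if "\<And>v. v \<in> ?S \<Longrightarrow> hinner h v = 0" for h
        proof -
          have "hinner h (lin_comb pos ?\<theta> x y) =
             (\<Sum>k\<in>UNIV. if k = j then x j * hinner h (dsteer pos t) + y j * hinner h (steer pos t) else 0)"
            unfolding lin_comb_def hinner_sum_right hinner_add_right hinner_scale_right
          proof (intro sum.cong refl)
            fix k
            show "x k * hinner h (dsteer pos (?\<theta> $ k)) + y k * hinner h (steer pos (?\<theta> $ k)) =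
              (if k = j then x j * hinner h (dsteer pos t) + y j * hinner h (steer pos t) else 0)"
            proof (cases "k = j")
              case False
              show ?thesis
              proof (cases "k \<in> I")
                case True
                then have "hinner h (dsteer pos (\<theta> $ k)) = 0" "hinner h (steer pos (\<theta> $ k)) = 0"
                  using that by auto
                then show ?thesis by (simp only: \<theta>(2)[OF False]) (simp add: False)
              qed (use xy(1) False in simp)
            next
              case True
              then show ?thesis by (simp only: \<theta>(1)) simp
            qed
          qed
          then show ?thesis by simp
        qed
        define z where "z = phasor (of_real t)"
        define \<kappa> where "\<kappa> = \<i> * of_real (pi * cos t) * z"
        have f0: "x j * (\<kappa> * poly (pderiv p) z) + y j * poly p z = 0"
          using red[OF fg(6)] xy(3) fg(1) by (simp add: hinner_dsteer hinner_steer \<kappa>_def p_def z_def)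
        have g0: "x j * (\<kappa> * poly (pderiv q) z) + y j * poly q z = 0"
          using red[OF fg(7)] xy(3) fg(2) by (simp add: hinner_dsteer hinner_steer \<kappa>_def q_def z_def)
        \<comment> \<open>\<open>f0\<close> and \<open>g0\<close> are a homogeneous linear system in
          \<open>x j\<close> and \<open>y j\<close> with determinant
          \<open>\<kappa> * poly W z\<close>. Eliminating each unknown in turn shows that the
          determinant vanishes.\<close>
        have "x j * (\<kappa> * poly W z) = 0"
        proof -
          have "x j * (\<kappa> * poly W z) = (x j * (\<kappa> * poly (pderiv p) z) + y j * poly p z) * poly q z
            - (x j * (\<kappa> * poly (pderiv q) z) + y j * poly q z) * poly p z"
            by (simp add: W_def algebra_simps)
          then show ?thesis by (simp add: f0 g0)
        qed
        moreover have "y j * (\<kappa> * poly W z) = 0"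
        proof -
          have "y j * (\<kappa> * poly W z) =
              (x j * (\<kappa> * poly (pderiv q) z) + y j * poly q z) * (\<kappa> * poly (pderiv p) z)
            - (x j * (\<kappa> * poly (pderiv p) z) + y j * poly p z) * (\<kappa> * poly (pderiv q) z)"
            by (simp add: W_def algebra_simps)
          then show ?thesis by (simp add: f0 g0)
        qed
        ultimately have "\<kappa> * poly W z = 0" using nz by auto
        then show ?thesis by (auto simp: \<kappa>_def z_def cos_of_real[symmetric] simp del: of_real_mult)
      qed
      then have "{s. \<theta> + s *\<^sub>R axis j 1 \<in> ?D} \<subseteq>
          (\<lambda>s. \<theta> $ j + s) -` {t. cos t = 0 \<or> poly W (phasor (of_real t)) = 0}" by blast
      moreover have "countable ((\<lambda>s. \<theta> $ j + s) -` {t. cos t = 0 \<or> poly W (phasor (of_real t)) = 0})"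
        using poly_phasor_zeros(1)[OF \<open>W \<noteq> 0\<close>] 
        using countable_image_inj_Int_vimage[of "\<lambda>s. \<theta> $ j + s" UNIV]
        unfolding Int_UNIV_left by (rule_tac countable_image_inj_Int_vimage[of _ UNIV, unfolded Int_UNIV_left]) (auto simp: inj_def)
      ultimately show "countable {s. \<theta> + s *\<^sub>R axis j 1 \<in> ?D}" by (rule countable_subset)
    qed
    moreover have "degenerate pos X I \<in> null_sets lborel" using insert by simp
    ultimately have "?D \<union> degenerate pos X I \<in> null_sets lborel" by (rule null_sets.Un)
    then show ?case
      by (rule null_sets_subset) (use borel_closed[OF closed_degenerate[OF X]] in auto)
  qed
qed

lemma not_degenerate:
  assumes "\<theta> \<notin> degenerate pos X UNIV" "\<And>v. v \<in> X \<Longrightarrow> hinner v (lin_comb pos \<theta> x y) = 0"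
  shows "(\<forall>k. x k = 0) \<and> (\<forall>k. y k = 0)"
  using assms by (auto simp: degenerate_def)

lemma orthogonal_complement:
  fixes V :: "(complex^'n::finite) set"
  assumes "vec.subspace V"
  obtains X where "vec.subspace X" "vec.dim X + vec.dim V = CARD('n)"
    "\<And>u v. u \<in> X \<Longrightarrow> v \<in> V \<Longrightarrow> hinner u v = 0"
proof -
  obtain B where B: "orthonormal B" "vec.span B = V"
    using orthonormal_extend[of "{}" V] assms by (auto simp: orthonormal_def)
  obtain C where C: "B \<subseteq> C" "orthonormal C" "vec.span C = UNIV"
    using orthonormal_extend[OF B(1), of UNIV] by auto
  have D: "orthonormal (C - B)" using C(2) by (rule orthonormal_mono) auto
  have dim: "vec.dim (vec.span E) = card E" if "orthonormal E" for E :: "(complex^'n) set"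
    using vec.dim_span_eq_card_independent[OF orthonormal_independent[OF that]] .
  have "vec.dim (vec.span (C - B)) + vec.dim V = card (C - B) + card B"
    using dim[OF D] dim[OF B(1)] B by simp
  also have "\<dots> = card C"
    using C orthonormal_finite by (metis card_Diff_subset card_mono finite_subset le_add_diff_inverse2)
  also have "\<dots> = CARD('n)" using dim[OF C(2)] vec_dim_card C(3) by metis
  finally have "vec.dim (vec.span (C - B)) + vec.dim V = CARD('n)" .
  moreover have "hinner u v = 0" if "u \<in> vec.span (C - B)" "v \<in> V" for u v
  proof -
    have 1: "hinner c b = 0" if "c \<in> C - B" "b \<in> B" for c b
      using that C by (auto simp: orthonormal_def)
    have 2: "hinner c v = 0" if "c \<in> C - B" for c
      using \<open>v \<in> V\<close> unfolding B(2)[symmetric]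
    proof (induction rule: vec.span_induct_alt)
      case (step a b w)
      then show ?case using 1[OF that step(1)] by (simp add: hinner_add_right hinner_scale_right)
    qed simp
    show ?thesis using \<open>u \<in> vec.span (C - B)\<close>
    proof (induction rule: vec.span_induct_alt)
      case (step a b w)
      then show ?case using 2[OF step(1)] by (simp add: hinner_add_left hinner_scale_left)
    qed simp
  qed
  ultimately show ?thesis using that by blast
qed

text \<open>A single nonzero vector orthogonal to \<open>V\<close> turns membership of the steering
  vector in \<open>V\<close> into a polynomial equation for the phasor.\<close>

lemma steer_isolated:
  fixes pos :: "'n::finite \<Rightarrow> nat"
  assumes pos: "inj pos" and V: "vec.subspace V" "vec.dim V < CARD('n)" and x: "steer pos x \<in> V"
  shows "x isolated_in {y. steer pos y \<in> V}"
proof -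
  obtain X where X: "vec.subspace X" "vec.dim X + vec.dim V = CARD('n)"
    "\<And>u v. u \<in> X \<Longrightarrow> v \<in> V \<Longrightarrow> hinner u v = 0"
    using orthogonal_complement[OF V(1)] by blast
  have "\<not> X \<subseteq> {0}"
  proof
    assume "X \<subseteq> {0}"
    then have "vec.dim X = 0" by (simp add: vec.dim_eq_0)
    then show False using X(2) V(2) by linarith
  qed
  then obtain f where f: "f \<in> X" "f \<noteq> 0" by blast
  have "conj_poly pos f \<noteq> 0"
  proof
    assume "conj_poly pos f = 0"
    then have "f = cnj 0 *s f" by (intro conj_poly_eq_smult[OF pos]) simp
    then show False using f by simp
  qed
  moreover have zero: "poly (conj_poly pos f) (phasor (of_real y)) = 0" if "steer pos y \<in> V" for y
    using X(3)[OF f(1) that] by (simp add: hinner_steer)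
  ultimately have "x isolated_in {y. poly (conj_poly pos f) (phasor (of_real y)) = 0}"
    using x by (intro poly_phasor_zeros(2)) auto
  then show ?thesis
    by (rule isolated_in_subset) (use zero x in auto)
qed

section \<open>Continuity of matrix operations\<close>

lemma continuous_on_matrix_mult [continuous_intros]:
  fixes f :: "'a::topological_space \<Rightarrow> complex^'n^'m"
  shows "continuous_on S f \<Longrightarrow> continuous_on S g \<Longrightarrow> continuous_on S (\<lambda>x. f x ** g x)"
  unfolding matrix_matrix_mult_def by (intro continuous_intros)

lemma continuous_on_matrix_vector [continuous_intros]:
  fixes f :: "'a::topological_space \<Rightarrow> complex^'n^'m"
  shows "continuous_on S f \<Longrightarrow> continuous_on S g \<Longrightarrow> continuous_on S (\<lambda>x. f x *v g x)"
  unfolding matrix_vector_mult_def by (intro continuous_intros)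

lemma continuous_on_hconj [continuous_intros]:
  fixes f :: "'a::topological_space \<Rightarrow> complex^'n^'m"
  shows "continuous_on S f \<Longrightarrow> continuous_on S (\<lambda>x. hconj (f x))"
  unfolding hconj_def by (intro continuous_intros)

lemma continuous_on_det [continuous_intros]:
  fixes f :: "'a::topological_space \<Rightarrow> complex^'n^'n"
  shows "continuous_on S f \<Longrightarrow> continuous_on S (\<lambda>x. det (f x))"
  unfolding det_def by (intro continuous_intros)

text \<open>Cramer's rule, written as a quotient of determinants so that continuity of the inverse
  follows from continuity of \<open>det\<close>.\<close>

lemma matrix_inv_nth:
  fixes A :: "'a::field^'n^'n"
  assumes "invertible A"
  shows "matrix_inv A $ i $ j = det (\<chi> p q. if q = i then axis j 1 $ p else A $ p $ q) / det A"
proof -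
  have ax: "M *v axis j 1 = column j M" for M :: "'a^'n^'n"
    by (simp add: vec_eq_iff matrix_vector_mult_def column_def axis_def if_distrib cong: if_cong)
  have "A *v (matrix_inv A *v axis j 1) = axis j 1"
    using matrix_inv_right[OF assms] by (simp add: matrix_vector_mul_assoc)
  moreover have "det A \<noteq> 0" by (rule iffD1[OF invertible_det_nz assms])
  ultimately have "matrix_inv A *v axis j 1 =
      (\<chi> k. det (\<chi> p q. if q = k then axis j 1 $ p else A $ p $ q) / det A)"
    using cramer by blast
  from arg_cong[OF this, of "\<lambda>v. v $ i"] show ?thesis by (simp add: ax column_def)
qed

lemma continuous_on_matrix_inv [continuous_intros]:
  fixes f :: "'a::topological_space \<Rightarrow> complex^'n^'n"
  assumes f: "continuous_on S f" and inv: "\<And>x. x \<in> S \<Longrightarrow> invertible (f x)"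
  shows "continuous_on S (\<lambda>x. matrix_inv (f x))"
proof -
  have cont: "continuous_on S (\<lambda>x. det (\<chi> p q. if q = i then axis j 1 $ p else f x $ p $ q) / det (f x))" for i j
  proof (intro continuous_intros f)
    show "\<forall>x\<in>S. det (f x) \<noteq> 0" using inv by (simp flip: invertible_det_nz)
    show "continuous_on S (\<lambda>x. if q = i then axis j 1 $ p else f x $ p $ q)" for p q
      by (cases "q = i") (simp_all add: f continuous_intros)
  qed
  have "continuous_on S (\<lambda>x. \<chi> i j. det (\<chi> p q. if q = i then axis j 1 $ p else f x $ p $ q) / det (f x))"
    by (intro continuous_on_vec_lambda cont)
  then show ?thesis
  proof (rule continuous_on_eq)
    fix x assume "x \<in> S"
    from matrix_inv_nth[OF inv[OF this]] show "(\<chi> i j. det (\<chi> p q. if q = i then axis j 1 $ p else f x $ p $ q) / det (f x)) = matrix_inv (f x)"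
      by (simp add: vec_eq_iff)
  qed
qed

lemma full_column_rank_iff:
  fixes A :: "complex^'l^'n"
  shows "rank A = CARD('l) \<longleftrightarrow> (\<forall>x. A *v x = 0 \<longrightarrow> x = 0)"
proof -
  have "rank A = CARD('l) \<longleftrightarrow> vec.dim (vec.span (rows A)) = vec.dim (UNIV :: (complex^'l) set)"
    by (simp only: row_rank_def_gen vec.dim_span vec_dim_card)
  also have "\<dots> \<longleftrightarrow> vec.span (rows A) = UNIV"
  proof
    assume "vec.dim (vec.span (rows A)) = vec.dim (UNIV :: (complex^'l) set)"
    then have "vec.span (vec.span (rows A)) = vec.span UNIV"
      by (intro vec.dim_eq_span) auto
    then show "vec.span (rows A) = UNIV" by (simp only: vec.span_span vec.span_UNIV)
  qed (simp only:)
  also have "\<dots> \<longleftrightarrow> (\<forall>x. A *v x = 0 \<longrightarrow> x = 0)"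
    by (simp only: matrix_left_invertible_span_rows_gen[symmetric] matrix_left_invertible_ker)
  finally show ?thesis .
qed

text \<open>Full rank becomes the nonvanishing of a continuous function; this gives open parameter
  domains and exhaustion by closed sets.\<close>

lemma full_column_rank_det:
  fixes A :: "complex^'l^'n"
  shows "rank A = CARD('l) \<longleftrightarrow> det (hconj A ** A) \<noteq> 0"
proof
  assume r: "rank A = CARD('l)"
  have "x = 0" if "A *v x = 0" for x by (rule mp[OF spec[OF iffD1[OF full_column_rank_iff r]] that])
  then have "invertible (hconj A ** A)" by (rule invertible_hermitian_product)
  then show "det (hconj A ** A) \<noteq> 0" by (rule iffD1[OF invertible_det_nz])
next
  assume "det (hconj A ** A) \<noteq> 0"
  then have inv: "invertible (hconj A ** A)" by (rule iffD2[OF invertible_det_nz])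
  have "x = 0" if "A *v x = 0" for x
  proof -
    have "x = matrix_inv (hconj A ** A) *v (hconj A *v (A *v x))"
      using matrix_inv_left[OF inv] by (simp add: matrix_vector_mul_assoc flip: matrix_mul_assoc)
    then show ?thesis using that by simp
  qed
  then show "rank A = CARD('l)" unfolding full_column_rank_iff by blast
qed

section \<open>Degrees of freedom of the phase-shifter subspaces\<close>

lemma has_derivative_vec_lambda:
  fixes f :: "'a::real_normed_vector \<Rightarrow> 'i::finite \<Rightarrow> 'b::euclidean_space"
  assumes "\<And>i. ((\<lambda>x. f x i) has_derivative (\<lambda>v. f' v i)) (at a)"
  shows "((\<lambda>x. \<chi> i. f x i) has_derivative (\<lambda>v. \<chi> i. f' v i)) (at a)"
  unfolding has_derivative_componentwise_within[of "\<lambda>x. \<chi> i. f x i"]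
proof
  fix b :: "'b^'i" assume "b \<in> Basis"
  then obtain i u where "b = axis i u" by (auto simp: Basis_vec_def)
  then show "((\<lambda>x. (\<chi> i. f x i) \<bullet> b) has_derivative (\<lambda>v. (\<chi> i. f' v i) \<bullet> b)) (at a)"
    using has_derivative_inner_left[OF assms[of i], of u] by (simp add: inner_axis)
qed

text \<open>Multiplying a row by a unit phase keeps the row space, so every row can be normalised at
  one antenna \<open>n0\<close>. This leaves \<open>CARD('n) - 1\<close> free phases in each of the
  \<open>CARD('l)\<close> rows.\<close>

lemma real_dof_R_PS:
  assumes q: "CARD('q::finite) = CARD('l::finite) * (CARD('n::finite) - 1)"
  shows "real_dof_at_most TYPE(real^'q) TYPE('l) (R_PS TYPE('l) :: (complex^'n) set set)"
proof -
  obtain n0 :: 'n where True by simp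
  define S :: "('l \<times> 'n) set" where "S = UNIV \<times> (UNIV - {n0})"
  have "card S = CARD('q)" by (simp add: S_def card_cartesian_product q card_Diff_subset)
  then obtain h :: "'q \<Rightarrow> 'l \<times> 'n" where h: "bij_betw h UNIV S"
    using finite_same_card_bij[of "UNIV :: 'q set" S] by auto
  define idx where "idx = inv_into UNIV h"
  have idx: "h (idx (l, n)) = (l, n)" if "n \<noteq> n0" for l n
    using h that unfolding idx_def by (intro f_inv_into_f) (auto simp: bij_betw_def S_def)
  define ph :: "real^'q \<Rightarrow> 'n \<Rightarrow> 'l \<Rightarrow> real" where
    "ph x n l = (if n = n0 then 0 else x $ idx (l, n))" for x n l
  define N where "N = complex_of_real (sqrt (real CARD('n)))"
  have N: "N \<noteq> 0" "cmod N = sqrt (real CARD('n))" by (simp_all add: N_def)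
  define B :: "real^'q \<Rightarrow> complex^'l^'n" where
    "B x = (\<chi> n l. cis (ph x n l) / N)" for x
  define B' :: "real^'q \<Rightarrow> real^'q \<Rightarrow> complex^'l^'n" where
    "B' x v = (\<chi> n l. of_real (ph v n l) * (\<i> * cis (ph x n l) / N))" for x v
  have dB: "(B has_derivative B' x) (at x)" for x
    unfolding B_def B'_def
  proof (intro has_derivative_vec_lambda)
    fix n l
    have "((\<lambda>x. ph x n l) has_derivative (\<lambda>v. ph v n l)) (at x)"
      by (cases "n = n0") (simp_all add: ph_def bounded_linear_imp_has_derivative bounded_linear_vec_nth)
    moreover have "((\<lambda>r. cis r / N) has_vector_derivative (\<i> * cis (ph x n l) / N)) (at (ph x n l))"
    proof -
      have "((\<lambda>r. exp (\<i> * complex_of_real r)) has_vector_derivative \<i> * exp (\<i> * complex_of_real (ph x n l))) (at (ph x n l))"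
      proof -
        have "((\<lambda>r. \<i> * complex_of_real r) has_vector_derivative \<i> * of_real 1) (at (ph x n l))"
          by (intro has_vector_derivative_mult_right has_vector_derivative_of_real DERIV_ident)
        from field_vector_diff_chain_at[OF this DERIV_exp] show ?thesis by (simp add: o_def)
      qed
      then show ?thesis unfolding cis_conv_exp by (rule has_vector_derivative_divide)
    qed
    ultimately have "((\<lambda>r. cis r / N) \<circ> (\<lambda>x. ph x n l) has_derivative
        (\<lambda>r. r *\<^sub>R (\<i> * cis (ph x n l) / N)) \<circ> (\<lambda>v. ph v n l)) (at x)"
      unfolding has_vector_derivative_def by (rule diff_chain_at)
    then show "((\<lambda>x. cis (ph x n l) / N) has_derivative
        (\<lambda>v. of_real (ph v n l) * (\<i> * cis (ph x n l) / N))) (at x)"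
      by (simp add: o_def scaleR_conv_of_real)
  qed
  then have bl: "bounded_linear (B' x)" for x by (rule has_derivative_bounded_linear)
  have cB: "continuous_on A B" for A
    using dB by (intro differentiable_imp_continuous_on) (auto simp: differentiable_on_def differentiable_def intro: has_derivative_at_withinI)
  define D where "D = {x. det (hconj (B x) ** B x) \<noteq> 0}"
  have D_rank: "x \<in> D \<longleftrightarrow> rank (B x) = CARD('l)" for x
    by (simp only: D_def full_column_rank_det mem_Collect_eq)
  have "open D"
    unfolding D_def by (intro open_Collect_neq continuous_intros cB)
  moreover have "\<forall>x\<in>D. (B has_derivative blinfun_apply (Blinfun (B' x))) (at x)"
    using dB bl by (simp add: bounded_linear_Blinfun_apply)
  moreover have "continuous_on D (\<lambda>x. Blinfun (B' x))"
  proof (rule continuous_on_blinfun_componentwise)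
    fix v :: "real^'q"
    have cph: "continuous_on D (\<lambda>x. ph x n l)" for n l
      by (cases "n = n0") (simp_all add: ph_def continuous_intros)
    have "continuous_on D (\<lambda>x. B' x v)"
      unfolding B'_def by (intro continuous_intros cph) (simp add: N(1))
    then show "continuous_on D (\<lambda>x. blinfun_apply (Blinfun (B' x)) v)"
      by (simp add: bounded_linear_Blinfun_apply[OF bl])
  qed
  moreover have "R_PS TYPE('l) \<subseteq> (\<lambda>x. col_space (B x)) ` D"
  proof
    fix V :: "(complex^'n) set" assume "V \<in> R_PS TYPE('l)"
    then obtain F :: "complex^'n^'l" where F: "V = row_space F" "F \<in> F_PS" "rank F = CARD('l)"
      by (auto simp: R_PS_def)
    have cF: "cmod (F $ l $ n) = 1 / sqrt (real CARD('n))" for l n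
      using F(2) by (simp add: F_PS_def)
    \<comment> \<open>The unit phase that makes the entry at \<open>n0\<close> real:
      \<open>cnj (F $ l $ n0) * d l = 1 / N\<close>, which is the entry of \<open>B\<close> at phase
      0.\<close>
    define d where "d l = N * F $ l $ n0" for l
    have d: "cmod (d l) = 1" "d l \<noteq> 0" for l
    proof -
      show "cmod (d l) = 1" by (simp add: d_def norm_mult cF N(2))
      then show "d l \<noteq> 0" by auto
    qed
    define x :: "real^'q" where
      "x = (\<chi> k. Arg (N * cnj (F $ fst (h k) $ snd (h k)) * d (fst (h k))))"
    have Bx: "B x $ n $ l = cnj (F $ l $ n) * d l" for n l
    proof (cases "n = n0")
      case True
      have "cnj (F $ l $ n0) * F $ l $ n0 = of_real ((cmod (F $ l $ n0))\<^sup>2)"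
        by (simp only: complex_norm_square mult.commute)
      also have "\<dots> = 1 / (N * N)"
        by (simp add: cF N_def power_divide flip: of_real_mult)
      finally show ?thesis using True N(1) by (simp add: B_def ph_def d_def field_simps)
    next
      case False
      have n1: "cmod (N * cnj (F $ l $ n) * d l) = 1" by (simp add: norm_mult cF d N(2))
      then have nz: "N * cnj (F $ l $ n) * d l \<noteq> 0" using norm_zero zero_neq_one by metis
      have "sgn (N * cnj (F $ l $ n) * d l) = N * cnj (F $ l $ n) * d l"
        unfolding sgn_div_norm n1 by simp
      then have "cis (Arg (N * cnj (F $ l $ n) * d l)) = N * cnj (F $ l $ n) * d l"
        by (rule trans[OF cis_Arg[OF nz]])
      then show ?thesis using False N(1) by (simp add: B_def ph_def x_def idx)
    qed
    have Bu: "B x *v u = hconj F *v (\<chi> l. d l * u $ l)" for u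
      by (simp add: vec_eq_iff matrix_vector_mult_def Bx mult_ac)
    have "u = 0" if "B x *v u = 0" for u
    proof -
      have "(\<chi> l. d l * u $ l) = 0"
        by (rule mp[OF spec[OF iffD1[OF full_row_rank_iff F(3)]]]) (use that Bu in simp)
      then show ?thesis using d(2) by (simp add: vec_eq_iff)
    qed
    then have "rank (B x) = CARD('l)" unfolding full_column_rank_iff by blast
    then have "x \<in> D" by (simp only: D_rank)
    moreover have "col_space (B x) = V"
      unfolding F(1) row_space_def col_space_eq_range
    proof safe
      show "B x *v u \<in> range ((*v) (hconj F))" for u by (simp add: Bu)
      show "hconj F *v u \<in> range ((*v) (B x))" for u
      proof (rule range_eqI)
        show "hconj F *v u = B x *v (\<chi> l. u $ l / d l)" using d(2) by (simp add: Bu)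
      qed
    qed
    ultimately show "V \<in> (\<lambda>x. col_space (B x)) ` D" by auto
  qed
  ultimately show ?thesis
    unfolding real_dof_at_most_def using D_rank by (intro exI[of _ D] exI[of _ B] exI[of _ "\<lambda>x. Blinfun (B' x)"]) auto
qed

section \<open>The Grassmannian is a manifold\<close>

text \<open>Points of \<open>Euclidean_space d\<close> are sequences that vanish from index
  \<open>d\<close> on, so orthonormal coordinates are padded with zeros.\<close>

lemma subspace_homeomorphic_Euclidean_space:
  fixes W :: "'a::euclidean_space set"
  assumes W: "subspace W"
  shows "top_of_set W homeomorphic_space Euclidean_space (dim W)"
proof -
  let ?d = "dim W"
  obtain C where C: "C \<subseteq> W" "pairwise orthogonal C" "\<And>x. x \<in> C \<Longrightarrow> norm x = 1"
    "independent C" "card C = ?d" "span C = W"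
    by (rule orthonormal_basis_subspace[OF W]) (rule that)
  have finC: "finite C" using C(4) by (rule independent_imp_finite)
  obtain b where b: "bij_betw b {..<?d} C"
    using finite_same_card_bij[of "{..<?d}" C] finC C(5) by auto
  have bC: "b i \<in> C" if "i < ?d" for i using b that by (auto simp: bij_betw_def)
  have bb: "b i \<bullet> b j = (if i = j then 1 else 0)" if "i < ?d" "j < ?d" for i j
  proof (cases "i = j")
    case True
    then show ?thesis using C(3)[OF bC[OF that(1)]] by (simp add: norm_eq_1)
  next
    case False
    then have "b i \<noteq> b j" using b that by (auto simp: bij_betw_def inj_on_def)
    then show ?thesis using C(2) bC that False by (auto simp: pairwise_def orthogonal_def)
  qed
  define \<xi> where "\<xi> z = (\<lambda>i. if i < ?d then z \<bullet> b i else 0)" for z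
  define \<eta> where "\<eta> x = (\<Sum>i<?d. x i *\<^sub>R b i)" for x :: "nat \<Rightarrow> real"
  have \<eta>W: "\<eta> x \<in> W" for x
    unfolding \<eta>_def using bC C(1) W by (intro subspace_sum subspace_scale) auto
  have \<xi>\<eta>: "\<eta> x \<bullet> b j = x j" if "j < ?d" for x j
  proof -
    have "\<eta> x \<bullet> b j = (\<Sum>i<?d. if i = j then x i else 0)"
      unfolding \<eta>_def inner_sum_left using bb that by (intro sum.cong) auto
    then show ?thesis using that by simp
  qed
  have \<eta>\<xi>: "\<eta> (\<xi> z) = z" if "z \<in> W" for z
  proof -
    define y where "y = \<eta> (\<xi> z) - z"
    have y: "y \<in> span C" unfolding y_def C(6) using \<eta>W that W by (intro subspace_diff) auto
    have "orthogonal y c" if "c \<in> C" for c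
    proof -
      obtain j where j: "j < ?d" "c = b j" using b \<open>c \<in> C\<close> by (auto simp: bij_betw_def)
      then show ?thesis using \<xi>\<eta>[of j "\<xi> z"]
        by (simp add: orthogonal_def y_def inner_diff_left \<xi>_def)
    qed
    then have "orthogonal y y" using orthogonal_to_span[OF y] by blast
    then show ?thesis by (simp add: orthogonal_self y_def)
  qed
  have "continuous_map (top_of_set W) (Euclidean_space ?d) \<xi>"
    unfolding \<xi>_def continuous_map_componentwise_Euclidean_space
    by (auto intro!: continuous_intros)
  moreover have "continuous_map (Euclidean_space ?d) (top_of_set W) \<eta>"
  proof -
    have "continuous_on A \<eta>" for A
      unfolding \<eta>_def
      by (intro continuous_intros continuous_on_subset[OF continuous_on_product_coordinates]) auto
    then show ?thesis
      unfolding Euclidean_space_def euclidean_product_topology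
      using \<eta>W by (simp add: continuous_map_in_subtopology Pi_iff)
  qed
  moreover have "\<xi> (\<eta> x) = x" if "x \<in> topspace (Euclidean_space ?d)" for x
    using that \<xi>\<eta> by (auto simp: \<xi>_def fun_eq_iff topspace_Euclidean_space)
  ultimately show ?thesis
    unfolding homeomorphic_space_def homeomorphic_maps_def using \<eta>\<xi>
    by (intro exI[of _ \<xi>] exI[of _ \<eta>]) auto
qed

text \<open>For the real Frobenius inner product, left multiplication by \<open>hconj A\<close> is
  the adjoint of left multiplication by \<open>A\<close>.\<close>

lemma inner_matrix_mult:
  fixes A :: "complex^'m^'n" and Y :: "complex^'l^'m" and Z :: "complex^'l^'n"
  shows "(A ** Y) \<bullet> Z = Y \<bullet> (hconj A ** Z)"
proof -
  have *: "(a * b) \<bullet> c = b \<bullet> (cnj a * c)" for a b c :: complex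
    by (simp add: inner_complex_def algebra_simps)
  have "(A ** Y) \<bullet> Z = (\<Sum>n\<in>UNIV. \<Sum>l\<in>UNIV. \<Sum>m\<in>UNIV. Y $ m $ l \<bullet> (cnj (A $ n $ m) * Z $ n $ l))"
    by (simp add: inner_vec_def matrix_matrix_mult_def inner_sum_left *)
  also have "\<dots> = (\<Sum>l\<in>UNIV. \<Sum>n\<in>UNIV. \<Sum>m\<in>UNIV. Y $ m $ l \<bullet> (cnj (A $ n $ m) * Z $ n $ l))"
    by (rule sum.swap)
  also have "\<dots> = (\<Sum>l\<in>UNIV. \<Sum>m\<in>UNIV. \<Sum>n\<in>UNIV. Y $ m $ l \<bullet> (cnj (A $ n $ m) * Z $ n $ l))"
    by (intro sum.cong refl sum.swap)
  also have "\<dots> = (\<Sum>m\<in>UNIV. \<Sum>l\<in>UNIV. \<Sum>n\<in>UNIV. Y $ m $ l \<bullet> (cnj (A $ n $ m) * Z $ n $ l))"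
    by (rule sum.swap)
  also have "\<dots> = Y \<bullet> (hconj A ** Z)"
    by (simp add: inner_vec_def matrix_matrix_mult_def inner_sum_right)
  finally show ?thesis .
qed

text \<open>The annihilator is the real orthogonal complement of the image of
  \<open>Y \<mapsto> A ** Y\<close>. This map is injective, so its image has the real dimension of
  the square matrices of size \<open>CARD('l)\<close>.\<close>

lemma dim_annihilator:
  fixes A :: "complex^'l^'n"
  assumes A: "hconj A ** A = mat 1"
  shows "subspace {Z :: complex^'l^'n. hconj A ** Z = 0}"
    and "dim {Z :: complex^'l^'n. hconj A ** Z = 0} = 2 * CARD('l) * (CARD('n) - CARD('l))"
proof -
  have lin: "linear (\<lambda>Y :: complex^'l^'l. A ** Y)" "linear (\<lambda>Z :: complex^'l^'n. hconj A ** Z)"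
    by (auto intro!: linearI simp: matrix_matrix_mult_def vec_eq_iff sum.distrib algebra_simps scaleR_sum_right)
  let ?W = "{Z :: complex^'l^'n. hconj A ** Z = 0}"
  let ?R = "range (\<lambda>Y :: complex^'l^'l. A ** Y)"
  show "subspace ?W" using linear_subspace_kernel[OF lin(2)] .
  have W: "?W = {Z \<in> UNIV. \<forall>X \<in> ?R. orthogonal X Z}"
  proof (intro set_eqI iffI)
    fix Z assume "Z \<in> {Z \<in> UNIV. \<forall>X \<in> ?R. orthogonal X Z}"
    then have "(A ** (hconj A ** Z)) \<bullet> Z = 0" unfolding orthogonal_def by blast
    then have "(hconj A ** Z) \<bullet> (hconj A ** Z) = 0"
      using inner_matrix_mult[of A "hconj A ** Z" Z] by (rule_tac trans[OF sym])
    then show "Z \<in> ?W" by simp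
  qed (auto simp: orthogonal_def inner_matrix_mult)
  have "dim ?W + dim ?R = dim (UNIV :: (complex^'l^'n) set)"
    unfolding W using linear_subspace_image[OF lin(1) subspace_UNIV]
    by (intro dim_subspace_orthogonal_to_vectors) auto
  moreover have "dim ?R = dim (UNIV :: (complex^'l^'l) set)"
  proof (rule dim_image_eq[OF lin(1)])
    have "Y = Y'" if "A ** Y = A ** Y'" for Y Y' :: "complex^'l^'l"
      using arg_cong[OF that, of "\<lambda>X. hconj A ** X"] by (simp add: matrix_mul_assoc A)
    then show "inj_on (\<lambda>Y :: complex^'l^'l. A ** Y) (span UNIV)" by (intro inj_onI)
  qed
  \<comment> \<open>The subtraction is on natural numbers, so \<open>CARD('l) \<le> CARD('n)\<close>
    is first extracted from the injectivity of \<open>A\<close>.\<close>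
  moreover have "2 * CARD('l) * (CARD('n) - CARD('l)) + 2 * CARD('l) * CARD('l) = 2 * CARD('l) * CARD('n)"
  proof -
    have "x = 0" if "A *v x = 0" for x
      using arg_cong[OF that, of "\<lambda>v. hconj A *v v"] by (simp add: matrix_vector_mul_assoc A)
    then have "\<forall>x. A *v x = 0 \<longrightarrow> x = 0" by blast
    then have "vec.dim (col_space A) = CARD('l)" by (simp only: dim_col_space)
    then have "CARD('l) \<le> CARD('n)" using dim_subset_UNIV_cart_gen[of "col_space A"] by simp
    then have "2 * CARD('l) * ((CARD('n) - CARD('l)) + CARD('l)) = 2 * CARD('l) * CARD('n)" by simp
    then show ?thesis by (simp only: distrib_left)
  qed
  ultimately show "dim ?W = 2 * CARD('l) * (CARD('n) - CARD('l))"
    by (simp add: mult_ac)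
qed

lemma topspace_gr_topology [simp]: "topspace (gr_topology L) = grassmannian L"
  by (simp add: gr_topology_def topspace_pullback_topology)

lemma is_proj_grassmannian: "V \<in> grassmannian L \<Longrightarrow> is_proj (orth_proj V) V"
  by (simp add: grassmannian_def is_proj_orth_proj)

lemma orth_proj_inj:
  assumes "V \<in> grassmannian L" "V' \<in> grassmannian L" "orth_proj V = orth_proj V'"
  shows "V = V'"
  using is_proj_grassmannian[OF assms(1)] is_proj_grassmannian[OF assms(2)] assms(3)
  by (simp add: is_proj_def)

text \<open>The topology is pulled back from a Hausdorff space along \<open>orth_proj\<close>, which
  is injective on the Grassmannian.\<close>

lemma Hausdorff_gr_topology: "Hausdorff_space (gr_topology L :: (complex^'n) set topology)"
  unfolding Hausdorff_space_def topspace_gr_topology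
proof (intro allI impI)
  fix V V' :: "(complex^'n) set"
  assume V: "V \<in> grassmannian L \<and> V' \<in> grassmannian L \<and> V \<noteq> V'"
  then have "orth_proj V \<noteq> orth_proj V'" using orth_proj_inj by blast
  then obtain U U' where U: "open U" "open U'" "orth_proj V \<in> U" "orth_proj V' \<in> U'" "U \<inter> U' = {}"
    using hausdorff by metis
  show "\<exists>U U'. openin (gr_topology L) U \<and> openin (gr_topology L) U' \<and> V \<in> U \<and> V' \<in> U' \<and> disjnt U U'"
  proof (intro exI conjI)
    show "openin (gr_topology L) (orth_proj -` U \<inter> grassmannian L)"
      "openin (gr_topology L) (orth_proj -` U' \<inter> grassmannian L)"
      using U by (auto simp: gr_topology_def openin_pullback_topology)
    show "disjnt (orth_proj -` U \<inter> grassmannian L) (orth_proj -` U' \<inter> grassmannian L)"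
      using U(5) by (auto simp: disjnt_def)
  qed (use U V in auto)
qed

lemma ex_frame:
  fixes V :: "(complex^'n) set"
  assumes V: "V \<in> grassmannian CARD('l::finite)"
  obtains A :: "complex^'l^'n" where "hconj A ** A = mat 1" "col_space A = V"
proof -
  have sub: "vec.subspace V" and dim: "vec.dim V = CARD('l)" using V by (simp_all add: grassmannian_def)
  obtain B where B: "orthonormal B" "vec.span B = V"
    using orthonormal_extend[of "{}" V] sub by (auto simp: orthonormal_def)
  have "card B = CARD('l)"
    using vec.dim_span_eq_card_independent[OF orthonormal_independent[OF B(1)]] B(2) dim by simp
  then obtain f :: "'l \<Rightarrow> complex^'n" where f: "bij_betw f UNIV B"
    using finite_same_card_bij[of "UNIV :: 'l set" B] orthonormal_finite[OF B(1)] by auto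
  define A :: "complex^'l^'n" where "A = (\<chi> n l. f l $ n)"
  have "hinner (f l) (f m) = (if l = m then 1 else 0)" for l m
    using B(1) f by (auto simp: orthonormal_def bij_betw_def inj_def)
  then have "hconj A ** A = mat 1"
    by (simp add: A_def vec_eq_iff matrix_matrix_mult_def mat_def hinner_def)
  moreover have "col_space A = V"
  proof -
    have "columns A = range f" by (auto simp: columns_def column_def A_def)
    then show ?thesis using f B(2) by (simp add: col_space_def bij_betw_def)
  qed
  ultimately show ?thesis by (rule that)
qed

text \<open>Near the column space of an orthonormal frame \<open>A\<close>, every subspace is the column space
  of \<open>A + Z\<close> for a unique \<open>Z\<close> whose columns are orthogonal to those of \<open>A\<close>.\<close>

lemma grassmannian_chart:
  fixes A :: "complex^'l^'n"
  assumes A: "hconj A ** A = mat 1"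
  defines "W \<equiv> {Z :: complex^'l^'n. hconj A ** Z = 0}"
    and "U \<equiv> {V \<in> grassmannian CARD('l). det (hconj A ** orth_proj V ** A) \<noteq> 0}"
  shows "openin (gr_topology CARD('l)) U" and "col_space A \<in> U"
    and "subtopology (gr_topology CARD('l)) U homeomorphic_space top_of_set W"
proof -
  let ?X = "gr_topology CARD('l) :: (complex^'n) set topology"
  define O' where "O' = {P :: complex^'n^'n. det (hconj A ** P ** A) \<noteq> 0}"
  have "open O'" unfolding O'_def by (intro open_Collect_neq continuous_intros)
  have U: "U = orth_proj -` O' \<inter> grassmannian CARD('l)" by (auto simp: U_def O'_def)
  show "openin ?X U"
    unfolding gr_topology_def openin_pullback_topology using U \<open>open O'\<close> by auto
  have inj: "x = 0" if Z: "Z \<in> W" and "(A + Z) *v x = 0" for Z x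
    using arg_cong[OF that(2), of "\<lambda>v. hconj A *v v"] Z
    by (simp add: W_def matrix_vector_mul_assoc matrix_add_ldistrib A)
  have gr: "col_space (A + Z) \<in> grassmannian CARD('l)" if Z: "Z \<in> W" for Z
  proof -
    have "\<forall>x. (A + Z) *v x = 0 \<longrightarrow> x = 0" using inj[OF Z] by blast
    then have "vec.dim (col_space (A + Z)) = CARD('l)" by (simp only: dim_col_space)
    then show ?thesis by (simp add: grassmannian_def subspace_col_space)
  qed
  define G where "G Z = hconj (A + Z) ** (A + Z)" for Z
  have invG: "invertible (G Z)" if "Z \<in> W" for Z
    unfolding G_def using inj[OF that] by (rule invertible_hermitian_product)
  have proj: "orth_proj (col_space (A + Z)) = (A + Z) ** matrix_inv (G Z) ** hconj (A + Z)" if Z: "Z \<in> W" for Z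
    unfolding G_def using is_proj_col_space[of "A + Z"] inj[OF Z]
    by (intro orth_proj_eqI subspace_col_space) auto
  have AZ: "hconj A ** (A + Z) = mat 1" "hconj (A + Z) ** A = mat 1" if Z: "Z \<in> W" for Z
  proof -
    show *: "hconj A ** (A + Z) = mat 1" using Z by (simp add: W_def matrix_add_ldistrib A)
    show "hconj (A + Z) ** A = mat 1" using arg_cong[OF *, of hconj] by (simp add: hconj_mult)
  qed
  have PA: "orth_proj (col_space (A + Z)) ** A = (A + Z) ** matrix_inv (G Z)" if Z: "Z \<in> W" for Z
    unfolding proj[OF Z] by (simp add: AZ[OF Z] flip: matrix_mul_assoc)
  \<comment> \<open>Since the right side is invertible, this puts the subspace into
    \<open>U\<close>; it also shows how \<open>G Z\<close> can be recovered from the projection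
    alone.\<close>
  have APA: "hconj A ** orth_proj (col_space (A + Z)) ** A = matrix_inv (G Z)" if Z: "Z \<in> W" for Z
  proof -
    have "hconj A ** orth_proj (col_space (A + Z)) ** A = hconj A ** (orth_proj (col_space (A + Z)) ** A)"
      by (simp only: matrix_mul_assoc)
    also have "\<dots> = (hconj A ** (A + Z)) ** matrix_inv (G Z)"
      unfolding PA[OF Z] by (simp only: matrix_mul_assoc)
    finally show ?thesis by (simp add: AZ[OF Z])
  qed
  have inv_inv: "invertible (matrix_inv (G Z))" "matrix_inv (matrix_inv (G Z)) = G Z" if Z: "Z \<in> W" for Z
  proof -
    note i = matrix_inv_left[OF invG[OF Z]] matrix_inv_right[OF invG[OF Z]]
    show "invertible (matrix_inv (G Z))" unfolding invertible_def using i by blast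
    show "matrix_inv (matrix_inv (G Z)) = G Z" using i by (rule matrix_inv_unique)
  qed
  have inU: "col_space (A + Z) \<in> U" if Z: "Z \<in> W" for Z
    unfolding U_def using gr[OF Z] APA[OF Z] inv_inv(1)[OF Z]
    by (simp add: invertible_det_nz)
  have "0 \<in> W" by (simp add: W_def matrix_matrix_mult_def vec_eq_iff)
  from inU[OF this] show "col_space A \<in> U" by simp
  \<comment> \<open>For the projection onto a member of \<open>U\<close>, the columns of
    \<open>P ** A\<close> are a basis of the subspace. The inverse factor changes that basis so that
    \<open>hconj A\<close> maps it to the identity, and subtracting \<open>A\<close> leaves the
    chart coordinate.\<close>
  define \<phi> where "\<phi> P = P ** A ** matrix_inv (hconj A ** P ** A) - A" for P :: "complex^'n^'n"
  have \<phi>W: "\<phi> P \<in> W" if "P \<in> O'" for P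
  proof -
    have "invertible (hconj A ** P ** A)" using that by (simp add: O'_def invertible_det_nz)
    from matrix_inv_right[OF this] have "hconj A ** (P ** A ** matrix_inv (hconj A ** P ** A)) = mat 1"
      by (simp add: matrix_mul_assoc)
    moreover have "hconj A ** (X - Y) = hconj A ** X - hconj A ** Y" for X Y :: "complex^'l^'n"
      by (simp add: vec_eq_iff matrix_matrix_mult_def sum_subtractf algebra_simps)
    ultimately show ?thesis by (simp add: W_def \<phi>_def A)
  qed
  have c\<phi>: "continuous_on O' \<phi>"
    unfolding \<phi>_def by (intro continuous_intros) (simp add: O'_def invertible_det_nz)
  have c1: "continuous_map (subtopology ?X U) (top_of_set W) (\<phi> \<circ> orth_proj)"
  proof (rule continuous_map_compose)
    have "continuous_map ?X euclidean (id \<circ> orth_proj)"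
      unfolding gr_topology_def by (rule continuous_map_pullback) simp
    then have "continuous_map ?X euclidean orth_proj" by simp
    then show "continuous_map (subtopology ?X U) (top_of_set O') orth_proj"
      by (simp add: continuous_map_in_subtopology continuous_map_from_subtopology) (auto simp: U)
    show "continuous_map (top_of_set O') (top_of_set W) \<phi>"
      using c\<phi> \<phi>W by (auto simp: continuous_map_in_subtopology)
  qed
  have c2: "continuous_map (top_of_set W) (subtopology ?X U) (\<lambda>Z. col_space (A + Z))"
    unfolding continuous_map_in_subtopology
  proof (intro conjI)
    have "continuous_on W (\<lambda>Z. (A + Z) ** matrix_inv (G Z) ** hconj (A + Z))"
      unfolding G_def by (intro continuous_intros) (use invG in \<open>simp add: G_def\<close>)
    then have "continuous_on W (\<lambda>Z. orth_proj (col_space (A + Z)))"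
      by (rule continuous_on_eq) (simp add: proj)
    then have "continuous_map (top_of_set W) euclidean (orth_proj \<circ> (\<lambda>Z. col_space (A + Z)))"
      by (simp add: o_def)
    then show "continuous_map (top_of_set W) ?X (\<lambda>Z. col_space (A + Z))"
      unfolding gr_topology_def by (rule continuous_map_pullback') (use gr in auto)
  qed (use inU in auto)
  have inv1: "(\<phi> \<circ> orth_proj) (col_space (A + Z)) = Z" if Z: "Z \<in> W" for Z
  proof -
    have "orth_proj (col_space (A + Z)) ** A ** matrix_inv (hconj A ** orth_proj (col_space (A + Z)) ** A)
        = A + Z"
      unfolding APA[OF Z] PA[OF Z] inv_inv(2)[OF Z]
      by (simp add: matrix_inv_left[OF invG[OF Z]] flip: matrix_mul_assoc)
    then show ?thesis by (simp add: \<phi>_def)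
  qed
  have inv2: "col_space (A + (\<phi> \<circ> orth_proj) V) = V" if V: "V \<in> U" for V
  proof -
    let ?P = "orth_proj V"
    have P: "is_proj ?P V" using V by (auto simp: U_def intro: is_proj_grassmannian)
    have W: "\<phi> ?P \<in> W" using V U by (intro \<phi>W) auto
    have "A + \<phi> ?P = ?P ** (A ** matrix_inv (hconj A ** ?P ** A))"
      by (simp add: \<phi>_def matrix_mul_assoc)
    then have "col_space (A + \<phi> ?P) \<subseteq> V"
      unfolding col_space_eq_range using is_proj_in[OF P] by (auto simp flip: matrix_vector_mul_assoc)
    moreover have "vec.dim V = vec.dim (col_space (A + \<phi> ?P))"
      using gr[OF W] V by (simp add: grassmannian_def U_def)
    moreover have "vec.subspace V" using V by (simp add: U_def grassmannian_def)
    ultimately show ?thesis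
      using vec.subspace_dim_equal[OF subspace_col_space, of V "A + \<phi> ?P"] by simp
  qed
  show "subtopology ?X U homeomorphic_space top_of_set W"
    unfolding homeomorphic_space_def homeomorphic_maps_def
    using c1 c2 inv1 inv2 by (intro exI[of _ "\<phi> \<circ> orth_proj"] exI[of _ "\<lambda>Z. col_space (A + Z)"]) auto
qed

lemma manifold_dim_grassmannian:
  "manifold_dim (gr_topology CARD('l::finite) :: (complex^'n) set topology)
     (2 * CARD('l) * (CARD('n) - CARD('l)))"
  unfolding manifold_dim_def
proof (intro conjI ballI Hausdorff_gr_topology)
  fix V :: "(complex^'n) set" assume "V \<in> topspace (gr_topology CARD('l))"
  then obtain A :: "complex^'l^'n" where A: "hconj A ** A = mat 1" "col_space A = V"
    using ex_frame[of V] by auto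
  let ?d = "2 * CARD('l) * (CARD('n) - CARD('l))"
  let ?U = "{V \<in> grassmannian CARD('l). det (hconj A ** orth_proj V ** A) \<noteq> 0}"
  have "subtopology (gr_topology CARD('l)) ?U homeomorphic_space Euclidean_space ?d"
    using grassmannian_chart(3)[OF A(1)] subspace_homeomorphic_Euclidean_space[OF dim_annihilator(1)[OF A(1)]]
    unfolding dim_annihilator(2)[OF A(1)] by (rule homeomorphic_space_trans)
  then show "\<exists>U V'. openin (gr_topology CARD('l)) U \<and> V \<in> U \<and> openin (Euclidean_space ?d) V' \<and>
      subtopology (gr_topology CARD('l)) U homeomorphic_space subtopology (Euclidean_space ?d) V'"
    using grassmannian_chart(1,2)[OF A(1)] A(2)
    by (intro exI[of _ ?U] exI[of _ "topspace (Euclidean_space ?d)"]) simp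
qed

section \<open>The uniform measure on the Grassmannian\<close>

text \<open>A Householder reflection in the hyperplane orthogonal to \<open>y - x\<close>. In the
  complex setting equal norms are not enough for it to carry \<open>x\<close> to \<open>y\<close>;
  the product of the two vectors must be real.\<close>

lemma reflection_exists:
  fixes x y :: "complex^'n"
  assumes norm: "norm x = norm y" and real: "hinner x y = hinner y x"
  obtains Q :: "complex^'n^'n" where "hconj Q ** Q = mat 1" "Q *v x = y"
proof (cases "x = y")
  case True
  then show ?thesis using that[of "mat 1"] by simp
next
  case False
  define w where "w = y - x"
  have w: "w \<noteq> 0" using False by (simp add: w_def)
  define u where "u = of_real (1 / norm w) *s w"
  have "hinner u u = 1" using w
    by (simp add: u_def hinner_scale_left hinner_scale_right hinner_self[of w] power2_eq_square)
  then have "orthonormal {u}" by (simp add: orthonormal_def)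
  then have P: "is_proj (gram_proj {u}) (vec.span {u})" by (rule is_proj_gram_proj)
  let ?P = "gram_proj {u}"
  define Q where "Q = mat 1 - ?P - ?P"
  have PP: "?P ** ?P = ?P" and hP: "hconj ?P = ?P" using P by (simp_all add: is_proj_def)
  have diff: "(X - Y) ** Z = X ** Z - Y ** Z" "Z ** (X - Y) = Z ** X - Z ** Y" for X Y Z :: "complex^'n^'n"
    by (simp_all add: vec_eq_iff matrix_matrix_mult_def sum_subtractf algebra_simps)
  have "hconj Q ** Q = mat 1"
    by (simp only: Q_def hconj_diff hconj_mat_1 hP diff PP matrix_mul_lid matrix_mul_rid
        diff_self diff_0 diff_minus_eq_add diff_add_cancel)
  moreover have "Q *v x = y"
  proof -
    \<comment> \<open>Both assumptions meet here; the identity says that \<open>x\<close> projects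
      onto \<open>- w / 2\<close>, so the reflection adds exactly \<open>w\<close>.\<close>
    have ww: "hinner w w = - 2 * hinner w x"
    proof -
      have "hinner y y = hinner x x" by (simp add: hinner_self norm)
      then show ?thesis
        by (simp add: w_def hinner_diff_left hinner_diff_right real algebra_simps)
    qed
    have nw: "of_real (norm w) * of_real (norm w) = hinner w w"
      by (simp add: hinner_self power2_eq_square)
    have "?P *v x = (hinner w x / hinner w w) *s w"
      unfolding gram_proj_mult u_def
      by (simp add: hinner_scale_left vector_smult_assoc flip: nw)
    moreover have "hinner w x / hinner w w = - (1 / 2)"
      using ww w hinner_self_eq_0[of w] by (auto simp: field_simps)
    ultimately have Px: "?P *v x = - (1 / 2) *s w" by simp
    have "Q *v x = x + w"
      unfolding Q_def matrix_vector_mult_diff_rdistrib matrix_vector_mul_lid Px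
      by (simp add: vec_eq_iff field_simps)
    then show ?thesis by (simp add: w_def)
  qed
  ultimately show ?thesis by (rule that)
qed

section \<open>Unitary action on the Grassmannian and subspaces near a vector\<close>

lemma is_proj_rotate:
  fixes Q :: "complex^'n^'n"
  assumes Q: "hconj Q ** Q = mat 1" and P: "is_proj P V"
  shows "is_proj (Q ** P ** hconj Q) ((*v) Q ` V)"
  unfolding is_proj_def
proof (intro conjI)
  show "hconj (Q ** P ** hconj Q) = Q ** P ** hconj Q"
    using P by (simp add: is_proj_def hconj_mult matrix_mul_assoc)
  have "Q ** P ** hconj Q ** (Q ** P ** hconj Q) = Q ** P ** (hconj Q ** Q) ** P ** hconj Q"
    by (simp only: matrix_mul_assoc)
  also have "\<dots> = Q ** (P ** P) ** hconj Q" by (simp add: Q matrix_mul_assoc)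
  finally show "Q ** P ** hconj Q ** (Q ** P ** hconj Q) = Q ** P ** hconj Q"
    using P by (simp add: is_proj_def)
  show "range ((*v) (Q ** P ** hconj Q)) = (*v) Q ` V"
  proof safe
    fix x
    have "(Q ** P ** hconj Q) *v x = Q *v (P *v (hconj Q *v x))"
      by (simp add: matrix_vector_mul_assoc matrix_mul_assoc)
    then show "(Q ** P ** hconj Q) *v x \<in> (*v) Q ` V" using is_proj_in[OF P] by simp
  next
    fix x assume "x \<in> V"
    have "(Q ** P ** hconj Q) *v (Q *v x) = Q *v (P *v ((hconj Q ** Q) *v x))"
      by (simp add: matrix_vector_mul_assoc matrix_mul_assoc)
    also have "P *v ((hconj Q ** Q) *v x) = x"
      unfolding Q matrix_vector_mul_lid using is_proj_fix[OF P] \<open>x \<in> V\<close> by blast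
    finally show "Q *v x \<in> range ((*v) (Q ** P ** hconj Q))" by (metis rangeI)
  qed
qed

lemma rotate_grassmannian:
  fixes Q :: "complex^'n^'n"
  assumes Q: "hconj Q ** Q = mat 1" and V: "V \<in> grassmannian L"
  shows "(*v) Q ` V \<in> grassmannian L"
    and "orth_proj ((*v) Q ` V) = Q ** orth_proj V ** hconj Q"
proof -
  have sub: "vec.subspace ((*v) Q ` V)"
    using V by (intro vec.subspace_image) (auto simp: grassmannian_def)
  have "inj ((*v) Q)"
    using Q matrix_left_invertible_injective by blast
  then have "vec.dim ((*v) Q ` V) = vec.dim V"
    by (intro vec.dim_image_eq) (auto intro: inj_on_subset)
  then show "(*v) Q ` V \<in> grassmannian L" using sub V by (simp add: grassmannian_def)
  show "orth_proj ((*v) Q ` V) = Q ** orth_proj V ** hconj Q"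
    by (rule orth_proj_eqI[OF is_proj_rotate[OF Q is_proj_grassmannian[OF V]] sub])
qed

text \<open>The norm on the left is the distance from \<open>x\<close> to \<open>V\<close>.
  Measuring it relative to \<open>norm x\<close> makes the condition depend only on the complex line
  through \<open>x\<close>.\<close>

definition near :: "nat \<Rightarrow> complex^'n \<Rightarrow> real \<Rightarrow> (complex^'n) set set" where
  "near L x \<epsilon> = {V \<in> grassmannian L. norm (x - orth_proj V *v x) \<le> \<epsilon> * norm x}"

lemma norm_scale_vec: "norm (c *s v) = cmod c * norm (v :: complex^'n)"
  by (simp add: norm_vec_def norm_mult L2_set_right_distrib)

lemma near_scale:
  assumes "c \<noteq> 0" shows "near L (c *s x) \<epsilon> = near L x \<epsilon>"
proof -
  have *: "c *s x - c *s y = c *s (x - y)" for y :: "complex^'a"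
    by (simp add: vec_eq_iff algebra_simps)
  show ?thesis
    unfolding near_def matrix_vector_mult_scale * norm_scale_vec mult.left_commute[of \<epsilon>]
    using assms by (simp add: mult_le_cancel_left_pos)
qed

section \<open>Volume of a slab around a subspace\<close>

lemma translate_lborel:
  fixes A :: "'a::euclidean_space set"
  assumes "closed A"
  shows "emeasure lborel ((+) t ` A) = emeasure lborel A"
proof -
  have "(+) t ` A \<in> sets borel" by (intro borel_closed closed_translation assms)
  then have "emeasure (distr lborel borel ((+) t)) ((+) t ` A) = emeasure lborel ((+) t -` ((+) t ` A) \<inter> space lborel)"
    by (rule_tac emeasure_distr) simp_all
  moreover have "(+) t -` ((+) t ` A) = A" by (auto simp: image_iff)
  ultimately show ?thesis by (simp add: lborel_distr_plus)
qed

lemma orthogonal_complement_dim: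
  assumes V: "V \<in> grassmannian CARD('l::finite)"
  shows "dim {y :: complex^'n. \<forall>x\<in>V. orthogonal x y} = 2 * (CARD('n) - CARD('l))"
proof -
  obtain A :: "complex^'l^'n" where A: "hconj A ** A = mat 1" "col_space A = V"
    using ex_frame[OF V] .
  have lin: "linear ((*v) A)" by (rule matrix_vector_mul_linear)
  have "V = range ((*v) A)" using A(2) by (simp add: col_space_eq_range)
  then have sub: "subspace V" using linear_subspace_image[OF lin subspace_UNIV] by simp
  have "inj ((*v) A)" using A(1) matrix_left_invertible_injective by blast
  then have "dim V = dim (UNIV :: (complex^'l) set)"
    unfolding \<open>V = range ((*v) A)\<close> by (intro dim_image_eq[OF lin]) (auto intro: inj_on_subset)
  moreover have "dim {y \<in> UNIV. \<forall>x\<in>V. orthogonal x y} + dim V = dim (UNIV :: (complex^'n) set)"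
    using sub by (intro dim_subspace_orthogonal_to_vectors) auto
  ultimately show ?thesis by simp
qed

text \<open>A packing argument: \<open>m\<close> parallel copies of the slab in each of the real directions
  orthogonal to \<open>V\<close> fit into a fixed ball.\<close>

lemma slab_volume:
  fixes V :: "(complex^'n) set" and m :: nat
  assumes V: "V \<in> grassmannian CARD('l::finite)" and m: "m > 0"
  defines "d \<equiv> 2 * (CARD('n) - CARD('l))"
  shows "of_nat (m ^ d) * emeasure lborel {x \<in> cball 0 2. norm (x - orth_proj V *v x) \<le> 2 / m}
    \<le> emeasure lborel (cball (0 :: complex^'n) (2 + 5 * real d))"
proof -
  let ?P = "orth_proj V"
  have P: "is_proj ?P V" using V by (rule is_proj_grassmannian)
  define W where "W = {y :: complex^'n. \<forall>x\<in>V. orthogonal x y}"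
  have "subspace W" unfolding W_def by (rule subspace_orthogonal_to_vectors)
  then obtain C where C: "C \<subseteq> W" "pairwise orthogonal C" "\<And>x. x \<in> C \<Longrightarrow> norm x = 1"
    "independent C" "card C = dim W" "span C = W"
    by (rule orthonormal_basis_subspace) (rule that)
  have dW: "dim W = d" unfolding W_def d_def by (rule orthogonal_complement_dim[OF V])
  have finC: "finite C" using C(4) by (rule independent_imp_finite)
  define A where "A = {x \<in> cball 0 2. norm (x - ?P *v x) \<le> 2 / m}"
  have "closed A"
    unfolding A_def
    by (intro closed_Collect_conj closed_Collect_le continuous_intros) (simp only: Collect_mem_eq closed_cball)
  define K where "K = PiE C (\<lambda>_. {..<m})"
  \<comment> \<open>In every direction \<open>c\<close> the slab has width at most
    \<open>4 / m\<close>, so a spacing of \<open>5 / m\<close> keeps the copies disjoint. With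
    \<open>k c < m\<close> each direction shifts by at most 5, whence the radius
    \<open>2 + 5 * real d\<close>.\<close>
  define t where "t k = (\<Sum>c\<in>C. (5 * real (k c) / m) *\<^sub>R c)" for k :: "complex^'n \<Rightarrow> nat"
  have finK: "finite K" unfolding K_def using finC by (intro finite_PiE) auto
  have cardK: "card K = m ^ d" unfolding K_def using finC C(5) dW by (simp add: card_PiE)
  have small: "\<bar>x \<bullet> c\<bar> \<le> 2 / m" if "x \<in> A" "c \<in> C" for x c
  proof -
    have "orthogonal (?P *v x) c" using C(1) that(2) is_proj_in[OF P] by (auto simp: W_def)
    then have "x \<bullet> c = (x - ?P *v x) \<bullet> c" by (simp add: orthogonal_def inner_diff_left)
    then have "\<bar>x \<bullet> c\<bar> \<le> norm (x - ?P *v x) * norm c" using Cauchy_Schwarz_ineq2 by simp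
    also have "\<dots> \<le> 2 / m" using that C(3) by (simp add: A_def)
    finally show ?thesis .
  qed
  have tc: "t k \<bullet> c = 5 * real (k c) / m" if "c \<in> C" for k c
  proof -
    have "t k \<bullet> c = (\<Sum>b\<in>C. if b = c then 5 * real (k b) / m else 0)"
      unfolding t_def inner_sum_left
    proof (intro sum.cong refl)
      fix b assume "b \<in> C"
      show "(5 * real (k b) / m) *\<^sub>R b \<bullet> c = (if b = c then 5 * real (k b) / m else 0)"
      proof (cases "b = c")
        case True
        then show ?thesis using C(3)[OF that] by (simp add: norm_eq_1)
      next
        case False
        then have "b \<bullet> c = 0" using C(2) \<open>b \<in> C\<close> that by (auto simp: pairwise_def orthogonal_def)
        then show ?thesis using False by simp
      qed
    qed
    then show ?thesis using that finC by simp
  qed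
  have disj: "disjoint_family_on (\<lambda>k. (+) (t k) ` A) K"
    unfolding disjoint_family_on_def
  proof (intro ballI impI)
    fix k k' assume k: "k \<in> K" "k' \<in> K" "k \<noteq> k'"
    show "(+) (t k) ` A \<inter> (+) (t k') ` A = {}"
    proof (rule ccontr)
      assume "(+) (t k) ` A \<inter> (+) (t k') ` A \<noteq> {}"
      then obtain x x' where x: "x \<in> A" "x' \<in> A" "t k + x = t k' + x'" by auto
      have "k c = k' c" if c: "c \<in> C" for c
      proof -
        have "t k \<bullet> c + x \<bullet> c = t k' \<bullet> c + x' \<bullet> c" using arg_cong[OF x(3), of "\<lambda>v. v \<bullet> c"] by (simp add: inner_add_left)
        then have "5 * real (k c) / m - 5 * real (k' c) / m = x' \<bullet> c - x \<bullet> c"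
          using tc[OF c, of k] tc[OF c, of k'] by linarith
        then have "\<bar>5 * real (k c) / m - 5 * real (k' c) / m\<bar> \<le> 4 / m"
          using small[OF x(1) c] small[OF x(2) c] by linarith
        then have "\<bar>5 * (real (k c) - real (k' c))\<bar> / m \<le> 4 / m"
          using m by (simp add: diff_divide_distrib[symmetric] algebra_simps abs_divide)
        then have "\<bar>5 * (real (k c) - real (k' c))\<bar> \<le> 4" using m by (simp add: divide_le_cancel)
        then have "real_of_int \<bar>5 * (int (k c) - int (k' c))\<bar> \<le> 4" by simp
        then have "\<bar>5 * (int (k c) - int (k' c))\<bar> \<le> 4" by linarith
        then show ?thesis by presburger
      qed
      then have "k = k'" using k(1,2) unfolding K_def by (intro PiE_ext) auto
      with k(3) show False by contradiction
    qed
  qed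
  have sub: "(+) (t k) ` A \<subseteq> cball 0 (2 + 5 * real d)" if k: "k \<in> K" for k
  proof
    fix y assume "y \<in> (+) (t k) ` A"
    then obtain x where x: "x \<in> A" "y = t k + x" by auto
    have "norm (t k) \<le> (\<Sum>c\<in>C. 5)"
      unfolding t_def
    proof (rule sum_norm_le)
      fix c assume c: "c \<in> C"
      then have "k c < m" using k by (auto simp: K_def PiE_iff)
      then have "real (k c) / m \<le> 1" by simp
      then show "norm ((5 * real (k c) / m) *\<^sub>R c) \<le> 5" using C(3)[OF c] by simp
    qed
    then have "norm (t k) \<le> 5 * d" using C(5) dW by (simp add: mult.commute)
    moreover have "norm x \<le> 2" using x(1) by (simp add: A_def)
    ultimately show "y \<in> cball 0 (2 + 5 * real d)" using x(2) norm_triangle_ineq[of "t k" x] by simp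
  qed
  have "of_nat (m ^ d) * emeasure lborel A = (\<Sum>k\<in>K. emeasure lborel ((+) (t k) ` A))"
    by (simp add: translate_lborel[OF \<open>closed A\<close>] cardK)
  also have "\<dots> = emeasure lborel (\<Union>k\<in>K. (+) (t k) ` A)"
    using closed_translation[OF \<open>closed A\<close>] finK disj by (intro sum_emeasure) (auto simp: borel_closed)
  also have "\<dots> \<le> emeasure lborel (cball (0 :: complex^'n) (2 + 5 * real d))"
    using sub by (intro emeasure_mono) auto
  finally show ?thesis unfolding A_def .
qed

lemma closed_F_PS: "closed (F_PS :: (complex^'n^'l) set)"
proof -
  have eq: "(F_PS :: (complex^'n^'l) set) = (\<Inter>l n. {F. cmod (F $ l $ n) = 1 / sqrt (real CARD('n))})"
    by (auto simp: F_PS_def)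
  show ?thesis unfolding eq by (intro closed_INT ballI closed_Collect_eq continuous_intros)
qed

lemma norm_vec_le_sum: "norm (x :: 'a::real_normed_vector^'n) \<le> (\<Sum>i\<in>UNIV. norm (x $ i))"
  unfolding norm_vec_def by (rule L2_set_le_sum) simp

lemma bounded_F_PS: "bounded (F_PS :: (complex^'n^'l) set)"
proof (rule boundedI)
  fix F :: "complex^'n^'l" assume F: "F \<in> F_PS"
  have "norm F \<le> (\<Sum>l\<in>UNIV. norm (F $ l))" by (rule norm_vec_le_sum)
  also have "\<dots> \<le> (\<Sum>l::'l\<in>UNIV. \<Sum>n\<in>UNIV. norm (F $ l $ n))" by (intro sum_mono norm_vec_le_sum)
  also have "\<dots> = (\<Sum>l::'l\<in>UNIV. \<Sum>n::'n\<in>UNIV. 1 / sqrt (real CARD('n)))" using F by (simp add: F_PS_def)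
  finally show "norm F \<le> (\<Sum>l::'l\<in>UNIV. \<Sum>n::'n\<in>UNIV. 1 / sqrt (real CARD('n)))" .
qed

section \<open>Measurability and invariance for the uniform measure\<close>

context
  fixes \<mu> :: "(complex^'n) set measure" and L :: nat
  assumes \<mu>: "gr_uniform L \<mu>"
begin

private lemma space_\<mu>: "space \<mu> = grassmannian L"
  and sets_\<mu>: "sets \<mu> = sigma_sets (grassmannian L) {U. openin (gr_topology L) U}"
  and inv_\<mu>: "hconj Q ** Q = mat 1 \<Longrightarrow> distr \<mu> \<mu> (\<lambda>V. (*v) Q ` V) = \<mu>"
  using \<mu> by (simp_all add: gr_uniform_def)

lemma measurable_orth_proj: "orth_proj \<in> borel_measurable \<mu>"
proof (rule borel_measurableI)
  fix S :: "(complex^'n^'n) set" assume "open S"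
  then have "openin (gr_topology L) (orth_proj -` S \<inter> grassmannian L)"
    by (auto simp: gr_topology_def openin_pullback_topology)
  then show "orth_proj -` S \<inter> space \<mu> \<in> sets \<mu>"
    unfolding sets_\<mu> space_\<mu> by (intro sigma_sets.Basic) simp
qed

lemma measurable_rotate:
  fixes Q :: "complex^'n^'n"
  assumes Q: "hconj Q ** Q = mat 1"
  shows "(\<lambda>V. (*v) Q ` V) \<in> measurable \<mu> \<mu>"
proof (rule measurable_sigma_sets[OF sets_\<mu>])
  show "{U. openin (gr_topology L) U} \<subseteq> Pow (grassmannian L)"
    using openin_subset[of "gr_topology L"] by auto
  show "(\<lambda>V. (*v) Q ` V) \<in> space \<mu> \<rightarrow> grassmannian L"
    using rotate_grassmannian(1)[OF Q] by (simp add: space_\<mu>)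
  fix U :: "(complex^'n) set set" assume "U \<in> {U. openin (gr_topology L) U}"
  then obtain S where S: "open S" "U = orth_proj -` S \<inter> grassmannian L"
    by (auto simp: gr_topology_def openin_pullback_topology)
  have "open ((\<lambda>P. Q ** P ** hconj Q) -` S)"
    using S(1) by (intro open_vimage continuous_intros)
  then have "(\<lambda>P. Q ** P ** hconj Q) -` S \<in> sets borel" by simp
  then have "orth_proj -` ((\<lambda>P. Q ** P ** hconj Q) -` S) \<inter> space \<mu> \<in> sets \<mu>"
    by (rule measurable_sets[OF measurable_orth_proj])
  moreover have "(\<lambda>V. (*v) Q ` V) -` U \<inter> space \<mu> = orth_proj -` ((\<lambda>P. Q ** P ** hconj Q) -` S) \<inter> space \<mu>"
    using rotate_grassmannian[OF Q] by (auto simp: S(2) space_\<mu>)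
  ultimately show "(\<lambda>V. (*v) Q ` V) -` U \<inter> space \<mu> \<in> sets \<mu>" by simp
qed

lemma measurable_near: "near L x \<epsilon> \<in> sets \<mu>"
proof -
  have "closed {P :: complex^'n^'n. norm (x - P *v x) \<le> \<epsilon> * norm x}"
    by (intro closed_Collect_le continuous_intros)
  then have "{P :: complex^'n^'n. norm (x - P *v x) \<le> \<epsilon> * norm x} \<in> sets borel" by simp
  from measurable_sets[OF measurable_orth_proj this] show ?thesis
    by (simp add: near_def space_\<mu> vimage_def Int_def conj_commute)
qed

text \<open>After a rescaling and a phase, which \<open>near\<close> ignores, a reflection carries
  \<open>x\<close> to \<open>y\<close>, and the measure is invariant under it.\<close>

lemma emeasure_near_eq:
  assumes "x \<noteq> 0" "y \<noteq> 0"
  shows "emeasure \<mu> (near L x \<epsilon>) = emeasure \<mu> (near L y \<epsilon>)"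
proof -
  define h where "h = hinner x y"
  \<comment> \<open>A unit phase that turns the product with \<open>y\<close> into a nonnegative
    real, as \<open>reflection_exists\<close> requires; for orthogonal vectors any phase
    works.\<close>
  define c where "c = (if h = 0 then 1 else h / of_real (cmod h))"
  have c: "cmod c = 1" by (simp add: c_def norm_divide)
  then have "c \<noteq> 0" by auto
  define x' where "x' = (of_real (norm y / norm x) * c) *s x"
  have nx': "norm x' = norm y" using assms c by (simp add: x'_def norm_scale_vec norm_mult norm_divide)
  have hc: "cnj c * h = of_real (cmod h)"
    by (auto simp: c_def complex_norm_square[symmetric] mult.commute[of "cnj h"] power2_eq_square)
  have hx': "hinner x' y = of_real (norm y / norm x * cmod h)"
  proof -
    have "hinner x' y = of_real (norm y / norm x) * (cnj c * h)"
      by (simp add: x'_def hinner_scale_left h_def)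
    then show ?thesis unfolding hc by simp
  qed
  have "hinner y x' = cnj (hinner x' y)" by (simp add: cnj_hinner)
  then have "hinner x' y = hinner y x'" unfolding hx' by simp
  with nx' obtain Q where Q: "hconj Q ** Q = mat 1" "Q *v x' = y" by (rule reflection_exists)
  have nQ: "norm (y - (Q ** P ** hconj Q) *v y) = norm (x' - P *v x')" for P
  proof -
    have "hconj Q *v y = x'" unfolding Q(2)[symmetric] by (simp add: matrix_vector_mul_assoc Q(1))
    then have "y - (Q ** P ** hconj Q) *v y = Q *v (x' - P *v x')"
      by (simp add: Q(2) matrix_vector_mult_diff_distrib flip: matrix_vector_mul_assoc)
    then show ?thesis by (simp add: norm_mult_unitary[OF Q(1)])
  qed
  have "near L y \<epsilon> \<in> sets \<mu>" by (rule measurable_near)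
  then have "emeasure (distr \<mu> \<mu> (\<lambda>V. (*v) Q ` V)) (near L y \<epsilon>) =
      emeasure \<mu> ((\<lambda>V. (*v) Q ` V) -` near L y \<epsilon> \<inter> space \<mu>)"
    by (intro emeasure_distr measurable_rotate Q)
  moreover have "(\<lambda>V. (*v) Q ` V) -` near L y \<epsilon> \<inter> space \<mu> = near L x' \<epsilon>"
    using rotate_grassmannian[OF Q(1)] by (auto simp: near_def space_\<mu> nQ nx')
  ultimately have "emeasure \<mu> (near L y \<epsilon>) = emeasure \<mu> (near L x' \<epsilon>)"
    using inv_\<mu>[OF Q(1)] by simp
  also have "near L x' \<epsilon> = near L x \<epsilon>"
    unfolding x'_def using assms \<open>c \<noteq> 0\<close> by (intro near_scale) simp
  finally show ?thesis ..
qed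

end

text \<open>By invariance the measure of \<open>near L x \<epsilon>\<close> does not depend on \<open>x\<close>; averaging it over a shell
  and exchanging the integrals bounds it by the volume of a slab.\<close>

lemma emeasure_near_le:
  fixes \<mu> :: "(complex^'n) set measure" and x :: "complex^'n"
  assumes \<mu>: "gr_uniform CARD('l::finite) \<mu>" and x: "x \<noteq> 0" and m: "m > 0"
  defines "d \<equiv> 2 * (CARD('n) - CARD('l))"
  shows "of_nat (m ^ d) * (emeasure \<mu> (near CARD('l) x (1 / m)) * emeasure lborel (cball (0::complex^'n) 2 - ball 0 1))
    \<le> emeasure lborel (cball (0 :: complex^'n) (2 + 5 * real d))"
proof -
  let ?L = "CARD('l)"
  let ?B = "cball (0::complex^'n) 2 - ball 0 1"
  let ?K = "emeasure lborel (cball (0 :: complex^'n) (2 + 5 * real d))"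
  interpret prob_space \<mu> using \<mu> by (simp add: gr_uniform_def)
  interpret pair_sigma_finite \<mu> "lborel :: (complex^'n) measure" ..
  have B: "?B \<in> sets borel" by auto
  \<comment> \<open>Integrated over \<open>V\<close> this gives the constant measure of
    \<open>near\<close> at each point of the shell, integrated over \<open>y\<close> at most a slab
    volume. The shell avoids 0, where \<open>near\<close> is the whole Grassmannian.\<close>
  define f where "f V y = (indicator ?B y * indicator (near ?L y (1 / m)) V :: ennreal)" for V y
  have op: "orth_proj \<in> borel_measurable \<mu>" using \<mu> by (rule measurable_orth_proj)
  have space_\<mu>: "space \<mu> = grassmannian ?L" using \<mu> by (simp add: gr_uniform_def)
  have f_meas: "case_prod f \<in> borel_measurable (\<mu> \<Otimes>\<^sub>M lborel)"
  proof -
    have m1: "(\<lambda>z. orth_proj (fst z)) \<in> borel_measurable (\<mu> \<Otimes>\<^sub>M (lborel :: (complex^'n) measure))"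
      using measurable_compose[OF measurable_fst op] .
    have m2: "(\<lambda>z. (orth_proj (fst z), snd z)) \<in> borel_measurable (\<mu> \<Otimes>\<^sub>M (lborel :: (complex^'n) measure))"
      using m1 by (intro borel_measurable_Pair) auto
    define S where "S = {z :: (complex^'n^'n) \<times> (complex^'n). norm (snd z - fst z *v snd z) \<le> 1 / m * norm (snd z)} \<inter> (UNIV \<times> ?B)"
    have "closed {z :: (complex^'n^'n) \<times> (complex^'n). norm (snd z - fst z *v snd z) \<le> 1 / m * norm (snd z)}"
      by (intro closed_Collect_le continuous_intros)
    moreover have "closed (UNIV \<times> ?B :: ((complex^'n^'n) \<times> (complex^'n)) set)"
      by (intro closed_Times closed_Diff) auto
    ultimately have "S \<in> sets borel" unfolding S_def by (intro borel_closed closed_Int)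
    then have "(\<lambda>z. indicator S (orth_proj (fst z), snd z) :: ennreal) \<in> borel_measurable (\<mu> \<Otimes>\<^sub>M lborel)"
      using measurable_compose[OF m2 borel_measurable_indicator] by blast
    moreover have "case_prod f z = indicator S (orth_proj (fst z), snd z)" if "z \<in> space (\<mu> \<Otimes>\<^sub>M lborel)" for z
      using that by (auto simp: f_def S_def near_def space_pair_measure space_\<mu> indicator_def split: prod.split)
    ultimately show ?thesis by (subst measurable_cong) auto
  qed
  have "emeasure \<mu> (near ?L x (1 / m)) * emeasure lborel ?B
      = (\<integral>\<^sup>+y. emeasure \<mu> (near ?L x (1 / m)) * indicator ?B y \<partial>lborel)"
    using B by (simp add: nn_integral_cmult_indicator)
  also have "\<dots> = (\<integral>\<^sup>+y. (\<integral>\<^sup>+V. f V y \<partial>\<mu>) \<partial>lborel)"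
  proof (intro nn_integral_cong)
    fix y :: "complex^'n"
    show "emeasure \<mu> (near ?L x (1 / m)) * indicator ?B y = (\<integral>\<^sup>+V. f V y \<partial>\<mu>)"
    proof (cases "y \<in> ?B")
      case True
      then have "y \<noteq> 0" by auto
      then show ?thesis using True measurable_near[OF \<mu>] emeasure_near_eq[OF \<mu> x] by (simp add: f_def)
    qed (simp add: f_def)
  qed
  also have "\<dots> = (\<integral>\<^sup>+V. (\<integral>\<^sup>+y. f V y \<partial>lborel) \<partial>\<mu>)"
    using Fubini'[OF f_meas] .
  finally have eq: "emeasure \<mu> (near ?L x (1 / m)) * emeasure lborel ?B = (\<integral>\<^sup>+V. (\<integral>\<^sup>+y. f V y \<partial>lborel) \<partial>\<mu>)" .
  have inner: "of_nat (m ^ d) * (\<integral>\<^sup>+y. f V y \<partial>lborel) \<le> ?K" if V: "V \<in> space \<mu>" for V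
  proof -
    let ?S = "{y \<in> cball 0 2. norm (y - orth_proj V *v y) \<le> 2 / m}"
    have "f V y \<le> indicator ?S y" for y
    proof (cases "y \<in> ?B \<and> V \<in> near ?L y (1 / m)")
      case True
      then have "norm (y - orth_proj V *v y) \<le> 1 / m * norm y" by (simp add: near_def)
      \<comment> \<open>The outer radius 2 of the shell turns the relative bound into the absolute
        slab width \<open>2 / m\<close>.\<close>
      also have "\<dots> \<le> 1 / m * 2" using True by (intro mult_left_mono) auto
      finally show ?thesis using True by (simp add: f_def)
    qed (auto simp: f_def)
    then have "(\<integral>\<^sup>+y. f V y \<partial>lborel) \<le> (\<integral>\<^sup>+y. indicator ?S y \<partial>lborel)"
      by (intro nn_integral_mono)
    also have "\<dots> = emeasure lborel ?S"
    proof -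
      have "closed ?S" 
        by (intro closed_Collect_conj closed_Collect_le continuous_intros)
          (simp only: Collect_mem_eq closed_cball)
      then show ?thesis by (intro nn_integral_indicator) auto
    qed
    finally have "of_nat (m ^ d) * (\<integral>\<^sup>+y. f V y \<partial>lborel) \<le> of_nat (m ^ d) * emeasure lborel ?S"
      by (intro mult_left_mono) auto
    also have "\<dots> \<le> ?K"
      unfolding d_def by (rule slab_volume[OF _ m]) (use V space_\<mu> in simp)
    finally show ?thesis .
  qed
  have "of_nat (m ^ d) * (\<integral>\<^sup>+V. (\<integral>\<^sup>+y. f V y \<partial>lborel) \<partial>\<mu>)
      = (\<integral>\<^sup>+V. of_nat (m ^ d) * (\<integral>\<^sup>+y. f V y \<partial>lborel) \<partial>\<mu>)"
    using f_meas by (intro nn_integral_cmult[symmetric]) (auto intro: lborel.borel_measurable_nn_integral)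
  also have "\<dots> \<le> (\<integral>\<^sup>+V. ?K \<partial>\<mu>)" using inner by (rule nn_integral_mono)
  also have "\<dots> = ?K" by (simp add: emeasure_space_1)
  finally show ?thesis unfolding eq .
qed

text \<open>The full-rank phase-shifter matrices are a countable union of compact sets, cut out by
  lower bounds on the Gram determinant. On each of them the projection depends continuously on the
  matrix, so the projections form a Borel set whose preimage under \<open>orth_proj\<close> is the
  reachable set.\<close>

lemma R_PS_measurable:
  fixes \<mu> :: "(complex^'n) set measure"
  assumes \<mu>: "gr_uniform CARD('l::finite) \<mu>"
  shows "(R_PS TYPE('l) :: (complex^'n) set set) \<in> sets \<mu>"
proof -
  define K where "K j = F_PS \<inter> {F :: complex^'n^'l. 1 / real (Suc j) \<le> cmod (det (F ** hconj F))}" for j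
  define p where "p F = hconj F ** matrix_inv (F ** hconj F) ** F" for F :: "complex^'n^'l"
  have rank: "rank F = CARD('l) \<longleftrightarrow> det (F ** hconj F) \<noteq> 0" for F :: "complex^'n^'l"
    unfolding full_row_rank_iff full_column_rank_iff[symmetric] full_column_rank_det by simp
  have K_iff: "(\<exists>j. F \<in> K j) \<longleftrightarrow> F \<in> F_PS \<and> rank F = CARD('l)" for F :: "complex^'n^'l"
  proof -
    have "(\<exists>j. 1 / real (Suc j) \<le> r) \<longleftrightarrow> 0 < r" for r :: real
    proof
      assume "0 < r"
      then obtain j where "inverse (real (Suc j)) < r" using reals_Archimedean by blast
      then show "\<exists>j. 1 / real (Suc j) \<le> r" by (intro exI[of _ j]) (simp add: inverse_eq_divide)
    next
      assume "\<exists>j. 1 / real (Suc j) \<le> r"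
      then obtain j where "1 / real (Suc j) \<le> r" by blast
      moreover have "0 < 1 / real (Suc j)" by simp
      ultimately show "0 < r" by linarith
    qed
    then show ?thesis by (simp add: K_def rank)
  qed
  have "compact (p ` K j)" for j
  proof (rule compact_continuous_image)
    have "closed {F :: complex^'n^'l. 1 / real (Suc j) \<le> cmod (det (F ** hconj F))}"
      by (intro closed_Collect_le continuous_intros)
    then show "compact (K j)"
      unfolding K_def compact_eq_bounded_closed
      using closed_F_PS bounded_F_PS by (auto intro: bounded_subset)
    have "invertible (F ** hconj F)" if "F \<in> K j" for F :: "complex^'n^'l"
      using that K_iff rank invertible_det_nz by blast
    then show "continuous_on (K j) p"
      unfolding p_def by (intro continuous_intros)
  qed
  then have "(\<Union>j. p ` K j) \<in> sets borel" by (intro sets.countable_UN) (auto simp: compact_imp_closed)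
  moreover have op: "orth_proj (row_space F) = p F" if "rank F = CARD('l)" for F :: "complex^'n^'l"
    unfolding p_def by (intro orth_proj_eqI is_proj_row_space that) (simp add: row_space_def subspace_col_space)
  have "R_PS TYPE('l) = orth_proj -` (\<Union>j. p ` K j) \<inter> space \<mu>"
  proof (intro set_eqI iffI)
    fix V :: "(complex^'n) set" assume "V \<in> R_PS TYPE('l)"
    then obtain F :: "complex^'n^'l" where F: "V = row_space F" "F \<in> F_PS" "rank F = CARD('l)"
      by (auto simp: R_PS_def)
    then obtain j where "F \<in> K j" using K_iff by blast
    then show "V \<in> orth_proj -` (\<Union>j. p ` K j) \<inter> space \<mu>"
      using F \<mu> op row_space_grassmannian by (auto simp: gr_uniform_def)
  next
    fix V assume V: "V \<in> orth_proj -` (\<Union>j. p ` K j) \<inter> space \<mu>"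
    then obtain j F where F: "F \<in> K j" "orth_proj V = p F" by auto
    then have F': "F \<in> F_PS" "rank F = CARD('l)" using K_iff by blast+
    have "V = row_space F"
    proof (rule orth_proj_inj)
      show "V \<in> grassmannian CARD('l)" using V \<mu> by (simp add: gr_uniform_def)
      show "row_space F \<in> grassmannian CARD('l)" using F'(2) by (rule row_space_grassmannian)
      show "orth_proj V = orth_proj (row_space F)" using F(2) op[OF F'(2)] by simp
    qed
    then show "V \<in> R_PS TYPE('l)" using F' by (auto simp: R_PS_def)
  qed
  ultimately show ?thesis
    using measurable_sets[OF measurable_orth_proj[OF \<mu>], of "\<Union>j. p ` K j"] by simp
qed

section \<open>Covering the reachable set by a grid\<close>

lemma cis_dist_le: "cmod (cis a - cis b) \<le> \<bar>a - b\<bar>"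
proof -
  have "cis a - cis b = cis b * (exp (\<i> * of_real (a - b)) - 1)"
    by (simp add: cis_conv_exp algebra_simps flip: exp_add)
  then have "cmod (cis a - cis b) = cmod (exp (\<i> * of_real (a - b)) - 1)" by (simp add: norm_mult)
  also have "\<dots> = 2 * \<bar>sin ((a - b) / 2)\<bar>"
    using dist_exp_i_1[of "a - b"] by simp
  also have "\<dots> \<le> \<bar>a - b\<bar>" using abs_sin_x_le_abs_x[of "(a - b) / 2"] by simp
  finally show ?thesis .
qed

text \<open>A phase-shifter row, normalised to have first entry 1, lies on a torus of dimension
  \<open>CARD('n) - 1\<close>; the points of a grid on this torus come close to every subspace in the set.\<close>

lemma R_PS_cover:
  fixes m :: nat and n0 :: "'n::finite"
  assumes m: "m > 0"
  defines "r \<equiv> 7 * CARD('n) * m"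
  defines "G \<equiv> {g. (\<forall>n. g n < r) \<and> g n0 = 0}"
  shows "(R_PS TYPE('l::finite) :: (complex^'n) set set)
      \<subseteq> (\<Union>g\<in>G. near CARD('l) (\<chi> n. cis (2 * pi * real (g n) / r)) (1 / m))"
proof
  fix V :: "(complex^'n) set" assume "V \<in> R_PS TYPE('l)"
  then obtain F :: "complex^'n^'l" where F: "V = row_space F" "F \<in> F_PS" "rank F = CARD('l)"
    by (auto simp: R_PS_def)
  have V: "V \<in> grassmannian CARD('l)" unfolding F(1) using F(3) by (rule row_space_grassmannian)
  have subV: "vec.subspace V" using V by (simp add: grassmannian_def)
  obtain l :: 'l where True by simp
  define N where "N = complex_of_real (sqrt (real CARD('n)))"
  have N: "N \<noteq> 0" "cmod N = sqrt (real CARD('n))" by (simp_all add: N_def)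
  have cF: "cmod (F $ l $ n) = 1 / sqrt (real CARD('n))" for n
    using F(2) by (simp add: F_PS_def)
  have F0: "F $ l $ n0 \<noteq> 0"
  proof
    assume "F $ l $ n0 = 0"
    then show False using cF[of n0] by simp
  qed
  \<comment> \<open>A conjugated row lies in the row space; dividing by its entry at
    \<open>n0\<close> removes the common phase and the common modulus.\<close>
  define u where "u = (1 / cnj (F $ l $ n0)) *s (\<chi> n. cnj (F $ l $ n))"
  have "hconj F *v axis l 1 = (\<chi> n. cnj (F $ l $ n))"
    by (simp add: vec_eq_iff matrix_vector_mult_def axis_def if_distrib cong: if_cong)
  then have "(\<chi> n. cnj (F $ l $ n)) \<in> V"
    unfolding F(1) row_space_def col_space_eq_range using rangeI[of "(*v) (hconj F)" "axis l 1"] by simp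
  then have uV: "u \<in> V" unfolding u_def by (rule vec.subspace_scale[OF subV])
  have u1: "cmod (u $ n) = 1" for n
    using cF[of n] cF[of n0] by (simp add: u_def norm_divide norm_mult)
  have u0: "u $ n0 = 1" using F0 by (simp add: u_def)
  have r: "r > 0" using m by (simp add: r_def)
  define \<phi> where "\<phi> n = (if n = n0 then 0 else Arg2pi (u $ n))" for n
  have \<phi>: "0 \<le> \<phi> n" "\<phi> n < 2 * pi" for n
    by (simp_all add: \<phi>_def Arg2pi_ge_0 Arg2pi_lt_2pi)
  have u\<phi>: "u $ n = cis (\<phi> n)" for n
  proof (cases "n = n0")
    case False
    then show ?thesis using Arg2pi_eq[of "u $ n"] by (simp add: \<phi>_def cis_conv_exp u1)
  qed (simp add: u0 \<phi>_def)
  \<comment> \<open>Round each phase down to the grid of step \<open>2 * pi / r\<close>; since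
    \<open>\<phi> n0 = 0\<close>, the result is 0 at \<open>n0\<close>.\<close>
  define g where "g n = nat \<lfloor>\<phi> n * r / (2 * pi)\<rfloor>" for n
  have g_le: "real (g n) \<le> \<phi> n * r / (2 * pi)" "\<phi> n * r / (2 * pi) < real (g n) + 1" for n
  proof -
    have "0 \<le> \<phi> n * r / (2 * pi)" using \<phi>(1)[of n] by simp
    then show "real (g n) \<le> \<phi> n * r / (2 * pi)" "\<phi> n * r / (2 * pi) < real (g n) + 1"
      unfolding g_def by linarith+
  qed
  have g_r: "g n < r" for n
  proof -
    have "\<phi> n * r / (2 * pi) < r" using \<phi>(2)[of n] r by (simp add: field_simps)
    then show ?thesis using g_le(1)[of n] by linarith
  qed
  have "g \<in> G" using g_r by (simp add: G_def g_def \<phi>_def)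
  moreover have "V \<in> near CARD('l) (\<chi> n. cis (2 * pi * real (g n) / r)) (1 / m)"
  proof -
    let ?w = "\<chi> n. cis (2 * pi * real (g n) / r) :: complex^'n"
    let ?P = "orth_proj V"
    have P: "is_proj ?P V" using V by (rule is_proj_grassmannian)
    have close: "cmod (?w $ n - u $ n) \<le> 1 / (real CARD('n) * real m)" for n
    proof -
      have "cmod (?w $ n - u $ n) \<le> \<bar>2 * pi * real (g n) / r - \<phi> n\<bar>"
        unfolding u\<phi> vec_lambda_beta by (rule cis_dist_le)
      also have "\<dots> = \<bar>real (g n) - \<phi> n * r / (2 * pi)\<bar> * (2 * pi / r)"
      proof -
        have "2 * pi * real (g n) / r - \<phi> n = (real (g n) - \<phi> n * r / (2 * pi)) * (2 * pi / r)"
          using r by (simp add: field_simps)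
        then show ?thesis using r by (simp only: abs_mult) simp
      qed
      also have "\<dots> \<le> 1 * (2 * pi / r)"
        using g_le[of n] r by (intro mult_right_mono) auto
      \<comment> \<open>The constant 7 in \<open>r\<close> is there because
        \<open>2 * pi < 7\<close>.\<close>
      also have "\<dots> \<le> 1 / (real CARD('n) * real m)"
        using m pi_less_4 pi_approx by (simp add: r_def field_simps)
      finally show ?thesis .
    qed
    \<comment> \<open>\<open>near\<close> measures relative to the norm of its centre, so an
      absolute bound is enough once this norm is at least 1.\<close>
    have nw: "1 \<le> norm ?w"
      using Finite_Cartesian_Product.norm_nth_le[of ?w n0] by simp
    \<comment> \<open>Since \<open>u\<close> lies in \<open>V\<close>, subtracting it does not
      change the component off \<open>V\<close>.\<close>
    have e: "?w - ?P *v ?w = (?w - u) - ?P *v (?w - u)"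
      using is_proj_fix[OF P] uV by (simp add: matrix_vector_mult_diff_distrib)
    have "(norm (?w - ?P *v ?w))\<^sup>2 \<le> (norm (?w - u))\<^sup>2"
      unfolding e using is_proj_norm[OF P, of "?w - u"] zero_le_power2[of "norm (?P *v (?w - u))"]
      by linarith
    then have "norm (?w - ?P *v ?w) \<le> norm (?w - u)" by (rule power2_le_imp_le) simp
    also have "\<dots> \<le> (\<Sum>n\<in>UNIV. cmod ((?w - u) $ n))" by (rule norm_vec_le_sum)
    also have "\<dots> \<le> (\<Sum>n::'n\<in>UNIV. 1 / (real CARD('n) * real m))"
      using close by (intro sum_mono) simp
    also have "\<dots> = 1 / real m" by simp
    also have "\<dots> \<le> 1 / real m * norm ?w" using mult_left_mono[OF nw, of "1 / real m"] by simp
    finally show ?thesis using V by (simp add: near_def)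
  qed
  ultimately show "V \<in> (\<Union>g\<in>G. near CARD('l) (\<chi> n. cis (2 * pi * real (g n) / r)) (1 / m))" by blast
qed

text \<open>\<open>PiE\<close> counts functions that are \<open>undefined\<close> at
  \<open>n0\<close>, whereas the grid has the value 0 there; the bijection exchanges these
  defaults.\<close>

lemma card_grid:
  fixes n0 :: "'n::finite"
  assumes "r > 0"
  shows "finite {g. (\<forall>n. g n < r) \<and> g n0 = (0::nat)}" (is "finite ?G")
    and "card {g. (\<forall>n. g n < r) \<and> g n0 = (0::nat)} = r ^ (CARD('n) - 1)"
proof -
  let ?h = "\<lambda>g. \<lambda>n. if n = n0 then 0 else g n"
  have bij: "bij_betw ?h (PiE (UNIV - {n0}) (\<lambda>_. {..<r})) ?G"
  proof (rule bij_betwI[where g = "\<lambda>g. restrict g (UNIV - {n0})"])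
    show "?h \<in> PiE (UNIV - {n0}) (\<lambda>_. {..<r}) \<rightarrow> ?G" using assms by (auto simp: PiE_iff)
    show "(\<lambda>g. restrict g (UNIV - {n0})) \<in> ?G \<rightarrow> PiE (UNIV - {n0}) (\<lambda>_. {..<r})" by auto
    show "restrict (?h g) (UNIV - {n0}) = g" if "g \<in> PiE (UNIV - {n0}) (\<lambda>_. {..<r})" for g
      using that by (auto simp: fun_eq_iff PiE_iff extensional_def restrict_def)
    show "?h (restrict g (UNIV - {n0})) = g" if "g \<in> ?G" for g
      using that by (auto simp: fun_eq_iff)
  qed
  have eq: "finite ?G = finite (PiE (UNIV - {n0}) (\<lambda>_. {..<r}))"
    "card ?G = card (PiE (UNIV - {n0}) (\<lambda>_. {..<r}))"
    using bij_betw_finite[OF bij] bij_betw_same_card[OF bij] by simp_all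
  show "finite ?G" unfolding eq(1) by (intro finite_PiE) auto
  show "card ?G = r ^ (CARD('n) - 1)" unfolding eq(2) by (simp add: card_PiE card_Diff_subset)
qed

text \<open>The grid has \<open>(7 * CARD('n) * m) ^ (CARD('n) - 1)\<close> points, each
  contributing at most a constant multiple of \<open>1 / m ^ d\<close> with
  \<open>d \<ge> CARD('n)\<close>. The total is of order \<open>1 / m\<close> for every positive
  \<open>m\<close>.\<close>

lemma R_PS_null:
  fixes \<mu> :: "(complex^'n) set measure"
  assumes \<mu>: "gr_uniform CARD('l::finite) \<mu>" and N: "CARD('n) \<ge> 2 * CARD('l)"
  shows "(R_PS TYPE('l) :: (complex^'n) set set) \<in> null_sets \<mu>"
proof -
  interpret prob_space \<mu> using \<mu> by (simp add: gr_uniform_def)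
  obtain n0 :: 'n where True by simp
  define d where "d = 2 * (CARD('n) - CARD('l))"
  have d: "CARD('n) \<le> d" using N by (simp add: d_def)
  let ?B = "cball (0::complex^'n) 2 - ball 0 1"
  define b where "b = measure lborel ?B"
  define k where "k = measure lborel (cball (0 :: complex^'n) (2 + 5 * real d))"
  have finB: "emeasure lborel ?B = ennreal b"
    unfolding b_def using emeasure_bounded_finite[of ?B]
    by (intro emeasure_eq_ennreal_measure) (auto simp: bounded_diff)
  have finK: "emeasure lborel (cball (0 :: complex^'n) (2 + 5 * real d)) = ennreal k"
    unfolding k_def using emeasure_bounded_finite[of "cball (0 :: complex^'n) (2 + 5 * real d)"]
    by (intro emeasure_eq_ennreal_measure) auto
  \<comment> \<open>The estimate is divided by the shell volume; a ball of radius
    \<open>1 / 2\<close> centred in the middle of the shell shows that it is positive.\<close>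
  have b: "b > 0"
  proof -
    obtain v :: "complex^'n" where v: "norm v = 3 / 2" using vector_choose_size[of "3/2"] by auto
    have "ball v (1 / 2) \<subseteq> ?B"
    proof
      fix y assume "y \<in> ball v (1 / 2)"
      then have "norm (v - y) < 1 / 2" by (simp add: dist_norm)
      then show "y \<in> ?B" using v norm_triangle_ineq2[of v y] norm_triangle_ineq2[of y v]
        by (simp add: norm_minus_commute)
    qed
    then have "emeasure lborel (ball v (1 / 2)) \<le> emeasure lborel ?B" by (intro emeasure_mono) auto
    moreover have "emeasure lborel (ball v (1 / 2)) \<noteq> 0"
      using open_not_negligible[of "ball v (1/2)"] by (auto simp: negligible_iff_null_sets null_sets_def)
    ultimately have "emeasure lborel ?B \<noteq> 0" by auto
    then show ?thesis unfolding finB by (simp add: b_def zero_less_measure_iff)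
  qed
  have near_le: "measure \<mu> (near CARD('l) x (1 / m)) \<le> k / b / real m ^ d" if "x \<noteq> 0" "m > 0" for x and m :: nat
  proof -
    have "of_nat (m ^ d) * (ennreal (measure \<mu> (near CARD('l) x (1 / m))) * ennreal b) \<le> ennreal k"
      using emeasure_near_le[OF \<mu> that] unfolding d_def[symmetric] finB finK emeasure_eq_measure .
    then have "ennreal (real (m ^ d) * (measure \<mu> (near CARD('l) x (1 / m)) * b)) \<le> ennreal k"
      by (simp add: ennreal_mult b_def ennreal_of_nat_eq_real_of_nat)
    then have "real (m ^ d) * (measure \<mu> (near CARD('l) x (1 / m)) * b) \<le> k"
      by (simp add: k_def)
    then show ?thesis using b that(2) by (simp add: field_simps)
  qed
  have R: "(R_PS TYPE('l) :: (complex^'n) set set) \<in> sets \<mu>" using \<mu> by (rule R_PS_measurable)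
  define c where "c = (7 * CARD('n)) ^ (CARD('n) - 1) * (k / b)"
  have bound: "measure \<mu> (R_PS TYPE('l)) \<le> c / real m" if m: "m > 0" for m :: nat
  proof -
    let ?r = "7 * CARD('n) * m"
    let ?G = "{g. (\<forall>n. g n < ?r) \<and> g n0 = (0::nat)}"
    let ?w = "\<lambda>g. \<chi> n. cis (2 * pi * real (g n) / ?r) :: complex^'n"
    have r: "?r > 0" using m by simp
    have w: "?w g \<noteq> 0" for g :: "'n \<Rightarrow> nat" by (simp add: vec_eq_iff)
    have "measure \<mu> (R_PS TYPE('l)) \<le> measure \<mu> (\<Union>g\<in>?G. near CARD('l) (?w g) (1 / m))"
      using measurable_near[OF \<mu>] card_grid(1)[OF r]
      by (intro finite_measure_mono R_PS_cover[OF m, of n0]) auto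
    also have "\<dots> \<le> (\<Sum>g\<in>?G. measure \<mu> (near CARD('l) (?w g) (1 / m)))"
      using measurable_near[OF \<mu>] card_grid(1)[OF r] by (intro finite_measure_subadditive_finite) auto
    also have "\<dots> \<le> (\<Sum>g\<in>?G. k / b / real m ^ d)"
      using near_le[OF w m] by (intro sum_mono)
    also have "\<dots> = real ?r ^ (CARD('n) - 1) * (k / b / real m ^ d)"
      by (simp add: card_grid(2)[OF r])
    also have "\<dots> = c * (real m ^ (CARD('n) - 1) / real m ^ d)"
      by (simp add: c_def power_mult_distrib)
    also have "\<dots> \<le> c * (1 / real m)"
    proof (rule mult_left_mono)
      have "real m ^ (CARD('n) - 1) * m = real m ^ CARD('n)"
        using power_minus_mult[of "CARD('n)" "real m"] by simp
      also have "\<dots> \<le> real m ^ d" using d m by (intro power_increasing) auto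
      finally show "real m ^ (CARD('n) - 1) / real m ^ d \<le> 1 / m"
        using m by (simp add: field_simps)
      show "0 \<le> c" using b by (simp add: c_def k_def)
    qed
    finally show ?thesis by simp
  qed
  have "measure \<mu> (R_PS TYPE('l)) \<le> 0"
  proof (rule field_le_epsilon)
    fix e :: real assume e: "e > 0"
    obtain j where "c / e < real j" using reals_Archimedean2 by blast
    then have "c < e * real (Suc j)" using e by (simp add: field_simps)
    then have "c / real (Suc j) \<le> e" by (simp add: field_simps)
    then show "measure \<mu> (R_PS TYPE('l)) \<le> 0 + e" using bound[of "Suc j"] by simp
  qed
  then have "measure \<mu> (R_PS TYPE('l)) = 0" by (simp add: measure_le_0_iff)
  then show ?thesis using R by (simp add: null_sets_def emeasure_eq_measure)
qed

section \<open>Assembly of the three claims\<close>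

theorem proposition3:
  fixes pos :: "'n::finite \<Rightarrow> nat"
    and \<beta> :: "complex^'k::finite"
    and s :: "complex^'t::finite"
    and var :: real
  assumes pos: "bij_betw pos UNIV {..<CARD('n)}"
    and \<beta>: "\<And>k. \<beta> $ k \<noteq> 0"
    and s: "s \<noteq> 0"
    and var: "var > 0"
    and L: "CARD('l::finite) \<ge> 2 * CARD('k)"
    and N: "CARD('n) \<ge> 2 * CARD('l)"
  shows
    \<comment> \<open>(i) Loewner ordering\<close>
    "(\<forall>(\<theta> :: real^'k) (F :: complex^'n^'l).
        admissible pos \<theta> \<longrightarrow> F \<in> F_PS \<longrightarrow> rank F = CARD('l) \<longrightarrow>
        (let J_dig = fim_dig pos s var (param_vec \<theta> \<beta>);
             J_PS = fim pos s var (param_vec \<theta> \<beta>) F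
         in crb_defined J_dig \<and>
            pos_semidef (J_dig - J_PS) \<and>
            (crb_defined J_PS \<longrightarrow> pos_semidef (crb J_PS - crb J_dig)) \<and>
            (J_PS = J_dig \<longleftrightarrow> target_space pos \<theta> \<subseteq> row_space F) \<and>
            (J_PS = J_dig \<and> crb_defined J_PS \<and> crb J_PS = crb J_dig \<longleftrightarrow>
               target_space pos \<theta> \<subseteq> row_space F)))
    \<and>
    \<comment> \<open>(ii) reach deficit\<close>
    (R_PS TYPE('l) \<subseteq> (grassmannian CARD('l) :: (complex^'n) set set) \<and>
     (CARD('q::finite) = CARD('l) * (CARD('n) - 1) \<longrightarrow>
        real_dof_at_most TYPE(real^'q) TYPE('l) (R_PS TYPE('l) :: (complex^'n) set set)) \<and>
     manifold_dim (gr_topology CARD('l) :: (complex^'n) set topology)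
       (2 * CARD('l) * (CARD('n) - CARD('l))) \<and>
     int (2 * CARD('l) * (CARD('n) - CARD('l))) - int (CARD('l) * (CARD('n) - 1))
       = reach_deficit CARD('l) CARD('n) \<and>
     reach_deficit CARD('l) CARD('n) > 0 \<and>
     (\<forall>\<mu> :: (complex^'n) set measure. gr_uniform CARD('l) \<mu> \<longrightarrow>
        (AE V in \<mu>. V \<notin> R_PS TYPE('l)) \<and> R_PS TYPE('l) \<in> null_sets \<mu>))
    \<and>
    \<comment> \<open>(iii) generic strict gap\<close>
    (\<forall>F :: complex^'n^'l. F \<in> F_PS \<longrightarrow> rank F = CARD('l) \<longrightarrow>
        row_space F \<noteq> UNIV \<and>
        (\<forall>x :: real. steer pos x \<in> row_space F \<longrightarrow>
           x isolated_in {y. steer pos y \<in> row_space F}) \<and>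
        {\<theta> :: real^'k. target_space pos \<theta> \<subseteq> row_space F} \<in> null_sets lebesgue \<and>
        (AE \<theta> in lebesgue.
           crb_defined (fim_dig pos s var (param_vec \<theta> \<beta>)) \<and>
           crb_defined (fim pos s var (param_vec \<theta> \<beta>) F) \<and>
           pos_def (crb (fim pos s var (param_vec \<theta> \<beta>) F)
                    - crb (fim_dig pos s var (param_vec \<theta> \<beta>)))) \<and>
        (CARD('k) = 1 \<longrightarrow>
           (AE \<theta> in lebesgue. \<forall>k.
              crb (fim_dig pos s var (param_vec \<theta> \<beta>)) $ k $ k
              < crb (fim pos s var (param_vec \<theta> \<beta>) F) $ k $ k)))
    \<and>
    (\<forall>\<theta> :: real^'k. admissible pos \<theta> \<longrightarrow>
       (\<exists>G :: complex^'n^'l. G \<in> F_MiLAC \<and> rank G = CARD('l) \<and>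
          target_space pos \<theta> \<subseteq> row_space G \<and>
          crb_defined (fim pos s var (param_vec \<theta> \<beta>) G) \<and>
          crb (fim pos s var (param_vec \<theta> \<beta>) G)
            = crb (fim_dig pos s var (param_vec \<theta> \<beta>))))"
proof (intro conjI)
  have inj: "inj pos" using pos by (rule bij_betw_imp_inj_on)
  have K: "1 \<le> CARD('k)" by (simp add: Suc_leI)
  note ctx = \<beta> s var
  let ?dig = "\<lambda>\<theta>. fim_dig pos s var (param_vec \<theta> \<beta>)"
  let ?fim = "\<lambda>\<theta> M. fim pos s var (param_vec \<theta> \<beta>) (M :: complex^'n^'l)"
  note dig_adm = pos_def_dig[OF ctx admissible_independent]
  show "\<forall>(\<theta> :: real^'k) (F :: complex^'n^'l).
        admissible pos \<theta> \<longrightarrow> F \<in> F_PS \<longrightarrow> rank F = CARD('l) \<longrightarrow>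
        (let J_dig = ?dig \<theta>; J_PS = ?fim \<theta> F
         in crb_defined J_dig \<and>
            pos_semidef (J_dig - J_PS) \<and>
            (crb_defined J_PS \<longrightarrow> pos_semidef (crb J_PS - crb J_dig)) \<and>
            (J_PS = J_dig \<longleftrightarrow> target_space pos \<theta> \<subseteq> row_space F) \<and>
            (J_PS = J_dig \<and> crb_defined J_PS \<and> crb J_PS = crb J_dig \<longleftrightarrow>
               target_space pos \<theta> \<subseteq> row_space F))"
    unfolding Let_def
  proof (intro allI impI)
    fix \<theta> :: "real^'k" and F :: "complex^'n^'l"
    assume adm: "admissible pos \<theta>" and F: "rank F = CARD('l)"
    have dig: "crb_defined (?dig \<theta>)"
      by (intro crb_defined_pos_def dig_adm[OF adm])
    have diff: "pos_semidef (?dig \<theta> - ?fim \<theta> F)" by (rule semidef_diff[OF ctx F])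
    have "pos_semidef (crb (?fim \<theta> F) - crb (?dig \<theta>))" if "crb_defined (?fim \<theta> F)"
      by (rule crb_antitone(1)[OF that semidef_comb[OF ctx F] dig semidef_dig[OF ctx] diff])
    then show "crb_defined (?dig \<theta>) \<and> pos_semidef (?dig \<theta> - ?fim \<theta> F) \<and>
        (crb_defined (?fim \<theta> F) \<longrightarrow> pos_semidef (crb (?fim \<theta> F) - crb (?dig \<theta>))) \<and>
        (?fim \<theta> F = ?dig \<theta> \<longleftrightarrow> target_space pos \<theta> \<subseteq> row_space F) \<and>
        (?fim \<theta> F = ?dig \<theta> \<and> crb_defined (?fim \<theta> F) \<and> crb (?fim \<theta> F) = crb (?dig \<theta>) \<longleftrightarrow>
           target_space pos \<theta> \<subseteq> row_space F)"
      \<comment> \<open>An equal information matrix brings a defined and equal bound with it, so the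
        second equivalence reduces to the first.\<close>
      using dig diff fim_eq_iff[OF ctx F, of pos \<theta>] by auto
  qed
  show "R_PS TYPE('l) \<subseteq> (grassmannian CARD('l) :: (complex^'n) set set)"
    using row_space_grassmannian by (auto simp: R_PS_def)
  show "CARD('q) = CARD('l) * (CARD('n) - 1) \<longrightarrow>
        real_dof_at_most TYPE(real^'q) TYPE('l) (R_PS TYPE('l) :: (complex^'n) set set)"
    using real_dof_R_PS by blast
  show "manifold_dim (gr_topology CARD('l) :: (complex^'n) set topology)
       (2 * CARD('l) * (CARD('n) - CARD('l)))"
    by (rule manifold_dim_grassmannian)
  have L0: "0 < CARD('l)" by simp
  have LN: "CARD('l) < CARD('n)" using N L0 by linarith
  show "int (2 * CARD('l) * (CARD('n) - CARD('l))) - int (CARD('l) * (CARD('n) - 1))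
       = reach_deficit CARD('l) CARD('n)"
    using LN by (simp add: reach_deficit_def of_nat_diff algebra_simps)
  have "0 < int CARD('n) - 2 * int CARD('l) + 1" using N by linarith
  then show "reach_deficit CARD('l) CARD('n) > 0"
    unfolding reach_deficit_def using L0 by (intro mult_pos_pos) simp_all
  show "\<forall>\<mu> :: (complex^'n) set measure. gr_uniform CARD('l) \<mu> \<longrightarrow>
        (AE V in \<mu>. V \<notin> R_PS TYPE('l)) \<and> R_PS TYPE('l) \<in> null_sets \<mu>"
    using R_PS_null[OF _ N] by (auto intro: AE_not_in)
  show "\<forall>F :: complex^'n^'l. F \<in> F_PS \<longrightarrow> rank F = CARD('l) \<longrightarrow>
        row_space F \<noteq> UNIV \<and>
        (\<forall>x :: real. steer pos x \<in> row_space F \<longrightarrow>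
           x isolated_in {y. steer pos y \<in> row_space F}) \<and>
        {\<theta> :: real^'k. target_space pos \<theta> \<subseteq> row_space F} \<in> null_sets lebesgue \<and>
        (AE \<theta> in lebesgue. crb_defined (?dig \<theta>) \<and> crb_defined (?fim \<theta> F) \<and>
           pos_def (crb (?fim \<theta> F) - crb (?dig \<theta>))) \<and>
        (CARD('k) = 1 \<longrightarrow>
           (AE \<theta> in lebesgue. \<forall>k. crb (?dig \<theta>) $ k $ k < crb (?fim \<theta> F) $ k $ k))"
  proof (intro allI impI)
    fix F :: "complex^'n^'l"
    assume F: "rank F = CARD('l)"
    let ?W = "row_space F"
    have dimW: "vec.dim ?W = CARD('l)"
      using row_space_grassmannian[OF F] by (simp add: grassmannian_def)
    obtain X where X: "vec.subspace X" "vec.dim X + vec.dim ?W = CARD('n)"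
      "\<And>u v. u \<in> X \<Longrightarrow> v \<in> ?W \<Longrightarrow> hinner u v = 0"
      using orthogonal_complement[OF subspace_row_space] by blast
    \<comment> \<open>Off the first set no nonzero combination lies in the row space; off the second
      none is orthogonal to all of it.\<close>
    define D where "D = (degenerate pos X UNIV \<union> degenerate pos ?W UNIV :: (real^'k) set)"
    \<comment> \<open>The complement has dimension
      \<open>CARD('n) - CARD('l) \<ge> CARD('l) \<ge> 2 * CARD('k)\<close>.\<close>
    have "2 * card (UNIV :: 'k set) \<le> vec.dim X" "2 * card (UNIV :: 'k set) \<le> vec.dim ?W"
      using X(2) dimW N L by linarith+
    then have "D \<in> null_sets lborel"
      unfolding D_def using degenerate_null[OF inj X(1)] degenerate_null[OF inj subspace_row_space]
      by (intro null_sets.Un) blast+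
    then have D: "D \<in> null_sets lebesgue" by (rule null_sets_completionI)
    have ne: "?W \<noteq> UNIV"
    proof
      assume "?W = UNIV"
      then have "vec.dim ?W = CARD('n)" by (simp only: vec_dim_card)
      then show False using dimW LN by linarith
    qed
    have iso: "\<forall>x. steer pos x \<in> ?W \<longrightarrow> x isolated_in {y. steer pos y \<in> ?W}"
      using steer_isolated[OF inj subspace_row_space, of F] dimW LN by simp
    have null: "{\<theta> :: real^'k. target_space pos \<theta> \<subseteq> ?W} \<in> null_sets lebesgue"
    proof (rule null_sets_completion_subset[OF _ D], rule subsetI)
      fix \<theta> :: "real^'k" assume "\<theta> \<in> {\<theta>. target_space pos \<theta> \<subseteq> ?W}"
      then have sub: "target_space pos \<theta> \<subseteq> ?W" by simp
      obtain k :: 'k where True by simp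
      \<comment> \<open>One steering vector in the row space is already a dependence over the
        complement, with coefficient 1 at a single target.\<close>
      let ?y = "\<lambda>j. if j = k then 1 else 0 :: complex"
      have "steer pos (\<theta> $ k) \<in> target_space pos \<theta>"
        unfolding target_space_def by (intro vec.span_base) auto
      then have "steer pos (\<theta> $ k) \<in> ?W" using sub by blast
      moreover have "lin_comb pos \<theta> (\<lambda>j. 0) ?y = (\<Sum>j\<in>UNIV. if j = k then steer pos (\<theta> $ k) else 0)"
        unfolding lin_comb_def by (intro sum.cong) auto
      ultimately have "lin_comb pos \<theta> (\<lambda>j. 0) ?y \<in> ?W" by simp
      then have "\<forall>v\<in>X. hinner v (lin_comb pos \<theta> (\<lambda>j. 0) ?y) = 0" using X(3) by blast
      moreover have "\<exists>j. ?y j \<noteq> 0" by auto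
      ultimately have "\<theta> \<in> degenerate pos X UNIV"
        unfolding degenerate_def by (intro CollectI exI[of _ "\<lambda>j. 0"] exI[of _ ?y]) simp
      then show "\<theta> \<in> D" by (simp add: D_def)
    qed
    have gap: "crb_defined (?dig \<theta>) \<and> crb_defined (?fim \<theta> F) \<and> pos_def (crb (?fim \<theta> F) - crb (?dig \<theta>))"
      if "\<theta> \<notin> D" for \<theta> :: "real^'k"
    proof -
      have nX: "\<theta> \<notin> degenerate pos X UNIV" and nW: "\<theta> \<notin> degenerate pos ?W UNIV"
        using that by (auto simp: D_def)
      have indX: "(\<forall>k. x k = 0) \<and> (\<forall>k. y k = 0)" if "lin_comb pos \<theta> x y \<in> ?W" for x y
        using X(3) that by (intro not_degenerate[OF nX])
      have dig: "pos_def (?dig \<theta>)"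
      proof (rule pos_def_dig[OF ctx])
        fix x y assume "lin_comb pos \<theta> x y = 0"
        then have "lin_comb pos \<theta> x y \<in> ?W" using vec.subspace_0[OF subspace_row_space, of F] by simp
        then show "(\<forall>k. x k = 0) \<and> (\<forall>k. y k = 0)" by (rule indX)
      qed
      have comb: "pos_def (?fim \<theta> F)"
        by (rule pos_def_comb[OF ctx F]) (rule not_degenerate[OF nW])
      have diff: "pos_def (?dig \<theta> - ?fim \<theta> F)"
        by (rule pos_def_diff[OF ctx F indX])
      note def = crb_defined_pos_def[OF comb] crb_defined_pos_def[OF dig]
      show ?thesis
        using crb_antitone(2)[OF def(1) pos_def_imp_semidef[OF comb] def(2) pos_def_imp_semidef[OF dig] diff] def
        by blast
    qed
    have ae: "AE \<theta> in lebesgue. \<theta> \<notin> D" using D by (rule AE_not_in)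
    have ae1: "AE \<theta> in lebesgue. crb_defined (?dig \<theta>) \<and> crb_defined (?fim \<theta> F) \<and>
        pos_def (crb (?fim \<theta> F) - crb (?dig \<theta>))"
      using ae by (rule eventually_mono) (rule gap)
    \<comment> \<open>The form at a unit vector is a diagonal entry, which for one target is the
      whole bound.\<close>
    have diag: "A $ k $ k < B $ k $ k" if "pos_def (B - A)" for A B :: "real^'k^'k" and k
    proof -
      have "axis k 1 \<bullet> ((B - A) *v axis k 1) = (B - A) $ k $ k"
        unfolding inner_axis' by (simp add: matrix_vector_mult_def axis_def if_distrib cong: if_cong)
      moreover have "axis k (1::real) \<noteq> 0" by (simp add: axis_eq_0_iff)
      then have "0 < axis k 1 \<bullet> ((B - A) *v axis k 1)" using that unfolding pos_def_def by blast
      ultimately show ?thesis by simp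
    qed
    have ae2: "AE \<theta> in lebesgue. \<forall>k. crb (?dig \<theta>) $ k $ k < crb (?fim \<theta> F) $ k $ k"
      using ae1 by (rule eventually_mono) (intro allI diag, elim conjE)
    show "?W \<noteq> UNIV \<and>
        (\<forall>x :: real. steer pos x \<in> ?W \<longrightarrow> x isolated_in {y. steer pos y \<in> ?W}) \<and>
        {\<theta> :: real^'k. target_space pos \<theta> \<subseteq> ?W} \<in> null_sets lebesgue \<and>
        (AE \<theta> in lebesgue. crb_defined (?dig \<theta>) \<and> crb_defined (?fim \<theta> F) \<and>
           pos_def (crb (?fim \<theta> F) - crb (?dig \<theta>))) \<and>
        (CARD('k) = 1 \<longrightarrow>
           (AE \<theta> in lebesgue. \<forall>k. crb (?dig \<theta>) $ k $ k < crb (?fim \<theta> F) $ k $ k))"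
      by (intro conjI impI ne iso null ae1 ae2)
  qed
  show "\<forall>\<theta> :: real^'k. admissible pos \<theta> \<longrightarrow>
       (\<exists>G :: complex^'n^'l. G \<in> F_MiLAC \<and> rank G = CARD('l) \<and>
          target_space pos \<theta> \<subseteq> row_space G \<and>
          crb_defined (?fim \<theta> G) \<and> crb (?fim \<theta> G) = crb (?dig \<theta>))"
  proof (intro allI impI)
    fix \<theta> :: "real^'k" assume adm: "admissible pos \<theta>"
    have "vec.subspace (target_space pos \<theta>)" by (simp add: target_space_def)
    moreover have "vec.dim (target_space pos \<theta>) \<le> CARD('l)"
      using adm L by (simp add: admissible_def)
    ultimately obtain G :: "complex^'n^'l" where G: "G \<in> F_MiLAC" "rank G = CARD('l)"
      "target_space pos \<theta> \<subseteq> row_space G"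
      using ex_milac less_imp_le[OF LN] by blast
    \<comment> \<open>Equality holds for the full information matrix, so definedness and the value
      of the bound transfer together.\<close>
    have "?fim \<theta> G = ?dig \<theta>" using fim_eq_iff[OF ctx G(2)] G(3) by blast
    moreover have "crb_defined (?dig \<theta>)" by (intro crb_defined_pos_def dig_adm[OF adm])
    ultimately show "\<exists>G :: complex^'n^'l. G \<in> F_MiLAC \<and> rank G = CARD('l) \<and>
          target_space pos \<theta> \<subseteq> row_space G \<and>
          crb_defined (?fim \<theta> G) \<and> crb (?fim \<theta> G) = crb (?dig \<theta>)"
      using G by (intro exI[of _ G]) simp
  qed
qed

end
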